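(* Let $\Omega\subset\mathbb R^2$ be a bounded simply connected domain with $C^2$ boundary $\Gamma$, let $T>0$, let $\psi\in L^2(0,T;W^{3,\infty}(\Omega))$ satisfy $\psi(t,\cdot)|_\Gamma=0$, and let $\gamma_0\in W^{2,\infty}([0,1];\Omega)$ be a parameterization of an initial material interface. Let $\Phi_\psi$ be the flow map of $\mathbf v=\nabla^\perp\psi$, set $X(t,s):=\Phi_\psi(t;\gamma_0(s))$ for $(t,s)\in[0,T]\times[0,1]$, and $a(t,s):=\partial_sX(t,s)$. Then the pair $(X,a)$ satisfies the coupled ODE system $$\partial_tX(t,s)=J\nabla_x\psi(t,X(t,s)),\qquad \partial_ta(t,s)=J\nabla_x^2\psi(t,X(t,s))\,a(t,s),$$ $$X(0,s)=\gamma_0(s),\qquad a(0,s)=\gamma_0'(s).$$ Moreover, the length of the advected interface $s\mapsto X(t,s)$, $s\in[0,1]$, at time $t$ is $$\mathcal L(\psi;t)=\int_0^1|a(t,s)|\,ds.$$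
   Context: $J=\begin{pmatrix}0&-1\\1&0\end{pmatrix}$, and $\nabla^\perp\psi:=(-\partial_{x_2}\psi,\partial_{x_1}\psi)=J\nabla_x\psi$. $\nabla_x^2\psi$ denotes the Hessian matrix in $x$. The flow map $\Phi_\psi(t;x)$, $x\in\Omega$, is the solution of $\frac{d}{dt}\Phi_\psi(t;x)=J\nabla_x\psi(t,\Phi_\psi(t;x))$, $\Phi_\psi(0;x)=x$. The ODEs are understood in the Carathéodory (integral) sense: for each $s$, $X(\cdot,s)$ and $a(\cdot,s)$ are absolutely continuous and the equations hold for a.e. $t\in(0,T)$. The functions $\nabla_x\psi(t,\cdot)$, $\nabla_x^2\psi(t,\cdot)$ and $\gamma_0'$ are taken to be their continuous representatives. The length of a curve is the usual arc length of the parameterized curve. *)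

theory Defs
  imports "HOL-Analysis.Analysis" "HOL-Probability.Essential_Supremum"
begin

text \<open>Multi-indices are rendered as lists of basis vectors: the list \<open>[b1, ..., bm]\<close> stands for
  the partial derivative of order \<open>m\<close> in the directions \<open>b1, ..., bm\<close>.\<close>

primrec iter_deriv ::
  "'a::euclidean_space list \<Rightarrow> ('a \<Rightarrow> 'b::real_normed_vector) \<Rightarrow> 'a \<Rightarrow> 'b" where
  "iter_deriv [] f = f"
| "iter_deriv (b # bs) f = (\<lambda>x. frechet_derivative (iter_deriv bs f) (at x) b)"

definition multi_indices :: "nat \<Rightarrow> 'a::euclidean_space list set" where
  "multi_indices k = {bs \<in> lists Basis. length bs \<le> k}"

definition C_k :: "nat \<Rightarrow> ('a::euclidean_space \<Rightarrow> 'b::real_normed_vector) \<Rightarrow> bool" where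
  "C_k k f \<longleftrightarrow>
     (\<forall>bs \<in> multi_indices k. continuous_on UNIV (iter_deriv bs f)) \<and>
     (\<forall>bs \<in> multi_indices k. length bs < k \<longrightarrow> iter_deriv bs f differentiable_on UNIV)"

definition test_function :: "'a::euclidean_space set \<Rightarrow> ('a \<Rightarrow> real) \<Rightarrow> bool" where
  "test_function \<Omega> \<phi> \<longleftrightarrow>
     (\<forall>k. C_k k \<phi>) \<and> compact (closure {x. \<phi> x \<noteq> 0}) \<and> closure {x. \<phi> x \<noteq> 0} \<subseteq> \<Omega>"

definition locally_integrable_on ::
  "('a::euclidean_space \<Rightarrow> 'b::euclidean_space) \<Rightarrow> 'a set \<Rightarrow> bool" where
  "locally_integrable_on u \<Omega> \<longleftrightarrow>
     (\<forall>K. compact K \<longrightarrow> K \<subseteq> \<Omega> \<longrightarrow> u absolutely_integrable_on K)"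

definition has_weak_deriv ::
  "'a::euclidean_space set \<Rightarrow> 'a list \<Rightarrow> ('a \<Rightarrow> 'b::euclidean_space) \<Rightarrow> ('a \<Rightarrow> 'b) \<Rightarrow> bool" where
  "has_weak_deriv \<Omega> bs u v \<longleftrightarrow>
     locally_integrable_on u \<Omega> \<and> locally_integrable_on v \<Omega> \<and>
     (\<forall>\<phi>. test_function \<Omega> \<phi> \<longrightarrow>
        (LINT x:\<Omega>|lebesgue. iter_deriv bs \<phi> x *\<^sub>R u x) =
        (- 1) ^ length bs *\<^sub>R (LINT x:\<Omega>|lebesgue. \<phi> x *\<^sub>R v x))"

text \<open>The weak derivative is determined up to null sets, and only properties invariant under
  changes on null sets are used below.\<close>

definition weak_deriv ::
  "'a::euclidean_space set \<Rightarrow> 'a list \<Rightarrow> ('a \<Rightarrow> 'b::euclidean_space) \<Rightarrow> 'a \<Rightarrow> 'b" where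
  "weak_deriv \<Omega> bs u = (SOME v. has_weak_deriv \<Omega> bs u v)"

definition Linf_norm ::
  "'a::euclidean_space set \<Rightarrow> ('a \<Rightarrow> 'b::euclidean_space) \<Rightarrow> ennreal" where
  "Linf_norm \<Omega> f = esssup (lebesgue_on \<Omega>) (\<lambda>x. ennreal (norm (f x)))"

definition Linf :: "'a::euclidean_space set \<Rightarrow> ('a \<Rightarrow> 'b::euclidean_space) set" where
  "Linf \<Omega> = {f \<in> borel_measurable (lebesgue_on \<Omega>). Linf_norm \<Omega> f < \<infinity>}"

definition sobolev_inf ::
  "nat \<Rightarrow> 'a::euclidean_space set \<Rightarrow> ('a \<Rightarrow> 'b::euclidean_space) set" where
  "sobolev_inf k \<Omega> = {u. \<forall>bs \<in> multi_indices k. \<exists>v \<in> Linf \<Omega>. has_weak_deriv \<Omega> bs u v}"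

definition sobolev_inf_norm ::
  "nat \<Rightarrow> 'a::euclidean_space set \<Rightarrow> ('a \<Rightarrow> 'b::euclidean_space) \<Rightarrow> ennreal" where
  "sobolev_inf_norm k \<Omega> u = (SUP bs \<in> multi_indices k. Linf_norm \<Omega> (weak_deriv \<Omega> bs u))"

text \<open>Continuous representative on \<open>S\<close>. When \<open>S\<close> is open or a nondegenerate interval, it is
  unique on \<open>S\<close> whenever it exists; its values outside \<open>S\<close> are irrelevant.\<close>

definition cont_rep ::
  "'a::euclidean_space set \<Rightarrow> ('a \<Rightarrow> 'b::euclidean_space) \<Rightarrow> 'a \<Rightarrow> 'b" where
  "cont_rep S f = (SOME w. continuous_on S w \<and> (AE x in lebesgue_on S. w x = f x))"

text \<open>As \<open>u\<close> is only determined almost everywhere in \<open>\<Omega>\<close>, its boundary values are those of the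
  continuous extension of its class to the closure.\<close>

definition vanishes_on_frontier ::
  "'a::euclidean_space set \<Rightarrow> ('a \<Rightarrow> 'b::euclidean_space) \<Rightarrow> bool" where
  "vanishes_on_frontier \<Omega> u \<longleftrightarrow>
     (\<exists>w. continuous_on (closure \<Omega>) w \<and> (AE x in lebesgue_on \<Omega>. w x = u x) \<and>
          (\<forall>x \<in> frontier \<Omega>. w x = 0))"

text \<open>Strong measurability: almost everywhere limit, in the norm of \<open>W^{k,\<infinity>}(\<Omega>)\<close>, of simple
  functions with values in \<open>W^{k,\<infinity>}(\<Omega>)\<close>.\<close>

definition strongly_measurable_sobolev ::
  "real \<Rightarrow> nat \<Rightarrow> 'a::euclidean_space set \<Rightarrow> (real \<Rightarrow> 'a \<Rightarrow> real) \<Rightarrow> bool" where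
  "strongly_measurable_sobolev T k \<Omega> \<psi> \<longleftrightarrow>
     (AE t in lebesgue_on {0<..<T}. \<psi> t \<in> sobolev_inf k \<Omega>) \<and>
     (\<exists>\<sigma> :: nat \<Rightarrow> real \<Rightarrow> 'a \<Rightarrow> real.
        (\<forall>n. simple_function (lebesgue_on {0<..<T}) (\<sigma> n) \<and>
             \<sigma> n ` {0<..<T} \<subseteq> sobolev_inf k \<Omega>) \<and>
        (AE t in lebesgue_on {0<..<T}.
           (\<lambda>n. sobolev_inf_norm k \<Omega> (\<lambda>x. \<sigma> n t x - \<psi> t x)) \<longlonglongrightarrow> 0))"

definition L2_sobolev ::
  "real \<Rightarrow> nat \<Rightarrow> 'a::euclidean_space set \<Rightarrow> (real \<Rightarrow> 'a \<Rightarrow> real) set" where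
  "L2_sobolev T k \<Omega> =
     {\<psi>. strongly_measurable_sobolev T k \<Omega> \<psi> \<and>
         (\<integral>\<^sup>+ t. (sobolev_inf_norm k \<Omega> (\<psi> t))\<^sup>2 \<partial>lebesgue_on {0<..<T}) < \<infinity>}"

text \<open>Near each boundary point, after an orthogonal change of coordinates, the domain is the
  region strictly above the graph of a \<open>C^2\<close> function.\<close>

definition C2_boundary :: "(real^2) set \<Rightarrow> bool" where
  "C2_boundary \<Omega> \<longleftrightarrow>
     (\<forall>p \<in> frontier \<Omega>. \<exists>r>0. \<exists>Q :: real^2 \<Rightarrow> real^2. \<exists>g :: real \<Rightarrow> real.
        orthogonal_transformation Q \<and> C_k 2 g \<and>
        \<Omega> \<inter> ball p r = {x \<in> ball p r. Q x $ 2 > g (Q x $ 1)})"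

definition J :: "real^2^2" where
  "J = vector [vector [0, -1], vector [1, 0]]"

definition grad :: "(real^2) set \<Rightarrow> (real^2 \<Rightarrow> real) \<Rightarrow> real^2 \<Rightarrow> real^2" where
  "grad \<Omega> u x = (\<chi> i. cont_rep \<Omega> (weak_deriv \<Omega> [axis i 1] u) x)"

definition hessian :: "(real^2) set \<Rightarrow> (real^2 \<Rightarrow> real) \<Rightarrow> real^2 \<Rightarrow> real^2^2" where
  "hessian \<Omega> u x = (\<chi> i j. cont_rep \<Omega> (weak_deriv \<Omega> [axis i 1, axis j 1] u) x)"

text \<open>Absolute continuity of a function of one real variable; a division consists of finitely many
  nonoverlapping compact intervals. (The library constant \<^const>\<open>absolutely_continuous\<close> is about
  measures.)\<close>

definition abs_cont_on :: "real set \<Rightarrow> (real \<Rightarrow> 'a::metric_space) \<Rightarrow> bool" where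
  "abs_cont_on S f \<longleftrightarrow>
     (\<forall>\<epsilon>>0. \<exists>\<delta>>0. \<forall>D. D division_of \<Union>D \<and> \<Union>D \<subseteq> S \<and> (\<Sum>K\<in>D. Sup K - Inf K) < \<delta> \<longrightarrow>
        (\<Sum>K\<in>D. dist (f (Inf K)) (f (Sup K))) < \<epsilon>)"

definition caratheodory_solution ::
  "(real \<Rightarrow> 'a \<Rightarrow> 'a) \<Rightarrow> real \<Rightarrow> (real \<Rightarrow> 'a::real_normed_vector) \<Rightarrow> bool" where
  "caratheodory_solution F T y \<longleftrightarrow>
     abs_cont_on {0..T} y \<and>
     (AE t in lebesgue_on {0<..<T}. (y has_vector_derivative F t (y t)) (at t))"

text \<open>The gradient is only meaningful on \<open>\<Omega>\<close>, so a trajectory has to stay there.\<close>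

definition is_flow_map ::
  "(real^2) set \<Rightarrow> real \<Rightarrow> (real \<Rightarrow> real^2 \<Rightarrow> real) \<Rightarrow> (real \<Rightarrow> real^2 \<Rightarrow> real^2) \<Rightarrow> bool" where
  "is_flow_map \<Omega> T \<psi> \<Phi> \<longleftrightarrow>
     (\<forall>x \<in> \<Omega>.
        (\<forall>t \<in> {0..T}. \<Phi> t x \<in> \<Omega>) \<and>
        caratheodory_solution (\<lambda>t y. J *v grad \<Omega> (\<psi> t) y) T (\<lambda>t. \<Phi> t x) \<and>
        \<Phi> 0 x = x)"

definition arc_length :: "real \<Rightarrow> real \<Rightarrow> (real \<Rightarrow> 'a::metric_space) \<Rightarrow> ennreal" where
  "arc_length a b c =
     (SUP D \<in> {D. D division_of {a..b}}. ennreal (\<Sum>K\<in>D. dist (c (Inf K)) (c (Sup K))))"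

end

theory Submission
  imports Defs
begin

text \<open>For almost every \<open>t\<close> the velocity \<open>V t = J \<nabla>\<psi>(t, \<cdot>)\<close> has a derivative \<open>A t = J \<nabla>\<^sup>2\<psi>(t, \<cdot>)\<close> in
  the space variable, and \<open>V t\<close> and \<open>A t\<close> are locally Lipschitz on \<open>\<Omega>\<close>, with a constant \<open>M t\<close> proportional
  to the norm of \<open>\<psi> t\<close> in \<open>W\<^sup>3\<^sup>,\<^sup>\<infinity>(\<Omega>)\<close>. The function \<open>M\<close> is square integrable, hence integrable, on
  \<open>(0, T)\<close>. The trajectories stay in \<open>\<Omega>\<close> by the definition of a flow map, so each of them has a tube of
  positive radius inside \<open>\<Omega>\<close>, and only local estimates are needed.

  By Gronwall's inequality with the coefficient \<open>M\<close>, two trajectories that start close enough to each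
  other separate at most by the factor \<open>exp (\<integral> M)\<close>. The quotients
  \<open>D\<^sub>\<sigma>(t) = (X(t, \<sigma>) - X(t, s)) / (\<sigma> - s)\<close> satisfy
  \<open>\<partial>\<^sub>t D\<^sub>\<sigma> = A(t, X(t, s)) D\<^sub>\<sigma> + O(M(t) \<bar>\<sigma> - s\<bar>)\<close>, by the second-order Taylor estimate for \<open>V\<close>. A further
  application of Gronwall's inequality shows that they are Cauchy as \<open>\<sigma> \<longlongrightarrow> s\<close>, uniformly in \<open>t\<close>. The limit
  is \<open>a(t, s) = \<partial>\<^sub>s X(t, s)\<close>, and dominated convergence turns the equations for \<open>D\<^sub>\<sigma>\<close> into
  \<open>a(t, s) = \<gamma>\<^sub>0'(s) + \<integral>\<^sub>0\<^sup>t A(r, X(r, s)) a(r, s) dr\<close> (\<open>flow_differentiable_in_parameter\<close>). Lebesgue's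
  differentiation theorem gives the differential equation for almost every \<open>t\<close>. Neither the existence theory for
  linear equations nor the measurability of \<open>\<nabla>\<^sup>2\<psi>\<close> along trajectories is needed, as both come out of the limit.
  Gronwall's inequality also makes \<open>a(t, \<cdot>)\<close> continuous (\<open>linearized_stable\<close>), so that \<open>X(t, \<cdot>)\<close> is a curve of class \<open>C\<^sup>1\<close>, whose
  arc length is the integral of its speed (\<open>arc_length_eq_integral\<close>).

  The estimates for \<open>V\<close> and \<open>A\<close> translate weak derivatives into pointwise statements. Let \<open>u\<close> have
  the weak derivative \<open>d\<close> in the direction of the basis vector \<open>c\<close>. Testing with smooth approximations of the indicator function of
  a cube shows that the integrals of \<open>u\<close> over two cubes translated by \<open>h c\<close> differ by
  the increment that \<open>d\<close> predicts (\<open>cube_integral_increment\<close>). Averages of \<open>u\<close> over small cubes are therefore uniformly Lipschitz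
  if all such \<open>d\<close> are bounded. They converge to \<open>u\<close> almost everywhere, so \<open>u\<close> has a continuous representative
  (\<open>continuous_representative_exists\<close>), and its increments are controlled by the values of the \<open>d\<close>
  (\<open>continuous_representative_increment\<close>). The same theorems, in dimension one, show that \<open>\<gamma>\<^sub>0\<close> is of
  class \<open>C\<^sup>1\<close> up to the end points.\<close>

section \<open>Absolutely continuous functions\<close>

lemma AE_lebesgue_on_iff_negligible:
  assumes "S \<in> sets lebesgue"
  shows "(AE x in lebesgue_on S. P x) \<longleftrightarrow> (\<exists>N. negligible N \<and> (\<forall>x \<in> S - N. P x))"
  using assms
  by (force simp: AE_restrict_space_iff eventually_ae_filter_negligible)

lemma AE_lebesgue_onI:
  assumes "S \<in> sets lebesgue" "negligible N" "\<And>x. x \<in> S \<Longrightarrow> x \<notin> N \<Longrightarrow> P x"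
  shows "AE x in lebesgue_on S. P x"
  using assms by (auto simp: AE_lebesgue_on_iff_negligible)

lemma AE_lebesgue_onE:
  assumes "AE x in lebesgue_on S. P x" "S \<in> sets lebesgue"
  obtains N where "negligible N" "\<And>x. x \<in> S \<Longrightarrow> x \<notin> N \<Longrightarrow> P x"
  using assms by (auto simp: AE_lebesgue_on_iff_negligible)

lemma AE_lebesgue_on_subset:
  assumes "AE t in lebesgue_on S. P t" "R \<subseteq> S" "R \<in> sets lebesgue" "S \<in> sets lebesgue"
  shows "AE t in lebesgue_on R. P t"
  using assms by (auto simp: AE_lebesgue_on_iff_negligible)

lemma abs_cont_on_subset: "abs_cont_on S f \<Longrightarrow> R \<subseteq> S \<Longrightarrow> abs_cont_on R f"
  unfolding abs_cont_on_def
proof (intro allI impI)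
  fix e :: real
  assume ac: "\<forall>\<epsilon>>0. \<exists>\<delta>>0. \<forall>D. D division_of \<Union>D \<and> \<Union>D \<subseteq> S \<and> (\<Sum>K\<in>D. Sup K - Inf K) < \<delta> \<longrightarrow>
      (\<Sum>K\<in>D. dist (f (Inf K)) (f (Sup K))) < \<epsilon>" and RS: "R \<subseteq> S" and e: "0 < e"
  obtain \<delta> where "\<delta> > 0" and \<delta>: "\<And>D. D division_of \<Union>D \<and> \<Union>D \<subseteq> S \<and> (\<Sum>K\<in>D. Sup K - Inf K) < \<delta> \<Longrightarrow>
      (\<Sum>K\<in>D. dist (f (Inf K)) (f (Sup K))) < e"
    using ac[rule_format, OF e] by blast
  then show "\<exists>\<delta>>0. \<forall>D. D division_of \<Union>D \<and> \<Union>D \<subseteq> R \<and> (\<Sum>K\<in>D. Sup K - Inf K) < \<delta> \<longrightarrow>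
      (\<Sum>K\<in>D. dist (f (Inf K)) (f (Sup K))) < e"
    using RS by (intro exI[of _ \<delta>] conjI allI impI \<delta>) auto
qed

lemma vector_derivative_straddle:
  fixes f :: "real \<Rightarrow> 'b::real_normed_vector"
  assumes der: "(f has_vector_derivative D) (at x within S)" and e: "e > 0"
  obtains d where "d > 0"
    "\<And>u v. \<lbrakk>u \<le> x; x \<le> v; u \<in> S; v \<in> S; {u..v} \<subseteq> ball x d\<rbrakk>
       \<Longrightarrow> norm (f v - f u - (v - u) *\<^sub>R D) \<le> e * (v - u)"
proof -
  from der e obtain d where d: "d > 0" and
    le: "\<And>y. y \<in> S \<Longrightarrow> norm (y - x) < d \<Longrightarrow> norm (f y - f x - (y - x) *\<^sub>R D) \<le> e * norm (y - x)"
    unfolding has_vector_derivative_def has_derivative_within_alt by blast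
  show ?thesis
  proof (rule that[OF d])
    fix u v assume uv: "u \<le> x" "x \<le> v" "u \<in> S" "v \<in> S" "{u..v} \<subseteq> ball x d"
    then have "u \<in> ball x d" "v \<in> ball x d" by (meson atLeastAtMost_iff order_refl order_trans subsetD)+
    then have 1: "norm (f v - f x - (v - x) *\<^sub>R D) \<le> e * (v - x)"
      "norm (f u - f x - (u - x) *\<^sub>R D) \<le> e * (x - u)"
      using le[of v] le[of u] uv by (auto simp: dist_real_def)
    have "f v - f u - (v - u) *\<^sub>R D = (f v - f x - (v - x) *\<^sub>R D) - (f u - f x - (u - x) *\<^sub>R D)"
      by (simp add: algebra_simps)
    also have "norm \<dots> \<le> e * (v - x) + e * (x - u)"
      using norm_triangle_ineq4 1 by (smt (verit))
    finally show "norm (f v - f u - (v - u) *\<^sub>R D) \<le> e * (v - u)" by (simp add: algebra_simps)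
  qed
qed

lemma tagged_partial_division_degenerate:
  fixes p :: "(real \<times> real set) set"
  assumes "p tagged_partial_division_of S" "(x, K) \<in> p" "(y, K) \<in> p" "x \<noteq> y"
  shows "Inf K = Sup K"
proof -
  have "interior K \<inter> interior K = {}"
    using assms unfolding tagged_partial_division_of_def by blast
  moreover obtain a b where K: "K = cbox a b" "x \<in> K"
    using assms unfolding tagged_partial_division_of_def by blast
  ultimately have "a = b" by (auto simp: box_eq_empty interior_cbox not_less)
  then show ?thesis using K by simp
qed

lemma sum_tagged_eq_sum_division:
  fixes f :: "real \<Rightarrow> 'b::real_normed_vector"
  assumes p: "p tagged_partial_division_of S"
  shows "(\<Sum>(x, K)\<in>p. norm (f (Sup K) - f (Inf K))) = (\<Sum>K\<in>snd ` p. dist (f (Inf K)) (f (Sup K)))"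
proof -
  have "(\<Sum>K\<in>snd ` p. dist (f (Inf K)) (f (Sup K))) = sum ((\<lambda>K. dist (f (Inf K)) (f (Sup K))) \<circ> snd) p"
  proof (rule sum.reindex_nontrivial)
    show "finite p" using p by (auto simp: tagged_partial_division_of_def)
    show "dist (f (Inf (snd x))) (f (Sup (snd x))) = 0"
      if "x \<in> p" "y \<in> p" "x \<noteq> y" "snd x = snd y" for x y
      using that tagged_partial_division_degenerate[OF p, of "fst x" "snd x" "fst y"]
      by (metis dist_self prod.collapse)
  qed
  also have "\<dots> = (\<Sum>(x, K)\<in>p. norm (f (Sup K) - f (Inf K)))"
    by (rule sum.cong) (auto simp: dist_norm norm_minus_commute)
  finally show ?thesis by simp
qed

lemma division_length_eq_measure:
  fixes D :: "real set set"
  assumes "D division_of S"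
  shows "(\<Sum>K\<in>D. Sup K - Inf K) = measure lebesgue S"
proof -
  have "(\<Sum>K\<in>D. Sup K - Inf K) = (\<Sum>K\<in>D. measure lebesgue K)"
  proof (rule sum.cong)
    fix K assume "K \<in> D"
    then obtain a b where "K = cbox a b" "K \<noteq> {}" using division_ofD[OF assms] by metis
    then show "Sup K - Inf K = measure lebesgue K" by auto
  qed simp
  then show ?thesis using content_division[OF assms] by simp
qed

text \<open>The fundamental theorem of calculus for absolutely continuous functions. The derivative is a gauge
  integrand: at the tags in the exceptional null set it is replaced by zero, and absolute continuity controls the
  increments of \<open>f\<close> over the corresponding intervals, which lie in an open set of small measure.\<close>

theorem abs_cont_on_has_integral:
  fixes f :: "real \<Rightarrow> 'b::banach"
  assumes ab: "a \<le> b" and ac: "abs_cont_on {a..b} f"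
    and der: "AE t in lebesgue_on {a<..<b}. (f has_vector_derivative f' t) (at t)"
  shows "(f' has_integral (f b - f a)) {a..b}"
proof (cases "a = b")
  case True then show ?thesis by (simp add: has_integral_refl)
next
  case False
  with ab have ab: "a < b" by simp
  obtain N where N: "negligible N" "\<And>t. t \<in> {a<..<b} \<Longrightarrow> t \<notin> N \<Longrightarrow> (f has_vector_derivative f' t) (at t)"
    using der by (rule AE_lebesgue_onE) auto
  define E where "E = N \<union> {a, b}"
  have negE: "negligible E" using N by (auto simp: E_def)
  define g where "g t = (if t \<in> E then 0 else f' t)" for t
  have "(g has_integral (f b - f a)) {a..b}"
    unfolding has_integral_real
  proof (intro allI impI)
    fix e :: real assume e: "e > 0"
    obtain \<delta> where \<delta>: "\<delta> > 0" and D: "\<And>D. D division_of \<Union>D \<Longrightarrow> \<Union>D \<subseteq> {a..b} \<Longrightarrow>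
       (\<Sum>K\<in>D. Sup K - Inf K) < \<delta> \<Longrightarrow> (\<Sum>K\<in>D. dist (f (Inf K)) (f (Sup K))) < e / 2"
      using ac e unfolding abs_cont_on_def by (meson half_gt_zero)
    have E0: "E \<in> sets lebesgue" "emeasure lebesgue E = 0"
      using negE by (auto simp: negligible_iff_null_sets)
    obtain U where U: "open U" "E \<subseteq> U" "U - E \<in> lmeasurable" "emeasure lebesgue (U - E) < ennreal \<delta>"
      using sets_lebesgue_outer_open[OF E0(1) \<delta>] by metis
    have Us: "U \<in> lmeasurable" "measure lebesgue U < \<delta>"
    proof -
      have "U = (U - E) \<union> E" using U by auto
      then have U': "U \<in> lmeasurable"
        using U(3) negE by (metis negligible_imp_measurable fmeasurable.Un)
      have "emeasure lebesgue U = emeasure lebesgue (U - E)"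
        using E0 U(1) by (metis emeasure_Diff_null_set negE negligible_iff_null_sets fmeasurableD U')
      then show "measure lebesgue U < \<delta>"
        using U(4) U' \<delta> by (metis emeasure_eq_measure2 ennreal_less_iff measure_nonneg)
      show "U \<in> lmeasurable" by fact
    qed
    let ?e = "e / (2 * (b - a))"
    have e': "?e > 0" using e ab by simp
    have "\<exists>d>0. \<forall>u v. u \<le> t \<longrightarrow> t \<le> v \<longrightarrow> {u..v} \<subseteq> ball t d \<longrightarrow>
        norm (f v - f u - (v - u) *\<^sub>R f' t) \<le> ?e * (v - u)" if "t \<in> {a..b}" "t \<notin> E" for t
    proof -
      have "(f has_vector_derivative f' t) (at t)" using that N by (force simp: E_def)
      from vector_derivative_straddle[OF this e'] show ?thesis by (metis UNIV_I)
    qed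
    then obtain d where d: "\<And>t. t \<in> {a..b} \<Longrightarrow> t \<notin> E \<Longrightarrow> d t > 0"
      "\<And>t u v. t \<in> {a..b} \<Longrightarrow> t \<notin> E \<Longrightarrow> u \<le> t \<Longrightarrow> t \<le> v \<Longrightarrow> {u..v} \<subseteq> ball t (d t) \<Longrightarrow>
        norm (f v - f u - (v - u) *\<^sub>R f' t) \<le> ?e * (v - u)"
      by metis
    define \<gamma> where "\<gamma> t = (if t \<in> E then U else if t \<in> {a..b} then ball t (d t) else UNIV)" for t
    have gauge: "gauge \<gamma>" using d U unfolding gauge_def \<gamma>_def by auto
    have main: "norm ((\<Sum>(x, K)\<in>p. measure lborel K *\<^sub>R g x) - (f b - f a)) < e"
      if p: "p tagged_division_of {a..b}" and fine: "\<gamma> fine p" for p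
    proof -
      note pD = tagged_division_ofD[OF p]
      define q where "q = {(x, K) \<in> p. x \<in> E}"
      have fin: "finite p" "q \<subseteq> p" using pD by (auto simp: q_def)
      have eq: "(\<Sum>(x, K)\<in>p. measure lborel K *\<^sub>R g x) - (f b - f a) =
          (\<Sum>(x, K)\<in>p. measure lborel K *\<^sub>R g x - (f (Sup K) - f (Inf K)))"
        using additive_tagged_division_1[OF less_imp_le[OF ab] p, of f]
        by (simp add: sum_subtractf case_prod_unfold)
      have qpart: "q tagged_partial_division_of {a..b}"
        using tagged_partial_division_subset[OF _ fin(2)] p tagged_division_of_def by blast
      have 1: "norm (\<Sum>(x, K)\<in>q. measure lborel K *\<^sub>R g x - (f (Sup K) - f (Inf K))) < e / 2"
      proof -
        have "norm (\<Sum>(x, K)\<in>q. measure lborel K *\<^sub>R g x - (f (Sup K) - f (Inf K)))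
            \<le> (\<Sum>(x, K)\<in>q. norm (f (Sup K) - f (Inf K)))"
          by (rule order_trans[OF norm_sum sum_mono]) (auto simp: q_def g_def norm_minus_commute)
        also have "\<dots> = (\<Sum>K\<in>snd ` q. dist (f (Inf K)) (f (Sup K)))"
          by (rule sum_tagged_eq_sum_division[OF qpart])
        also have "\<dots> < e / 2"
        proof (rule D)
          show dq: "snd ` q division_of \<Union>(snd ` q)"
            by (rule partial_division_of_tagged_division[OF qpart])
          show "\<Union>(snd ` q) \<subseteq> {a..b}" using pD(3) fin(2) by force
          have sub: "\<Union>(snd ` q) \<subseteq> U" using fine unfolding fine_def q_def \<gamma>_def by fastforce
          have "(\<Sum>K\<in>snd ` q. Sup K - Inf K) = measure lebesgue (\<Union>(snd ` q))"
            by (rule division_length_eq_measure[OF dq])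
          also have "\<dots> \<le> measure lebesgue U"
            using sub Us lmeasurable_division[OF dq] by (intro measure_mono_fmeasurable) auto
          finally show "(\<Sum>K\<in>snd ` q. Sup K - Inf K) < \<delta>" using Us by simp
        qed
        finally show ?thesis .
      qed
      have 2: "norm (\<Sum>(x, K)\<in>p - q. measure lborel K *\<^sub>R g x - (f (Sup K) - f (Inf K))) \<le> e / 2"
      proof -
        have "norm (\<Sum>(x, K)\<in>p - q. measure lborel K *\<^sub>R g x - (f (Sup K) - f (Inf K)))
            \<le> (\<Sum>(x, K)\<in>p - q. ?e * measure lborel K)"
        proof (rule order_trans[OF norm_sum sum_mono], clarify)
          fix x K assume xK: "(x, K) \<in> p" "(x, K) \<notin> q"
          then have xE: "x \<notin> E" by (auto simp: q_def)
          obtain u v where K: "K = {u..v}" using pD(4)[OF xK(1)] by auto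
          have x: "u \<le> x" "x \<le> v" "x \<in> {a..b}" using pD(2,3)[OF xK(1)] K by auto
          have "{u..v} \<subseteq> ball x (d x)"
            using fine xK(1) K x xE unfolding fine_def \<gamma>_def by fastforce
          from d(2)[OF x(3) xE x(1,2) this]
          have "norm ((v - u) *\<^sub>R f' x - (f v - f u)) \<le> ?e * (v - u)"
            by (simp add: norm_minus_commute)
          then show "norm (measure lborel K *\<^sub>R g x - (f (Sup K) - f (Inf K))) \<le> ?e * measure lborel K"
            using K x xE by (simp add: g_def)
        qed
        also have "\<dots> \<le> (\<Sum>(x, K)\<in>p. ?e * measure lborel K)"
          using fin less_imp_le[OF e'] by (intro sum_mono2) (auto intro!: mult_nonneg_nonneg simp del: times_divide_eq_left)
        also have "\<dots> = ?e * (b - a)"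
          using additive_content_tagged_division[of p a b] p ab
          by (simp add: sum_distrib_left[symmetric] case_prod_unfold del: times_divide_eq_left)
        also have "\<dots> = e / 2" using ab by (simp add: field_simps)
        finally show ?thesis .
      qed
      have "norm ((\<Sum>(x, K)\<in>p. measure lborel K *\<^sub>R g x) - (f b - f a)) =
        norm ((\<Sum>(x, K)\<in>p - q. measure lborel K *\<^sub>R g x - (f (Sup K) - f (Inf K))) +
         (\<Sum>(x, K)\<in>q. measure lborel K *\<^sub>R g x - (f (Sup K) - f (Inf K))))"
        unfolding eq by (subst sum.subset_diff[OF fin(2) fin(1)]) simp
      also have "\<dots> < e" using norm_triangle_lt[of _ _ e] 1 2 by (smt (verit) field_sum_of_halves norm_triangle_ineq)
      finally show ?thesis .
    qed
    show "\<exists>\<gamma>. gauge \<gamma> \<and> (\<forall>\<D>. \<D> tagged_division_of {a..b} \<and> \<gamma> fine \<D> \<longrightarrow>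
        norm ((\<Sum>(x, k)\<in>\<D>. measure lborel k *\<^sub>R g x) - (f b - f a)) < e)"
      using gauge main by (intro exI[of _ \<gamma>]) simp
  qed
  then show ?thesis
    by (rule has_integral_spike[OF negE, rotated]) (auto simp: g_def)
qed


section \<open>Indefinite integrals\<close>

lemma absolutely_integrable_AE_bound:
  fixes f :: "real \<Rightarrow> 'b::euclidean_space"
  assumes f: "f integrable_on {a..b}" and M: "M integrable_on {a..b}"
    and bound: "AE t in lebesgue_on {a<..<b}. norm (f t) \<le> M t"
  shows "f absolutely_integrable_on {a..b}" "norm (integral {a..b} f) \<le> integral {a..b} M"
proof -
  obtain N where N: "negligible N" "\<And>t. t \<in> {a<..<b} \<Longrightarrow> t \<notin> N \<Longrightarrow> norm (f t) \<le> M t"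
    using bound by (rule AE_lebesgue_onE) auto
  define E where "E = N \<union> {a, b}"
  have E: "negligible E" using N by (auto simp: E_def)
  define f0 where "f0 t = (if t \<in> E then 0 else f t)" for t
  define M0 where "M0 t = (if t \<in> E then 0 else M t)" for t
  have le: "norm (f0 t) \<le> M0 t" if "t \<in> {a..b}" for t
  proof (cases "t \<in> E")
    case False
    then have "t \<in> {a<..<b}" using that by (auto simp: E_def less_le)
    then show ?thesis using N False by (auto simp: f0_def M0_def E_def)
  qed (simp add: f0_def M0_def)
  have i: "f0 integrable_on {a..b}" "M0 integrable_on {a..b}"
    using integrable_spike[OF f E, of f0] integrable_spike[OF M E, of M0] by (auto simp: f0_def M0_def)
  have a: "f0 absolutely_integrable_on {a..b}"
    by (rule absolutely_integrable_integrable_bound[OF le i])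
  show "f absolutely_integrable_on {a..b}"
    by (rule absolutely_integrable_spike[OF a E]) (auto simp: f0_def)
  have "integral {a..b} f = integral {a..b} f0" "integral {a..b} M = integral {a..b} M0"
    by (rule integral_spike[OF E]; simp add: f0_def M0_def)+
  then show "norm (integral {a..b} f) \<le> integral {a..b} M"
    using integral_norm_bound_integral[OF i le] by simp
qed

lemma dominated_convergence_AE:
  fixes f :: "nat \<Rightarrow> real \<Rightarrow> 'b::euclidean_space"
  assumes f: "\<And>n. f n integrable_on {a..b}" and h: "h integrable_on {a..b}"
    and le: "\<And>n. AE t in lebesgue_on {a<..<b}. norm (f n t) \<le> h t"
    and conv: "AE t in lebesgue_on {a<..<b}. (\<lambda>n. f n t) \<longlonglongrightarrow> g t"
  shows "g integrable_on {a..b}" "(\<lambda>n. integral {a..b} (f n)) \<longlonglongrightarrow> integral {a..b} g"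
proof -
  have "AE t in lebesgue_on {a<..<b}. (\<forall>n. norm (f n t) \<le> h t) \<and> (\<lambda>n. f n t) \<longlonglongrightarrow> g t"
    using le conv by (simp add: AE_all_countable)
  then obtain N where N: "negligible N"
    "\<And>t. t \<in> {a<..<b} \<Longrightarrow> t \<notin> N \<Longrightarrow> (\<forall>n. norm (f n t) \<le> h t) \<and> (\<lambda>n. f n t) \<longlonglongrightarrow> g t"
    by (rule AE_lebesgue_onE) auto
  define E where "E = N \<union> {a, b}"
  have E: "negligible E" using N(1) by (auto simp: E_def)
  have ok: "t \<in> {a<..<b} \<and> t \<notin> N" if "t \<in> {a..b}" "t \<notin> E" for t using that by (auto simp: E_def)
  define f' where "f' n t = (if t \<in> E then 0 else f n t)" for n t
  define h' where "h' t = (if t \<in> E then 0 else h t)" for t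
  define g' where "g' t = (if t \<in> E then 0 else g t)" for t
  have f'i: "f' n integrable_on {a..b}" for n
    by (rule integrable_spike[OF f E]) (simp add: f'_def)
  have h'i: "h' integrable_on {a..b}"
    by (rule integrable_spike[OF h E]) (simp add: h'_def)
  have le': "norm (f' n t) \<le> h' t" if "t \<in> {a..b}" for n t
    using N(2) ok[OF that] by (auto simp: f'_def h'_def)
  have conv': "(\<lambda>n. f' n t) \<longlonglongrightarrow> g' t" if "t \<in> {a..b}" for t
    using N(2) ok[OF that] by (auto simp: f'_def g'_def)
  note dc = dominated_convergence[OF f'i h'i le' conv']
  show "g integrable_on {a..b}"
    by (rule integrable_spike[OF dc(1) E]) (auto simp: g'_def)
  have "integral {a..b} (f' n) = integral {a..b} (f n)" for n
    by (rule integral_spike[OF E]) (simp add: f'_def)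
  moreover have "integral {a..b} g' = integral {a..b} g"
    by (rule integral_spike[OF E]) (simp add: g'_def)
  ultimately show "(\<lambda>n. integral {a..b} (f n)) \<longlonglongrightarrow> integral {a..b} g" using dc(2) by simp
qed

text \<open>The increments are small on sets of small measure because \<open>M\<close> is close in \<open>L\<^sup>1\<close> to the bounded
  function \<open>min M k\<close>.\<close>

lemma abs_cont_on_dominated:
  fixes F :: "real \<Rightarrow> 'b::metric_space"
  assumes M: "M integrable_on {a..b}" "\<And>t. t \<in> {a..b} \<Longrightarrow> 0 \<le> M t"
    and F: "\<And>s t. a \<le> s \<Longrightarrow> s \<le> t \<Longrightarrow> t \<le> b \<Longrightarrow> dist (F s) (F t) \<le> integral {s..t} M"
  shows "abs_cont_on {a..b} F"
  unfolding abs_cont_on_def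
proof (intro allI impI)
  fix e :: real assume e: "e > 0"
  have aM: "M absolutely_integrable_on {a..b}"
    using M nonnegative_absolutely_integrable_1 by blast
  define Mk where "Mk k t = min (M t) (real k)" for k t
  have aMk: "Mk k absolutely_integrable_on {a..b}" for k
    unfolding Mk_def by (intro absolutely_integrable_min_1 aM absolutely_integrable_on_const) simp
  have "(\<lambda>k. integral {a..b} (Mk k)) \<longlonglongrightarrow> integral {a..b} M"
  proof (rule dominated_convergence(2)[OF _ M(1)])
    show "Mk k integrable_on {a..b}" for k using aMk set_lebesgue_integral_eq_integral(1) by blast
    show "norm (Mk k t) \<le> M t" if "t \<in> {a..b}" for k t using M(2)[OF that] by (auto simp: Mk_def)
    show "(\<lambda>k. Mk k t) \<longlonglongrightarrow> M t" for t
    proof (rule tendsto_eventually)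
      show "\<forall>\<^sub>F k in sequentially. Mk k t = M t"
        using eventually_ge_at_top[of "nat \<lceil>M t\<rceil>"]
        by eventually_elim (auto simp: Mk_def min_def nat_le_iff ceiling_le_iff)
    qed
  qed
  then obtain k where k: "\<bar>integral {a..b} (Mk k) - integral {a..b} M\<bar> < e / 2"
    using e unfolding LIMSEQ_def dist_real_def by (meson half_gt_zero order_refl)
  let ?d = "e / (2 * (real k + 1))"
  show "\<exists>\<delta>>0. \<forall>D. D division_of \<Union>D \<and> \<Union>D \<subseteq> {a..b} \<and> (\<Sum>K\<in>D. Sup K - Inf K) < \<delta> \<longrightarrow>
        (\<Sum>K\<in>D. dist (F (Inf K)) (F (Sup K))) < e"
  proof (intro exI[of _ ?d] conjI allI impI)
    show "?d > 0" using e by simp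
    fix D assume "D division_of \<Union>D \<and> \<Union>D \<subseteq> {a..b} \<and> (\<Sum>K\<in>D. Sup K - Inf K) < ?d"
    then have D: "D division_of \<Union>D" "\<Union>D \<subseteq> {a..b}" "measure lebesgue (\<Union>D) < ?d"
      using division_length_eq_measure by auto
    let ?S = "\<Union>D"
    have S: "?S \<in> lmeasurable" by (rule lmeasurable_division[OF D(1)])
    have ai: "g absolutely_integrable_on ?S" if "g absolutely_integrable_on {a..b}" for g :: "real \<Rightarrow> real"
      using that D(2) S by (meson fmeasurableD set_integrable_subset)
    have ii: "g integrable_on ?S" if "g absolutely_integrable_on {a..b}" for g :: "real \<Rightarrow> real"
      using ai[OF that] set_lebesgue_integral_eq_integral(1) by blast
    have "(\<Sum>K\<in>D. dist (F (Inf K)) (F (Sup K))) \<le> (\<Sum>K\<in>D. integral K M)"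
    proof (rule sum_mono)
      fix K assume K: "K \<in> D"
      then obtain u v where uv: "K = {u..v}" using division_ofD(4)[OF D(1)] by (metis cbox_interval)
      have "u \<le> v" using division_ofD(3)[OF D(1) K] uv by auto
      moreover have "{u..v} \<subseteq> {a..b}" using K D(2) uv by blast
      ultimately show "dist (F (Inf K)) (F (Sup K)) \<le> integral K M" using F[of u v] uv by auto
    qed
    also have "\<dots> = integral ?S M"
      using integral_combine_division_topdown[OF ii[OF aM] D(1)] by simp
    also have "\<dots> = integral ?S (\<lambda>t. M t - Mk k t) + integral ?S (Mk k)"
      using integral_diff[OF ii[OF aM] ii[OF aMk[of k]]] by simp
    also have "integral ?S (\<lambda>t. M t - Mk k t) \<le> integral {a..b} (\<lambda>t. M t - Mk k t)"
      using D(2) by (intro integral_subset_le integrable_diff ii aM aMk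
          set_lebesgue_integral_eq_integral(1)) (auto simp: Mk_def)
    also have "\<dots> = integral {a..b} M - integral {a..b} (Mk k)"
      by (intro integral_diff set_lebesgue_integral_eq_integral(1) aM aMk)
    also have "\<dots> < e / 2" using k by linarith
    also have "integral ?S (Mk k) \<le> integral ?S (\<lambda>t. real k)"
      by (rule integral_le[OF ii[OF aMk]]) (use S integrable_on_const in \<open>auto simp: Mk_def\<close>)
    also have "\<dots> = real k * measure lebesgue ?S"
      using lmeasure_integral[OF S] integral_mult_right[of ?S "real k" "\<lambda>_. 1"] by simp
    also have "\<dots> \<le> (real k + 1) * ?d"
      using D(3) by (intro mult_mono) auto
    also have "\<dots> = e / 2" by (simp add: field_simps add_pos_nonneg)
    finally show "(\<Sum>K\<in>D. dist (F (Inf K)) (F (Sup K))) < e" by simp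
  qed
qed

text \<open>In dimension one, averages over small cubes with lower corner \<open>x\<close> are right difference quotients of the
  indefinite integral. Left ones are obtained by reflection.\<close>

lemma integral_right_derivative_AE:
  fixes f :: "real \<Rightarrow> 'b::euclidean_space"
  assumes "f integrable_on {a..b}"
  obtains N where "negligible N"
    "\<And>x e. \<lbrakk>x \<in> {a<..<b}; x \<notin> N; 0 < e\<rbrakk> \<Longrightarrow>
       \<exists>d>0. \<forall>h. 0 < h \<and> h < d \<longrightarrow> norm (integral {x..x + h} f - h *\<^sub>R f x) \<le> e * h"
proof -
  define f0 where "f0 t = (if t \<in> {a..b} then f t else 0)" for t
  have "f0 integrable_on UNIV" using assms unfolding f0_def by (simp only: integrable_restrict_UNIV)
  then have "f0 integrable_on cbox u v" for u v by (rule integrable_on_subcbox) auto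
  from integrable_ccontinuous_explicit[OF this] obtain N where N: "negligible N"
    "\<And>x e. \<lbrakk>x \<notin> N; 0 < e\<rbrakk> \<Longrightarrow> \<exists>d>0. \<forall>h. 0 < h \<and> h < d \<longrightarrow>
          norm (integral (cbox x (x + h *\<^sub>R One)) f0 /\<^sub>R h ^ DIM(real) - f0 x) < e" by metis
  show ?thesis
  proof (rule that[OF N(1)])
    fix x e :: real assume x: "x \<in> {a<..<b}" "x \<notin> N" "0 < e"
    obtain d where d: "d > 0" "\<And>h. 0 < h \<Longrightarrow> h < d \<Longrightarrow> norm (integral {x..x + h} f0 /\<^sub>R h - f0 x) < e"
      using N(2)[OF x(2,3)] by auto
    have "norm (integral {x..x + h} f - h *\<^sub>R f x) \<le> e * h" if h: "0 < h" "h < min d (b - x)" for h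
    proof -
      have "integral {x..x + h} f0 = integral {x..x + h} f"
        using h x by (intro integral_cong) (auto simp: f0_def)
      then have "norm (integral {x..x + h} f /\<^sub>R h - f x) < e"
        using d(2)[of h] h x by (auto simp: f0_def)
      then have "h * norm (integral {x..x + h} f /\<^sub>R h - f x) \<le> e * h"
        using h by (simp add: mult.commute)
      moreover have "h * norm (integral {x..x + h} f /\<^sub>R h - f x) = norm (h *\<^sub>R (integral {x..x + h} f /\<^sub>R h - f x))"
        using h by simp
      moreover have "h *\<^sub>R (integral {x..x + h} f /\<^sub>R h - f x) = integral {x..x + h} f - h *\<^sub>R f x"
        using h by (simp add: scaleR_right_diff_distrib)
      ultimately show ?thesis by simp
    qed
    then show "\<exists>d>0. \<forall>h. 0 < h \<and> h < d \<longrightarrow> norm (integral {x..x + h} f - h *\<^sub>R f x) \<le> e * h"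
      using d(1) x(1) by (intro exI[of _ "min d (b - x)"]) auto
  qed
qed

theorem indefinite_integral_has_vector_derivative_AE:
  fixes f :: "real \<Rightarrow> 'b::euclidean_space"
  assumes f: "f integrable_on {a..b}"
  shows "AE t in lebesgue_on {a<..<b}. ((\<lambda>u. integral {a..u} f) has_vector_derivative f t) (at t)"
proof -
  obtain N1 where N1: "negligible N1"
    "\<And>x e. \<lbrakk>x \<in> {a<..<b}; x \<notin> N1; 0 < e\<rbrakk> \<Longrightarrow>
       \<exists>d>0. \<forall>h. 0 < h \<and> h < d \<longrightarrow> norm (integral {x..x + h} f - h *\<^sub>R f x) \<le> e * h"
    using integral_right_derivative_AE[OF f] by blast
  have "(\<lambda>t. f (- t)) integrable_on {-b..-a}" using f by simp
  from integral_right_derivative_AE[OF this] obtain N2 where N2: "negligible N2"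
    "\<And>x e. \<lbrakk>x \<in> {-b<..<-a}; x \<notin> N2; 0 < e\<rbrakk> \<Longrightarrow>
       \<exists>d>0. \<forall>h. 0 < h \<and> h < d \<longrightarrow> norm (integral {x..x + h} (\<lambda>t. f (- t)) - h *\<^sub>R f (- x)) \<le> e * h"
    by blast
  have neg: "negligible (N1 \<union> uminus ` N2)"
    using N1 N2 by (auto intro!: negligible_Un negligible_differentiable_image_negligible derivative_intros simp: differentiable_on_def)
  show ?thesis
  proof (rule AE_lebesgue_onI[OF _ neg])
    fix x assume x: "x \<in> {a<..<b}" "x \<notin> N1 \<union> uminus ` N2"
    then have x2: "-x \<in> {-b<..<-a}" "-x \<notin> N2" by (auto simp: image_iff) 
    show "((\<lambda>u. integral {a..u} f) has_vector_derivative f x) (at x)"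
      unfolding has_vector_derivative_def has_derivative_within_alt
    proof (intro conjI allI impI)
      show "bounded_linear (\<lambda>h. h *\<^sub>R f x)" by (rule bounded_linear_scaleR_left)
      fix e :: real assume e: "e > 0"
      obtain d1 where d1: "d1 > 0" "\<And>h. 0 < h \<Longrightarrow> h < d1 \<Longrightarrow> norm (integral {x..x + h} f - h *\<^sub>R f x) \<le> e * h"
        using N1(2)[of x e] x e by auto
      obtain d2 where d2: "d2 > 0" "\<And>h. 0 < h \<Longrightarrow> h < d2 \<Longrightarrow>
           norm (integral {-x..-x + h} (\<lambda>t. f (- t)) - h *\<^sub>R f x) \<le> e * h"
        using N2(2)[OF x2 e] by auto
      let ?d = "min (min d1 d2) (min (b - x) (x - a))"
      have "norm (integral {a..y} f - integral {a..x} f - (y - x) *\<^sub>R f x) \<le> e * norm (y - x)"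
        if y: "norm (y - x) < ?d" for y
      proof -
        have yab: "a \<le> y" "y \<le> b" using y by (auto simp: abs_real_def split: if_splits)
        have sub: "f integrable_on {u..v}" if "a \<le> u" "v \<le> b" for u v
          using f that by (meson atLeastatMost_subset_iff integrable_on_subinterval)
        consider "y = x" | "y > x" | "y < x" by linarith
        then show ?thesis
        proof cases
          case 2
          then have "integral {a..x} f + integral {x..y} f = integral {a..y} f"
            using x yab by (intro Henstock_Kurzweil_Integration.integral_combine sub) auto
          then have "integral {a..y} f - integral {a..x} f = integral {x..x + (y - x)} f" by (simp add: algebra_simps)
          then show ?thesis using d1(2)[of "y - x"] 2 y by simp
        next
          case 3
          then have c: "integral {a..y} f + integral {y..x} f = integral {a..x} f"
            using x yab by (intro Henstock_Kurzweil_Integration.integral_combine sub) auto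
          have "integral {-x..-x + (x - y)} (\<lambda>t. f (- t)) = integral {y..x} f"
            using integral_reflect_real[of x y f] by simp
          then have "norm (integral {y..x} f - (x - y) *\<^sub>R f x) \<le> e * (x - y)"
            using d2(2)[of "x - y"] 3 y by auto
          moreover have "integral {a..y} f - integral {a..x} f - (y - x) *\<^sub>R f x
              = - (integral {y..x} f - (x - y) *\<^sub>R f x)"
            unfolding c[symmetric] by (simp add: algebra_simps)
          ultimately show ?thesis using 3 by (metis abs_of_neg diff_less_0_iff_less minus_diff_eq norm_minus_cancel real_norm_def)
        qed simp
      qed
      moreover have "?d > 0" using d1 d2 x by auto
      ultimately show "\<exists>d>0. \<forall>y\<in>UNIV. norm (y - x) < d \<longrightarrow>
        norm (integral {a..y} f - integral {a..x} f - (y - x) *\<^sub>R f x) \<le> e * norm (y - x)" by blast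
    qed
  qed simp
qed


section \<open>Gronwall's inequality with an integrable coefficient\<close>

lemma continuous_on_if_indefinite_integral:
  fixes f y :: "real \<Rightarrow> 'b::banach"
  assumes "f integrable_on {a..b}" "\<And>t. t \<in> {a..b} \<Longrightarrow> y t = c + integral {a..t} f"
  shows "continuous_on {a..b} y"
proof (rule continuous_on_eq)
  show "continuous_on {a..b} (\<lambda>t. c + integral {a..t} f)"
    by (intro continuous_intros indefinite_integral_continuous_1 assms(1))
qed (simp add: assms(2))

text \<open>The interval is subdivided so that \<open>K\<close> increases by the same amount on each of \<open>n\<close> pieces; the increments of
  \<open>g\<close> then add up to at most a constant times \<open>1 / n\<close>.\<close>

lemma decreasing_if_quadratic_increments:
  fixes g K :: "real \<Rightarrow> real"
  assumes ab: "a \<le> b" and K: "continuous_on {a..b} K" "\<And>s t. a \<le> s \<Longrightarrow> s \<le> t \<Longrightarrow> t \<le> b \<Longrightarrow> K s \<le> K t"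
    and C: "C \<ge> 0"
    and g: "\<And>s t. a \<le> s \<Longrightarrow> s \<le> t \<Longrightarrow> t \<le> b \<Longrightarrow> g t - g s \<le> C * (K t - K s)\<^sup>2"
  shows "g b \<le> g a"
proof -
  define \<kappa> where "\<kappa> = K b - K a"
  have bound: "g b \<le> g a + C * \<kappa>\<^sup>2 / real n" if n: "n > 0" for n :: nat
  proof -
    define h where "h = \<kappa> / real n"
    have h: "h \<ge> 0" using K(2)[of a b] ab by (simp add: h_def \<kappa>_def)
    have "g t \<le> g a + real j * (C * h\<^sup>2)" if "t \<in> {a..b}" "K t \<le> K a + real j * h" for j :: nat and t
      using that
    proof (induction j arbitrary: t)
      case 0
      then have "K t = K a" using K(2)[of a t] by auto
      then show ?case using g[of a t] 0 by simp
    next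
      case (Suc j)
      show ?case
      proof (cases "K t \<le> K a + real j * h")
        case True
        then have "g t \<le> g a + real j * (C * h\<^sup>2)" using Suc by blast
        also have "\<dots> \<le> g a + real (Suc j) * (C * h\<^sup>2)" using C by (simp add: algebra_simps)
        finally show ?thesis .
      next
        case False
        have "continuous_on {a..t} K" using K(1) Suc.prems by (auto elim: continuous_on_subset)
        then obtain s where s: "a \<le> s" "s \<le> t" "K s = K a + real j * h"
          using IVT'[of K a "K a + real j * h" t] False h Suc.prems by auto
        have "K t - K s \<le> h" "0 \<le> K t - K s"
          using Suc.prems s False by (auto simp: algebra_simps)
        then have "C * (K t - K s)\<^sup>2 \<le> C * h\<^sup>2" using C by (simp add: mult_left_mono power_mono)
        moreover have "g t - g s \<le> C * (K t - K s)\<^sup>2" using Suc.prems s by (intro g) auto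
        moreover have "g s \<le> g a + real j * (C * h\<^sup>2)" using Suc.IH[of s] s Suc.prems by auto
        ultimately show ?thesis by (simp add: algebra_simps)
      qed
    qed
    from this[of b n] have "g b \<le> g a + real n * (C * h\<^sup>2)" using ab n by (simp add: h_def \<kappa>_def)
    also have "real n * (C * h\<^sup>2) = C * \<kappa>\<^sup>2 / real n" using n by (simp add: h_def power2_eq_square field_simps)
    finally show ?thesis .
  qed
  have "(\<lambda>n. g a + C * \<kappa>\<^sup>2 / real n) \<longlonglongrightarrow> g a + 0"
    by (intro tendsto_intros lim_const_over_n)
  then have "(\<lambda>n. g a + C * \<kappa>\<^sup>2 / real n) \<longlonglongrightarrow> g a" by simp
  then show ?thesis
    by (rule LIMSEQ_le_const) (use bound in \<open>auto intro!: exI[of _ 1]\<close>)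
qed

lemma integral_diff_initial:
  fixes f :: "real \<Rightarrow> 'b::banach"
  assumes "f integrable_on {a..b}" "a \<le> s" "s \<le> t" "t \<le> b"
  shows "integral {a..t} f - integral {a..s} f = integral {s..t} f"
proof -
  have "f integrable_on {a..t}" using assms by (meson atLeastatMost_subset_iff integrable_on_subinterval order_refl)
  from Henstock_Kurzweil_Integration.integral_combine[OF assms(2,3) this] show ?thesis by (simp add: algebra_simps)
qed

lemma integrable_times_continuous:
  fixes M z :: "real \<Rightarrow> real"
  assumes M: "M integrable_on {a..b}" "\<And>t. t \<in> {a..b} \<Longrightarrow> 0 \<le> M t" and z: "continuous_on {a..b} z"
  shows "(\<lambda>s. M s * z s) integrable_on {a..b}"
proof -
  have aM: "M absolutely_integrable_on {a..b}"
    using M nonnegative_absolutely_integrable_1 by blast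
  have "(\<lambda>s. z s * M s) absolutely_integrable_on {a..b}"
    by (rule absolutely_integrable_bounded_measurable_product_real)
       (use z aM in \<open>auto intro!: continuous_imp_measurable_on_sets_lebesgue compact_imp_bounded compact_continuous_image\<close>)
  then show ?thesis
    using set_lebesgue_integral_eq_integral(1) by (simp add: mult.commute)
qed

text \<open>With \<open>f t = B + \<integral>\<^sub>a\<^sup>t M z\<close> and \<open>K t = \<integral>\<^sub>a\<^sup>t M\<close>, the function \<open>f exp (-K)\<close> decreases. As \<open>M\<close> is only integrable,
  this is deduced not from its derivative but from the quadratic bound for its increments.\<close>

theorem gronwall_integrable:
  fixes z M :: "real \<Rightarrow> real"
  assumes M: "M integrable_on {a..b}" "\<And>t. t \<in> {a..b} \<Longrightarrow> 0 \<le> M t"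
    and z: "continuous_on {a..b} z" "\<And>t. t \<in> {a..b} \<Longrightarrow> 0 \<le> z t"
    and le: "\<And>t. t \<in> {a..b} \<Longrightarrow> z t \<le> B + integral {a..t} (\<lambda>s. M s * z s)"
    and t: "t \<in> {a..b}"
  shows "z t \<le> B * exp (integral {a..t} M)"
proof -
  define f where "f t = B + integral {a..t} (\<lambda>s. M s * z s)" for t
  define K where "K t = integral {a..t} M" for t
  define g where "g t = f t * exp (- K t)" for t
  have Mz: "(\<lambda>s. M s * z s) integrable_on {a..b}" by (rule integrable_times_continuous[OF M z(1)])
  have sub: "h integrable_on {s..t}" if "h integrable_on {a..b}" "a \<le> s" "t \<le> b" for h :: "real \<Rightarrow> real" and s t
    using that by (meson atLeastatMost_subset_iff integrable_on_subinterval)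
  have Kd: "K t - K s = integral {s..t} M" if "a \<le> s" "s \<le> t" "t \<le> b" for s t
    unfolding K_def using integral_diff_initial[OF M(1)] that by blast
  have fd: "f t - f s = integral {s..t} (\<lambda>s. M s * z s)" if "a \<le> s" "s \<le> t" "t \<le> b" for s t
    unfolding f_def using integral_diff_initial[OF Mz] that by simp
  have Kmono: "K s \<le> K t" if "a \<le> s" "s \<le> t" "t \<le> b" for s t
    using Kd[OF that] integral_nonneg[OF sub[OF M(1), of s t]] M(2) that by auto
  have fmono: "f s \<le> f t" if "a \<le> s" "s \<le> t" "t \<le> b" for s t
    using fd[OF that] integral_nonneg[OF sub[OF Mz, of s t]] M(2) z(2) that by auto
  have zf: "z t \<le> f t" if "t \<in> {a..b}" for t using le[OF that] by (simp add: f_def)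
  have f0: "0 \<le> f t" if "t \<in> {a..b}" for t using zf[OF that] z(2)[OF that] by linarith
  have fstep: "f t * (1 - (K t - K s)) \<le> f s" if "a \<le> s" "s \<le> t" "t \<le> b" for s t
  proof -
    have "f t - f s \<le> integral {s..t} (\<lambda>s. M s * f t)"
      unfolding fd[OF that]
    proof (rule integral_le)
      show "(\<lambda>s. M s * z s) integrable_on {s..t}" "(\<lambda>s. M s * f t) integrable_on {s..t}"
        using sub[OF Mz] sub[OF M(1)] that by (auto intro: integrable_on_mult_left)
      show "M r * z r \<le> M r * f t" if "r \<in> {s..t}" for r
        using that \<open>a \<le> s\<close> \<open>t \<le> b\<close> zf[of r] fmono[of r t] M(2)[of r] by (intro mult_left_mono) auto
    qed
    also have "\<dots> = (K t - K s) * f t" using Kd[OF that] by simp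
    finally show ?thesis by (simp add: algebra_simps)
  qed
  have gstep: "g v - g u \<le> f t * (K v - K u)\<^sup>2" if "a \<le> u" "u \<le> v" "v \<le> t" for u v
  proof -
    let ?D = "K v - K u"
    have uv: "v \<le> b" using that t by auto
    have D: "?D \<ge> 0" using Kmono that uv by auto
    have Ka: "K v \<ge> 0" using Kmono[of a v] that uv by (simp add: K_def)
    have gv: "0 \<le> g v" "g v \<le> f t"
    proof -
      show "0 \<le> g v" unfolding g_def using f0[of v] that uv by auto
      have "g v \<le> f v * 1" unfolding g_def using f0[of v] that uv Ka by (intro mult_left_mono) auto
      then show "g v \<le> f t" using fmono[of v t] that t by auto
    qed
    have "g v * (1 - ?D\<^sup>2) \<le> g u"
    proof (cases "?D \<le> 1")
      case True
      have "g v * (1 - ?D\<^sup>2) = (f v * exp (- K v)) * ((1 - ?D) * (1 + ?D))"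
        by (simp add: g_def power2_eq_square algebra_simps)
      also have "\<dots> \<le> (f v * exp (- K v)) * ((1 - ?D) * exp ?D)"
        using True D f0[of v] that uv by (intro mult_left_mono exp_ge_add_one_self) auto
      also have "\<dots> = (f v * (1 - ?D)) * exp (- K u)"
        by (simp add: exp_diff exp_minus field_simps)
      also have "\<dots> \<le> f u * exp (- K u)" using fstep[of u v] that uv by (intro mult_right_mono) auto
      finally show ?thesis by (simp add: g_def)
    next
      case False
      then have "1 - ?D\<^sup>2 \<le> 0" by (simp add: power2_eq_square) (smt (verit) mult_less_cancel_left2 False)
      then have "g v * (1 - ?D\<^sup>2) \<le> 0" using gv by (simp add: mult_nonneg_nonpos)
      also have "0 \<le> g u" unfolding g_def using f0[of u] that uv by auto
      finally show ?thesis .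
    qed
    then have "g v - g u \<le> g v * ?D\<^sup>2" by (simp add: algebra_simps)
    also have "\<dots> \<le> f t * ?D\<^sup>2" using gv by (intro mult_right_mono) auto
    finally show ?thesis .
  qed
  have "continuous_on {a..b} K" unfolding K_def by (rule indefinite_integral_continuous_1[OF M(1)])
  then have "g t \<le> g a"
    using t Kmono f0[OF t]
    by (intro decreasing_if_quadratic_increments[of a t K "f t" g] gstep) (auto elim: continuous_on_subset)
  then have "f t * exp (- K t) \<le> B" by (simp add: g_def f_def K_def)
  then have "f t \<le> B * exp (K t)" by (simp add: exp_minus field_simps)
  then show ?thesis using zf[OF t] by (simp add: K_def)
qed

section \<open>Arc length\<close>

theorem arc_length_eq_integral:
  fixes c c' :: "real \<Rightarrow> 'b::euclidean_space"
  assumes ab: "a \<le> b"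
    and der: "\<And>s. s \<in> {a..b} \<Longrightarrow> (c has_vector_derivative c' s) (at s within {a..b})"
    and cont: "continuous_on {a..b} c'"
  shows "arc_length a b c = ennreal (integral {a..b} (\<lambda>s. norm (c' s)))"
proof -
  have ftc: "(c' has_integral (c v - c u)) {u..v}" if "a \<le> u" "u \<le> v" "v \<le> b" for u v
    by (rule fundamental_theorem_of_calculus[OF that(2)])
       (rule has_vector_derivative_within_subset[OF der], use that in auto)
  have ni: "(\<lambda>s. norm (c' s)) integrable_on {u..v}" if "a \<le> u" "v \<le> b" for u v
    using that cont by (intro integrable_continuous_interval continuous_intros) (auto elim: continuous_on_subset)
  have piece: "\<exists>u v. K = {u..v} \<and> a \<le> u \<and> u \<le> v \<and> v \<le> b" if D: "D division_of {a..b}" "K \<in> D" for D K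
  proof -
    obtain u v where uv: "K = {u..v}" using division_ofD(4)[OF D] by (metis cbox_interval)
    moreover have "u \<le> v" using division_ofD(3)[OF D] uv by auto
    moreover have "{u..v} \<subseteq> {a..b}" using division_ofD(2)[OF D] uv by simp
    ultimately show ?thesis by auto
  qed
  have comb: "integral {a..b} (\<lambda>s. norm (c' s)) = (\<Sum>K\<in>D. integral K (\<lambda>s. norm (c' s)))"
    if "D division_of {a..b}" for D
    using ni[of a b] that by (intro integral_combine_division_topdown) auto
  show ?thesis
  proof (rule antisym)
    show "arc_length a b c \<le> ennreal (integral {a..b} (\<lambda>s. norm (c' s)))"
      unfolding arc_length_def
    proof (rule SUP_least, clarify)
      fix D assume D: "D division_of {a..b}"
      have "(\<Sum>K\<in>D. dist (c (Inf K)) (c (Sup K))) \<le> (\<Sum>K\<in>D. integral K (\<lambda>s. norm (c' s)))"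
      proof (rule sum_mono)
        fix K assume "K \<in> D"
        then obtain u v where uv: "K = {u..v}" "a \<le> u" "u \<le> v" "v \<le> b" using piece[OF D] by blast
        have "norm (integral {u..v} c') \<le> integral {u..v} (\<lambda>s. norm (c' s))"
          using ftc[OF uv(2-4)] by (intro integral_norm_bound_integral ni uv) auto
        then show "dist (c (Inf K)) (c (Sup K)) \<le> integral K (\<lambda>s. norm (c' s))"
          using integral_unique[OF ftc[OF uv(2-4)]] uv by (simp add: dist_norm norm_minus_commute)
      qed
      then show "ennreal (\<Sum>K\<in>D. dist (c (Inf K)) (c (Sup K))) \<le> ennreal (integral {a..b} (\<lambda>s. norm (c' s)))"
        using comb[OF D] by (simp add: ennreal_leI)
    qed
    show "ennreal (integral {a..b} (\<lambda>s. norm (c' s))) \<le> arc_length a b c"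
    proof (rule ennreal_le_epsilon)
      fix e :: real assume e: "e > 0"
      let ?e = "e / (2 * (b - a + 1))"
      have e': "?e > 0" using e ab by simp
      have "uniformly_continuous_on {a..b} c'" using cont by (intro compact_uniformly_continuous) auto
      then obtain d where d: "d > 0" "\<And>x y. x \<in> {a..b} \<Longrightarrow> y \<in> {a..b} \<Longrightarrow> dist y x < d \<Longrightarrow> dist (c' y) (c' x) < ?e"
        using e' unfolding uniformly_continuous_on_def by metis
      obtain p where p: "p tagged_division_of {a..b}" "(\<lambda>x. ball x d) fine p"
        using fine_division_exists_real[OF gauge_ball[OF d(1)]] by blast
      define D where "D = snd ` p"
      have D: "D division_of {a..b}" unfolding D_def by (rule division_of_tagged_division[OF p(1)])
      have "integral {a..b} (\<lambda>s. norm (c' s)) \<le> (\<Sum>K\<in>D. dist (c (Inf K)) (c (Sup K)) + 2 * ?e * (Sup K - Inf K))"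
        unfolding comb[OF D]
      proof (rule sum_mono)
        fix K assume K: "K \<in> D"
        then obtain u v where uv: "K = {u..v}" "a \<le> u" "u \<le> v" "v \<le> b" using piece[OF D] by blast
        obtain x where x: "(x, K) \<in> p" using K by (auto simp: D_def)
        have xs: "x \<in> {a..b}" "{u..v} \<subseteq> ball x d"
          using tagged_division_ofD(2,3)[OF p(1) x] p(2) x uv by (auto simp: fine_def)
        have close: "norm (c' s - c' x) \<le> ?e" if "s \<in> {u..v}" for s
          using d(2)[of x s] xs uv that by (force simp: dist_norm norm_minus_commute)
        have "((\<lambda>s. c' s - c' x) has_integral (c v - c u - (v - u) *\<^sub>R c' x)) {u..v}"
          using has_integral_diff[OF ftc[OF uv(2-4)] has_integral_const_real[of "c' x" u v]] uv by simp
        from has_integral_bound_real[of ?e "{}", OF _ _ this] have 1: "norm (c v - c u - (v - u) *\<^sub>R c' x) \<le> ?e * (v - u)"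
          using close e' uv by simp
        have "integral {u..v} (\<lambda>s. norm (c' s)) \<le> integral {u..v} (\<lambda>s. norm (c' x) + ?e)"
        proof (intro integral_le ni uv)
          show "norm (c' s) \<le> norm (c' x) + ?e" if "s \<in> {u..v}" for s
            using close[OF that] norm_triangle_sub[of "c' s" "c' x"] by linarith
        qed (rule integrable_const_ivl)
        also have "\<dots> = norm ((v - u) *\<^sub>R c' x) + ?e * (v - u)" using uv by (simp add: distrib_left mult.commute)
        also have "\<dots> \<le> norm (c v - c u) + 2 * (?e * (v - u))"
          using 1 norm_triangle_sub[of "(v - u) *\<^sub>R c' x" "c v - c u"] by (simp add: norm_minus_commute)
        finally show "integral K (\<lambda>s. norm (c' s)) \<le> dist (c (Inf K)) (c (Sup K)) + 2 * ?e * (Sup K - Inf K)"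
          using uv by (simp add: dist_norm norm_minus_commute)
      qed
      also have "\<dots> = (\<Sum>K\<in>D. dist (c (Inf K)) (c (Sup K))) + 2 * ?e * (b - a)"
        using division_length_eq_measure[OF D] ab by (simp add: sum.distrib sum_distrib_left[symmetric] del: times_divide_eq_left)
      also have "2 * ?e * (b - a) \<le> e" using e ab by (simp add: field_simps)
      finally have "ennreal (integral {a..b} (\<lambda>s. norm (c' s))) \<le> ennreal ((\<Sum>K\<in>D. dist (c (Inf K)) (c (Sup K))) + e)"
        by (simp add: ennreal_leI)
      also have "\<dots> = ennreal (\<Sum>K\<in>D. dist (c (Inf K)) (c (Sup K))) + ennreal e"
        using e by (intro ennreal_plus sum_nonneg) auto
      also have "\<dots> \<le> arc_length a b c + ennreal e"
        unfolding arc_length_def using D by (intro add_right_mono SUP_upper) auto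
      finally show "ennreal (integral {a..b} (\<lambda>s. norm (c' s))) \<le> arc_length a b c + ennreal e" .
    qed
  qed
qed

section \<open>Smooth bump functions\<close>

text \<open>\<open>k\<close>-fold differentiability of a real function; being differentiable of every order is
  smoothness.\<close>

primrec differentiable_times :: "nat \<Rightarrow> (real \<Rightarrow> real) \<Rightarrow> bool" where
  "differentiable_times 0 f \<longleftrightarrow> True"
| "differentiable_times (Suc k) f \<longleftrightarrow>
     (\<exists>f'. (\<forall>x. (f has_real_derivative f' x) (at x)) \<and> differentiable_times k f')"

definition smooth :: "(real \<Rightarrow> real) \<Rightarrow> bool" where
  "smooth f \<longleftrightarrow> (\<forall>k. differentiable_times k f)"

lemma differentiable_times_SucI:
  "(\<And>x. (f has_real_derivative f' x) (at x)) \<Longrightarrow> differentiable_times k f' \<Longrightarrow> differentiable_times (Suc k) f"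
  by auto

lemma differentiable_times_Suc_imp: "differentiable_times (Suc k) f \<Longrightarrow> differentiable_times k f"
proof (induction k arbitrary: f)
  case (Suc k)
  then obtain f' where "\<forall>x. (f has_real_derivative f' x) (at x)" "differentiable_times (Suc k) f'"
    unfolding differentiable_times.simps(2)[of "Suc k"] by blast
  then show ?case using Suc.IH differentiable_times_SucI by blast
qed simp

lemma differentiable_times_add:
  "differentiable_times k f \<Longrightarrow> differentiable_times k g \<Longrightarrow> differentiable_times k (\<lambda>x. f x + g x)"
proof (induction k arbitrary: f g)
  case (Suc k)
  then obtain f' g' where "\<forall>x. (f has_real_derivative f' x) (at x)" "differentiable_times k f'"
    "\<forall>x. (g has_real_derivative g' x) (at x)" "differentiable_times k g'" by auto
  then show ?case using Suc.IH[of f' g']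
    by (auto intro!: exI[of _ "\<lambda>x. f' x + g' x"] derivative_intros)
qed simp

lemma differentiable_times_mult:
  "differentiable_times k f \<Longrightarrow> differentiable_times k g \<Longrightarrow> differentiable_times k (\<lambda>x. f x * g x)"
proof (induction k arbitrary: f g)
  case (Suc k)
  then obtain f' g' where d: "\<forall>x. (f has_real_derivative f' x) (at x)" "differentiable_times k f'"
    "\<forall>x. (g has_real_derivative g' x) (at x)" "differentiable_times k g'" by auto
  have "differentiable_times k f" "differentiable_times k g"
    using Suc.prems differentiable_times_Suc_imp by blast+
  then have "differentiable_times k (\<lambda>x. f' x * g x + f x * g' x)"
    by (intro differentiable_times_add Suc.IH d)
  moreover have "((\<lambda>x. f x * g x) has_real_derivative (f' x * g x + f x * g' x)) (at x)" for x
    by (rule DERIV_cong[OF DERIV_mult]) (use d in \<open>auto simp: mult.commute\<close>)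
  ultimately show ?case by (rule differentiable_times_SucI[rotated])
qed simp

lemma differentiable_times_const: "differentiable_times k (\<lambda>_. c)"
proof (induction k arbitrary: c)
  case (Suc k)
  then have "differentiable_times k (\<lambda>_. 0)" by blast
  then show ?case unfolding differentiable_times.simps by (intro exI[of _ "\<lambda>_. 0"]) simp
qed simp

lemma differentiable_times_affine:
  "differentiable_times k f \<Longrightarrow> differentiable_times k (\<lambda>x. f (m * x + c))"
proof (induction k arbitrary: f)
  case (Suc k)
  then obtain f' where f': "\<forall>x. (f has_real_derivative f' x) (at x)" "differentiable_times k f'" by auto
  have "((\<lambda>x. f (m * x + c)) has_real_derivative f' (m * x + c) * m) (at x)" for x
    by (rule DERIV_chain2[of f]) (use f' in \<open>auto intro!: derivative_eq_intros\<close>)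
  moreover have "differentiable_times k (\<lambda>x. f' (m * x + c) * m)"
    by (rule differentiable_times_mult[OF Suc.IH[OF f'(2)] differentiable_times_const])
  ultimately show ?case by (rule differentiable_times_SucI)
qed simp

lemma differentiable_times_exp:
  "differentiable_times k f \<Longrightarrow> differentiable_times k (\<lambda>x. exp (f x))"
proof (induction k arbitrary: f)
  case (Suc k)
  then obtain f' where f': "\<forall>x. (f has_real_derivative f' x) (at x)" "differentiable_times k f'" by auto
  have "((\<lambda>x. exp (f x)) has_real_derivative exp (f x) * f' x) (at x)" for x
    using f' by (auto intro!: derivative_eq_intros)
  moreover have "differentiable_times k f" using Suc.prems differentiable_times_Suc_imp by blast
  then have "differentiable_times k (\<lambda>x. exp (f x) * f' x)"
    by (intro differentiable_times_mult Suc.IH f')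
  ultimately show ?case by (rule differentiable_times_SucI)
qed simp

text \<open>The class of functions \<open>p (1/x) exp (-1/x)\<close> on the positive half-line, extended by zero,
  is closed under differentiation; this is why \<open>exp (-1/x)\<close> glues smoothly to zero.\<close>

definition exp_inv_poly :: "real poly \<Rightarrow> real \<Rightarrow> real" where
  "exp_inv_poly p x = (if x > 0 then poly p (1 / x) * exp (- (1 / x)) else 0)"

lemma poly_times_exp_minus_tendsto_0: "((\<lambda>y. poly p y * exp (- y)) \<longlongrightarrow> (0::real)) at_top"
proof -
  have "((\<lambda>y. \<Sum>i\<le>degree p. coeff p i * (y ^ i / exp y)) \<longlongrightarrow> (\<Sum>i\<le>degree p. coeff p i * 0)) at_top"
    by (intro tendsto_intros tendsto_power_div_exp_0)
  moreover have "(\<lambda>y. \<Sum>i\<le>degree p. coeff p i * (y ^ i / exp y)) = (\<lambda>y. poly p y * exp (- y))"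
    by (simp add: poly_altdef sum_distrib_right exp_minus divide_inverse mult.assoc)
  ultimately show ?thesis by simp
qed

lemma exp_inv_poly_has_derivative:
  "(exp_inv_poly p has_real_derivative exp_inv_poly ([:0, 0, 1:] * (p - pderiv p)) x) (at x)"
proof -
  consider "x > 0" | "x < 0" | "x = 0" by linarith
  then show ?thesis
  proof cases
    case 1
    have "((\<lambda>x. poly p (1 / x) * exp (- (1 / x))) has_real_derivative
        exp_inv_poly ([:0, 0, 1:] * (p - pderiv p)) x) (at x)"
      using 1 by (auto intro!: derivative_eq_intros DERIV_chain2[OF poly_DERIV] simp: exp_inv_poly_def)
        (simp add: field_simps power2_eq_square)
    then show ?thesis
      by (rule has_field_derivative_transform_within_open[where S = "{0<..}"])
        (use 1 in \<open>auto simp: exp_inv_poly_def\<close>)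
  next
    case 2
    have "((\<lambda>x. 0) has_real_derivative exp_inv_poly ([:0, 0, 1:] * (p - pderiv p)) x) (at x)"
      using 2 by (simp add: exp_inv_poly_def)
    then show ?thesis
      by (rule has_field_derivative_transform_within_open[where S = "{..<0}"])
        (use 2 in \<open>auto simp: exp_inv_poly_def\<close>)
  next
    case 3
    have "((\<lambda>h. exp_inv_poly p h / h) \<longlongrightarrow> 0) (at_right 0)"
    proof -
      have "((\<lambda>h. poly ([:0, 1:] * p) (inverse h) * exp (- inverse h)) \<longlongrightarrow> 0) (at_right 0)"
        by (rule filterlim_compose[OF poly_times_exp_minus_tendsto_0 filterlim_inverse_at_top_right])
      then show ?thesis
      proof (rule Lim_transform_eventually)
        show "\<forall>\<^sub>F h in at_right 0. poly ([:0, 1:] * p) (inverse h) * exp (- inverse h) = exp_inv_poly p h / h"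
          using eventually_at_right_less[of "0::real"]
          by eventually_elim (simp add: exp_inv_poly_def field_simps)
      qed
    qed
    moreover have "((\<lambda>h. exp_inv_poly p h / h) \<longlongrightarrow> 0) (at_left 0)"
    proof (rule tendsto_eventually)
      show "\<forall>\<^sub>F h in at_left 0. exp_inv_poly p h / h = 0"
        by (auto simp: exp_inv_poly_def eventually_at_left_field intro!: exI[of _ "-1"])
    qed
    ultimately have "((\<lambda>h. exp_inv_poly p h / h) \<longlongrightarrow> 0) (at 0)"
      by (simp add: filterlim_split_at)
    then show ?thesis using 3 by (simp add: DERIV_def exp_inv_poly_def)
  qed
qed

lemma differentiable_times_exp_inv_poly: "differentiable_times k (exp_inv_poly p)"
proof (induction k arbitrary: p)
  case (Suc k)
  then show ?case unfolding differentiable_times.simps using exp_inv_poly_has_derivative by blast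
qed simp

text \<open>Smooth functions increasing, as \<open>n\<close> grows, to the indicator function of \<open>(0, \<epsilon>)\<close>.\<close>

definition bump :: "nat \<Rightarrow> real \<Rightarrow> real \<Rightarrow> real" where
  "bump n \<epsilon> r = 1 - exp (- (real n * (exp_inv_poly 1 r * exp_inv_poly 1 (\<epsilon> - r))))"

lemma smooth_bump: "smooth (bump n \<epsilon>)"
  unfolding smooth_def
proof
  fix k
  have 1: "differentiable_times k (\<lambda>r. exp_inv_poly 1 (\<epsilon> - r))"
    using differentiable_times_affine[OF differentiable_times_exp_inv_poly, of k 1 "-1" \<epsilon>] by simp
  have "differentiable_times k (\<lambda>r. (- real n) * (exp_inv_poly 1 r * exp_inv_poly 1 (\<epsilon> - r)))"
    by (intro differentiable_times_mult differentiable_times_const differentiable_times_exp_inv_poly 1)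
  from differentiable_times_add[OF differentiable_times_const[of k 1]
      differentiable_times_mult[OF differentiable_times_const[of k "-1"] differentiable_times_exp[OF this]]]
  show "differentiable_times k (bump n \<epsilon>)"
    by (simp add: bump_def[abs_def])
qed

lemma smooth_shift: "smooth f \<Longrightarrow> smooth (\<lambda>r. f (r - c))"
  using differentiable_times_affine[of _ f 1 "- c"] by (simp add: smooth_def)

lemma smooth_deriv:
  assumes "smooth f"
  shows "(f has_real_derivative deriv f x) (at x)" "smooth (deriv f)"
proof -
  have "\<exists>f'. (\<forall>x. (f has_real_derivative f' x) (at x)) \<and> differentiable_times k f'" for k
    using assms unfolding smooth_def by (metis differentiable_times.simps(2))
  then have "differentiable_times k (deriv f) \<and> (\<forall>x. (f has_real_derivative deriv f x) (at x))" for k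
    by (metis DERIV_imp_deriv ext)
  then show "(f has_real_derivative deriv f x) (at x)" "smooth (deriv f)"
    by (auto simp: smooth_def)
qed

lemma smooth_imp_continuous_on: "smooth f \<Longrightarrow> continuous_on S f"
  by (rule DERIV_continuous_on[OF has_field_derivative_at_within[OF smooth_deriv(1)]])

lemma bump_range: "0 \<le> bump n \<epsilon> r" "bump n \<epsilon> r \<le> 1"
  by (auto simp: bump_def exp_inv_poly_def)

lemma bump_eq_0: "r \<notin> {0<..<\<epsilon>} \<Longrightarrow> bump n \<epsilon> r = 0"
  by (auto simp: bump_def exp_inv_poly_def)

lemma bump_tendsto_1:
  assumes "0 < r" "r < \<epsilon>"
  shows "(\<lambda>n. bump n \<epsilon> r) \<longlonglongrightarrow> 1"
proof -
  define q where "q = exp_inv_poly 1 r * exp_inv_poly 1 (\<epsilon> - r)"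
  have q: "q > 0" using assms by (simp add: q_def exp_inv_poly_def)
  have "(\<lambda>n. exp (- q) ^ n) \<longlonglongrightarrow> 0"
    using q by (intro LIMSEQ_power_zero) simp
  then have "(\<lambda>n. 1 - exp (- q) ^ n) \<longlonglongrightarrow> 1 - 0" by (rule tendsto_diff[OF tendsto_const])
  moreover have "1 - exp (- q) ^ n = bump n \<epsilon> r" for n
    unfolding bump_def q_def[symmetric] using exp_of_nat_mult[of n "- q"] by simp
  ultimately show ?thesis by simp
qed

lemma deriv_bump_eq_0: "r \<notin> {0..\<epsilon>} \<Longrightarrow> deriv (bump n \<epsilon>) r = 0"
proof -
  assume r: "r \<notin> {0..\<epsilon>}"
  have "((\<lambda>_. 0) has_real_derivative 0) (at r)" by simp
  then have "(bump n \<epsilon> has_real_derivative 0) (at r)"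
    by (rule has_field_derivative_transform_within_open[where S = "- {0..\<epsilon>}"])
      (use r in \<open>auto simp: bump_eq_0\<close>)
  then show ?thesis by (rule DERIV_imp_deriv)
qed

lemma bump_deriv_bounded:
  obtains L where "\<And>r. \<bar>deriv (bump n \<epsilon>) r\<bar> \<le> L" "L \<ge> 0"
proof -
  have "compact (deriv (bump n \<epsilon>) ` {0..\<epsilon>})"
    by (intro compact_continuous_image smooth_imp_continuous_on smooth_deriv smooth_bump) simp
  then obtain L where "\<And>r. r \<in> {0..\<epsilon>} \<Longrightarrow> \<bar>deriv (bump n \<epsilon>) r\<bar> \<le> L"
    using compact_imp_bounded bounded_iff by (metis image_eqI real_norm_def)
  then show ?thesis using deriv_bump_eq_0 by (intro that[of "max L 0"]) (metis abs_zero max.coboundedI1 max.coboundedI2 order_refl, simp)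
qed

section \<open>Products of functions of one coordinate\<close>

text \<open>The function \<open>x \<mapsto> \<Prod>\<^sub>b \<alpha>\<^sub>b(x\<^sub>b)\<close> of the coordinates of \<open>x\<close>. Products with smooth factors are closed under
  partial derivatives, since \<open>\<partial>\<^sub>c\<close> replaces \<open>\<alpha>\<^sub>c\<close> by its derivative.\<close>

definition prod_fun :: "('a::euclidean_space \<Rightarrow> real \<Rightarrow> real) \<Rightarrow> 'a \<Rightarrow> real" where
  "prod_fun \<alpha> x = (\<Prod>b\<in>Basis. \<alpha> b (x \<bullet> b))"

lemma prod_fun_has_derivative:
  assumes "\<And>b. b \<in> Basis \<Longrightarrow> smooth (\<alpha> b)"
  shows "(prod_fun \<alpha> has_derivative
     (\<lambda>h. \<Sum>b\<in>Basis. (h \<bullet> b) * prod_fun (\<alpha>(b := deriv (\<alpha> b))) x)) (at (x :: 'a::euclidean_space))"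
proof -
  have d: "((\<lambda>x. \<alpha> b (x \<bullet> b)) has_derivative (\<lambda>h. (h \<bullet> b) * deriv (\<alpha> b) (x \<bullet> b))) (at x)"
    if "b \<in> Basis" for b
  proof -
    have "(\<alpha> b has_derivative (\<lambda>h. h * deriv (\<alpha> b) (x \<bullet> b))) (at (x \<bullet> b))"
      using smooth_deriv(1)[OF assms[OF that], of "x \<bullet> b"]
      by (simp add: has_field_derivative_def mult_commute_abs)
    moreover have "((\<lambda>x. x \<bullet> b) has_derivative (\<lambda>h. h \<bullet> b)) (at x)"
      by (intro derivative_eq_intros) auto
    ultimately show ?thesis by (rule has_derivative_compose[rotated])
  qed
  have "((\<lambda>x. \<Prod>b\<in>Basis. \<alpha> b (x \<bullet> b)) has_derivative
     (\<lambda>h. \<Sum>b\<in>Basis. (h \<bullet> b) * deriv (\<alpha> b) (x \<bullet> b) * (\<Prod>c\<in>Basis - {b}. \<alpha> c (x \<bullet> c)))) (at x)"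
    by (rule has_derivative_prod[OF d])
  moreover have "prod_fun (\<alpha>(b := deriv (\<alpha> b))) x = deriv (\<alpha> b) (x \<bullet> b) * (\<Prod>c\<in>Basis - {b}. \<alpha> c (x \<bullet> c))"
    if "b \<in> Basis" for b
    unfolding prod_fun_def using that by (subst prod.remove[OF finite_Basis that]) (auto intro!: prod.cong)
  ultimately show ?thesis
    unfolding prod_fun_def[of \<alpha>, abs_def] by (simp add: mult.assoc)
qed

lemma frechet_derivative_prod_fun:
  assumes "\<And>b. b \<in> Basis \<Longrightarrow> smooth (\<alpha> b)" "c \<in> Basis"
  shows "frechet_derivative (prod_fun \<alpha>) (at (x :: 'a::euclidean_space)) c = prod_fun (\<alpha>(c := deriv (\<alpha> c))) x"
proof -
  have "frechet_derivative (prod_fun \<alpha>) (at x) c = (\<Sum>b\<in>Basis. (c \<bullet> b) * prod_fun (\<alpha>(b := deriv (\<alpha> b))) x)"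
    using frechet_derivative_at[OF prod_fun_has_derivative[of \<alpha> x, OF assms(1)]] by metis
  also have "\<dots> = prod_fun (\<alpha>(c := deriv (\<alpha> c))) x"
    using assms(2) by (subst sum.remove[OF finite_Basis assms(2)]) (auto simp: inner_Basis intro!: sum.neutral split: if_splits)
  finally show ?thesis .
qed

lemma iter_deriv_prod_fun:
  assumes "\<And>b. b \<in> Basis \<Longrightarrow> smooth (\<alpha> b)" "bs \<in> lists Basis"
  shows "\<exists>\<beta>. (\<forall>b\<in>Basis. smooth (\<beta> b)) \<and> iter_deriv bs (prod_fun \<alpha>) = (prod_fun \<beta> :: 'a::euclidean_space \<Rightarrow> real)"
  using assms(2)
proof (induction bs)
  case Nil then show ?case using assms(1) by auto
next
  case (Cons c bs)
  then obtain \<beta> where \<beta>: "\<forall>b\<in>Basis. smooth (\<beta> b)" "iter_deriv bs (prod_fun \<alpha>) = prod_fun \<beta>" by auto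
  have "iter_deriv (c # bs) (prod_fun \<alpha>) = prod_fun (\<beta>(c := deriv (\<beta> c)))"
    using frechet_derivative_prod_fun[of \<beta> c] \<beta> Cons by auto
  moreover have "\<forall>b\<in>Basis. smooth ((\<beta>(c := deriv (\<beta> c))) b)" using \<beta> smooth_deriv(2) Cons by auto
  ultimately show ?case by blast
qed

lemma C_k_prod_fun:
  assumes "\<And>b. b \<in> Basis \<Longrightarrow> smooth (\<alpha> b)"
  shows "C_k k (prod_fun \<alpha> :: 'a::euclidean_space \<Rightarrow> real)"
proof -
  have "continuous_on UNIV (iter_deriv bs (prod_fun \<alpha>)) \<and> iter_deriv bs (prod_fun \<alpha>) differentiable_on UNIV"
    if "bs \<in> lists Basis" for bs :: "'a list"
  proof -
    obtain \<beta> where \<beta>: "\<And>b. b \<in> Basis \<Longrightarrow> smooth (\<beta> b)" "iter_deriv bs (prod_fun \<alpha>) = (prod_fun \<beta> :: 'a \<Rightarrow> real)"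
      using iter_deriv_prod_fun[of \<alpha>, OF assms \<open>bs \<in> lists Basis\<close>] by blast
    have "(prod_fun \<beta> :: 'a \<Rightarrow> real) differentiable_on UNIV"
      using prod_fun_has_derivative[of \<beta>, OF \<beta>(1)] unfolding differentiable_on_def differentiable_def by blast
    then show ?thesis using \<beta>(2) differentiable_imp_continuous_on by metis
  qed
  then show ?thesis by (auto simp: C_k_def multi_indices_def)
qed

section \<open>Weak derivatives and integrals over cubes\<close>

text \<open>Smooth functions supported in the cube with corners \<open>0\<close> and \<open>\<epsilon> One\<close> and increasing to the
  indicator function of its interior, and their partial derivatives in the direction \<open>c\<close>.\<close>

definition cube_bump :: "nat \<Rightarrow> real \<Rightarrow> 'a::euclidean_space \<Rightarrow> real" where
  "cube_bump n \<epsilon> = prod_fun (\<lambda>_. bump n \<epsilon>)"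

definition cube_bump_deriv :: "nat \<Rightarrow> real \<Rightarrow> 'a::euclidean_space \<Rightarrow> 'a \<Rightarrow> real" where
  "cube_bump_deriv n \<epsilon> c = prod_fun ((\<lambda>_. bump n \<epsilon>)(c := deriv (bump n \<epsilon>)))"

lemma cube_bump_range: "0 \<le> cube_bump n \<epsilon> z" "cube_bump n \<epsilon> z \<le> 1"
  unfolding cube_bump_def prod_fun_def
  by (auto intro!: prod_nonneg prod_le_1 simp: bump_range)

lemma cube_bump_eq_0: "z \<notin> box 0 (\<epsilon> *\<^sub>R One) \<Longrightarrow> cube_bump n \<epsilon> z = 0"
proof -
  assume "z \<notin> box 0 (\<epsilon> *\<^sub>R One)"
  then obtain b where b: "b \<in> Basis" "z \<bullet> b \<notin> {0<..<\<epsilon>}" by (auto simp: mem_box)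
  show ?thesis
    unfolding cube_bump_def prod_fun_def
    by (rule prod_zero[OF finite_Basis], rule bexI[OF _ b(1)], rule bump_eq_0[OF b(2)])
qed

lemma cube_bump_deriv_eq_0: "z \<notin> cbox 0 (\<epsilon> *\<^sub>R One) \<Longrightarrow> cube_bump_deriv n \<epsilon> c z = 0"
proof -
  assume "z \<notin> cbox 0 (\<epsilon> *\<^sub>R One)"
  then obtain b where b: "b \<in> Basis" "z \<bullet> b \<notin> {0..\<epsilon>}" by (auto simp: mem_box)
  have "((\<lambda>_. bump n \<epsilon>)(c := deriv (bump n \<epsilon>))) b (z \<bullet> b) = 0"
  proof -
    have "z \<bullet> b \<notin> {0<..<\<epsilon>}" using b(2) by auto
    from bump_eq_0[OF this, of n] show ?thesis
      using deriv_bump_eq_0[OF b(2), of n] by (cases "b = c") simp_all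
  qed
  then show ?thesis
    unfolding cube_bump_deriv_def prod_fun_def
    by (intro prod_zero[OF finite_Basis] bexI[OF _ b(1)])
qed

lemma cube_bump_tendsto_1:
  assumes "z \<in> box 0 (\<epsilon> *\<^sub>R One)"
  shows "(\<lambda>n. cube_bump n \<epsilon> z) \<longlonglongrightarrow> 1"
proof -
  have "(\<lambda>n. \<Prod>b\<in>Basis. bump n \<epsilon> (z \<bullet> b)) \<longlonglongrightarrow> (\<Prod>b\<in>(Basis::'a set). 1)"
    using assms by (intro tendsto_prod bump_tendsto_1) (auto simp: mem_box)
  then show ?thesis by (simp add: cube_bump_def prod_fun_def)
qed

lemma cube_bump_deriv_bounded:
  assumes "c \<in> Basis"
  obtains L where "\<And>z. \<bar>cube_bump_deriv n \<epsilon> c (z :: 'a::euclidean_space)\<bar> \<le> L" "L \<ge> 0"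
proof -
  obtain L where L: "\<And>r. \<bar>deriv (bump n \<epsilon>) r\<bar> \<le> L" "L \<ge> 0"
    using bump_deriv_bounded[of n \<epsilon>] by metis
  show ?thesis
  proof (rule that[OF _ L(2)])
    fix z :: 'a
    have "(\<Prod>b\<in>Basis - {c}. bump n \<epsilon> (z \<bullet> b)) \<le> 1" "0 \<le> (\<Prod>b\<in>Basis - {c}. bump n \<epsilon> (z \<bullet> b))"
      by (auto intro!: prod_nonneg prod_le_1 simp: bump_range)
    then have "\<bar>deriv (bump n \<epsilon>) (z \<bullet> c)\<bar> * (\<Prod>b\<in>Basis - {c}. bump n \<epsilon> (z \<bullet> b)) \<le> L * 1"
      using L by (intro mult_mono) auto
    moreover have "cube_bump_deriv n \<epsilon> c z = deriv (bump n \<epsilon>) (z \<bullet> c) * (\<Prod>b\<in>Basis - {c}. bump n \<epsilon> (z \<bullet> b))"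
      unfolding cube_bump_deriv_def prod_fun_def
      using assms by (subst prod.remove[OF finite_Basis assms]) (auto intro!: prod.cong)
    ultimately show "\<bar>cube_bump_deriv n \<epsilon> c z\<bar> \<le> L"
      using \<open>0 \<le> (\<Prod>b\<in>Basis - {c}. bump n \<epsilon> (z \<bullet> b))\<close> by (simp add: abs_mult)
  qed
qed

lemma cube_bump_directional:
  assumes "c \<in> Basis"
  shows "((\<lambda>t. cube_bump n \<epsilon> (z - t *\<^sub>R c)) has_real_derivative - cube_bump_deriv n \<epsilon> c (z - t *\<^sub>R c)) (at t)"
proof -
  have "((\<lambda>t. z - t *\<^sub>R c) has_derivative (\<lambda>h. - (h *\<^sub>R c))) (at t)"
    by (auto intro!: derivative_eq_intros)
  from has_derivative_compose[OF this prod_fun_has_derivative[of "\<lambda>_. bump n \<epsilon>"]]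
  have "((\<lambda>t. cube_bump n \<epsilon> (z - t *\<^sub>R c)) has_derivative
     (\<lambda>h. \<Sum>b\<in>Basis. (- (h *\<^sub>R c) \<bullet> b) * cube_bump_deriv n \<epsilon> b (z - t *\<^sub>R c))) (at t)"
    by (simp add: cube_bump_def cube_bump_deriv_def smooth_bump)
  moreover have "(\<Sum>b\<in>Basis. (- (h *\<^sub>R c) \<bullet> b) * cube_bump_deriv n \<epsilon> b (z - t *\<^sub>R c))
     = - cube_bump_deriv n \<epsilon> c (z - t *\<^sub>R c) * h" for h
    using assms by (subst sum.remove[OF finite_Basis assms])
      (auto simp: inner_Basis intro!: sum.neutral split: if_splits)
  ultimately show ?thesis
    unfolding has_field_derivative_def by (metis (no_types, lifting) has_derivative_eq_rhs ext)
qed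

lemma prod_fun_shift: "prod_fun \<alpha> (z - x) = prod_fun (\<lambda>b r. \<alpha> b (r - x \<bullet> b)) z"
  by (simp add: prod_fun_def inner_diff_left)

lemma iter_deriv_cube_bump:
  assumes "c \<in> Basis"
  shows "iter_deriv [c] (\<lambda>z. cube_bump n \<epsilon> (z - x)) = (\<lambda>z. cube_bump_deriv n \<epsilon> c (z - (x :: 'a::euclidean_space)))"
proof -
  have "deriv (\<lambda>r. bump n \<epsilon> (r - x \<bullet> c)) = (\<lambda>r. deriv (bump n \<epsilon>) (r - x \<bullet> c))"
  proof
    fix r
    have "((\<lambda>r. bump n \<epsilon> (r - x \<bullet> c)) has_real_derivative deriv (bump n \<epsilon>) (r - x \<bullet> c) * 1) (at r)"
      by (rule DERIV_chain2[OF smooth_deriv(1)[OF smooth_bump]]) (auto intro!: derivative_eq_intros)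
    then show "deriv (\<lambda>r. bump n \<epsilon> (r - x \<bullet> c)) r = deriv (bump n \<epsilon>) (r - x \<bullet> c)"
      using DERIV_imp_deriv by fastforce
  qed
  then have "(\<lambda>b r. bump n \<epsilon> (r - x \<bullet> b))(c := deriv (\<lambda>r. bump n \<epsilon> (r - x \<bullet> c)))
    = (\<lambda>b r. ((\<lambda>_. bump n \<epsilon>)(c := deriv (bump n \<epsilon>))) b (r - x \<bullet> b))"
    by (auto simp: fun_eq_iff)
  then show ?thesis
    unfolding cube_bump_def cube_bump_deriv_def prod_fun_shift
    using frechet_derivative_prod_fun[of "\<lambda>b r. bump n \<epsilon> (r - x \<bullet> b)" c] assms
    by (auto simp: smooth_shift smooth_bump)
qed

lemma cbox_0_shift: "z - x \<in> cbox 0 y \<longleftrightarrow> z \<in> cbox x (x + (y :: 'a::euclidean_space))"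
  by (auto simp: mem_box algebra_simps)

lemma test_function_cube_bump:
  assumes "cbox x (x + \<epsilon> *\<^sub>R One) \<subseteq> \<Omega>"
  shows "test_function \<Omega> (\<lambda>z. cube_bump n \<epsilon> (z - (x :: 'a::euclidean_space)))"
proof -
  have sub: "closure {z. cube_bump n \<epsilon> (z - x) \<noteq> 0} \<subseteq> cbox x (x + \<epsilon> *\<^sub>R One)"
  proof (rule closure_minimal)
    show "{z. cube_bump n \<epsilon> (z - x) \<noteq> 0} \<subseteq> cbox x (x + \<epsilon> *\<^sub>R One)"
      using cube_bump_eq_0[of _ \<epsilon> n] box_subset_cbox cbox_0_shift by blast
  qed (rule closed_cbox)
  have "compact (closure {z. cube_bump n \<epsilon> (z - x) \<noteq> 0})"
    using sub bounded_subset[OF bounded_cbox] by (auto simp: compact_eq_bounded_closed)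
  moreover have "C_k k (\<lambda>z. cube_bump n \<epsilon> (z - x))" for k
    unfolding cube_bump_def prod_fun_shift
    by (intro C_k_prod_fun smooth_shift smooth_bump)
  ultimately show ?thesis using sub assms by (auto simp: test_function_def)
qed

lemma test_function_continuous_on:
  assumes "test_function \<Omega> \<phi>"
  shows "continuous_on S \<phi>" "c \<in> Basis \<Longrightarrow> continuous_on S (iter_deriv [c] \<phi>)"
proof -
  have C: "C_k 1 \<phi>" using assms by (auto simp: test_function_def)
  have "[] \<in> multi_indices 1" by (auto simp: multi_indices_def)
  then show "continuous_on S \<phi>" using C unfolding C_k_def
    by (metis continuous_on_subset iter_deriv.simps(1) subset_UNIV)
  assume "c \<in> Basis"
  then have "[c] \<in> multi_indices 1" by (auto simp: multi_indices_def)
  then show "continuous_on S (iter_deriv [c] \<phi>)" using C unfolding C_k_def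
    by (metis continuous_on_subset subset_UNIV)
qed

lemma absolutely_integrable_continuous_scaleR:
  fixes u :: "'a::euclidean_space \<Rightarrow> 'b::euclidean_space"
  assumes "compact K" "continuous_on K \<phi>" "u absolutely_integrable_on K"
  shows "(\<lambda>z. \<phi> z *\<^sub>R u z) absolutely_integrable_on K"
  by (rule absolutely_integrable_bounded_measurable_product[OF bilinear_conv_bounded_bilinear[THEN iffD2, OF bounded_bilinear_scaleR]])
     (use assms in \<open>auto intro!: continuous_imp_measurable_on_sets_lebesgue compact_imp_bounded
        compact_continuous_image lmeasurable_compact fmeasurableD\<close>)

lemma set_lebesgue_integral_supported:
  fixes f :: "'a::euclidean_space \<Rightarrow> 'b::euclidean_space"
  assumes "f absolutely_integrable_on K" "K \<subseteq> \<Omega>" "\<And>z. z \<notin> K \<Longrightarrow> f z = 0"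
  shows "(LINT z:\<Omega>|lebesgue. f z) = integral K f"
proof -
  have "(\<lambda>z. indicator \<Omega> z *\<^sub>R f z) = (\<lambda>z. indicator K z *\<^sub>R f z)"
    using assms(2,3) by (auto simp: fun_eq_iff indicator_def)
  then have "(LINT z:\<Omega>|lebesgue. f z) = (LINT z:K|lebesgue. f z)"
    by (simp add: set_lebesgue_integral_def)
  then show ?thesis using set_lebesgue_integral_eq_integral(2)[OF assms(1)] by simp
qed

lemma has_weak_deriv_integral:
  assumes w: "has_weak_deriv \<Omega> [c] u d" and \<phi>: "test_function \<Omega> \<phi>" and c: "c \<in> Basis"
    and K: "compact K" "K \<subseteq> \<Omega>" "\<And>z. z \<notin> K \<Longrightarrow> \<phi> z = 0" "\<And>z. z \<notin> K \<Longrightarrow> iter_deriv [c] \<phi> z = 0"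
  shows "integral K (\<lambda>z. iter_deriv [c] \<phi> z *\<^sub>R u z) = - integral K (\<lambda>z. \<phi> z *\<^sub>R d z)"
proof -
  have ud: "u absolutely_integrable_on K" "d absolutely_integrable_on K"
    using w K(1,2) by (auto simp: has_weak_deriv_def locally_integrable_on_def)
  have "(LINT z:\<Omega>|lebesgue. iter_deriv [c] \<phi> z *\<^sub>R u z) = - (LINT z:\<Omega>|lebesgue. \<phi> z *\<^sub>R d z)"
    using w \<phi> by (auto simp: has_weak_deriv_def)
  moreover have "(LINT z:\<Omega>|lebesgue. iter_deriv [c] \<phi> z *\<^sub>R u z) = integral K (\<lambda>z. iter_deriv [c] \<phi> z *\<^sub>R u z)"
    using K ud test_function_continuous_on[OF \<phi>] c
    by (intro set_lebesgue_integral_supported absolutely_integrable_continuous_scaleR) simp_all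
  moreover have "(LINT z:\<Omega>|lebesgue. \<phi> z *\<^sub>R d z) = integral K (\<lambda>z. \<phi> z *\<^sub>R d z)"
    using K ud test_function_continuous_on[OF \<phi>]
    by (intro set_lebesgue_integral_supported absolutely_integrable_continuous_scaleR) simp_all
  ultimately show ?thesis by simp
qed

lemma cube_bump_integral_tendsto:
  fixes u :: "'a::euclidean_space \<Rightarrow> 'b::euclidean_space"
  assumes K: "compact K" "cbox x (x + \<epsilon> *\<^sub>R One) \<subseteq> K" and u: "u absolutely_integrable_on K"
  shows "(\<lambda>n. integral K (\<lambda>z. cube_bump n \<epsilon> (z - x) *\<^sub>R u z)) \<longlonglongrightarrow> integral (cbox x (x + \<epsilon> *\<^sub>R One)) u"
proof -
  let ?B = "box x (x + \<epsilon> *\<^sub>R One)"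
  have cont: "continuous_on S (\<lambda>z. cube_bump n \<epsilon> (z - x))" for n and S :: "'a set"
    by (rule test_function_continuous_on(1)[OF test_function_cube_bump[OF K(2)]])
  have lim: "(\<lambda>n. integral K (\<lambda>z. cube_bump n \<epsilon> (z - x) *\<^sub>R u z)) \<longlonglongrightarrow>
     integral K (\<lambda>z. if z \<in> ?B then u z else 0)"
  proof (rule dominated_convergence(2))
    show "(\<lambda>z. cube_bump n \<epsilon> (z - x) *\<^sub>R u z) integrable_on K" for n
      by (intro set_lebesgue_integral_eq_integral(1) absolutely_integrable_continuous_scaleR K cont u)
    show "(\<lambda>z. norm (u z)) integrable_on K" using u by (simp add: absolutely_integrable_on_def)
    show "norm (cube_bump n \<epsilon> (z - x) *\<^sub>R u z) \<le> norm (u z)" for n z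
      using cube_bump_range[of n \<epsilon> "z - x"] by (simp add: mult_left_le_one_le)
    show "(\<lambda>n. cube_bump n \<epsilon> (z - x) *\<^sub>R u z) \<longlonglongrightarrow> (if z \<in> ?B then u z else 0)" for z
    proof (cases "z \<in> ?B")
      case True
      then have "z - x \<in> box 0 (\<epsilon> *\<^sub>R One)" by (auto simp: mem_box algebra_simps)
      then have "(\<lambda>n. cube_bump n \<epsilon> (z - x) *\<^sub>R u z) \<longlonglongrightarrow> 1 *\<^sub>R u z"
        by (intro tendsto_intros cube_bump_tendsto_1)
      then show ?thesis using True by simp
    next
      case False
      then have "z - x \<notin> box 0 (\<epsilon> *\<^sub>R One)" by (auto simp: mem_box algebra_simps)
      then show ?thesis using False by (simp add: cube_bump_eq_0)
    qed
  qed
  have "integral K (\<lambda>z. if z \<in> ?B then u z else 0) = integral ?B u"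
    using K(2) box_subset_cbox[of x "x + \<epsilon> *\<^sub>R One"] by (subst integral_restrict_Int) (auto simp: Int_absorb2)
  also have "\<dots> = integral (cbox x (x + \<epsilon> *\<^sub>R One)) u" by (simp add: integral_open_interval)
  finally show ?thesis using lim by simp
qed

lemma has_vector_derivative_iff_tendsto:
  "(f has_vector_derivative D) (at t within S) \<longleftrightarrow>
     ((\<lambda>s. (f s - f t) /\<^sub>R (s - t)) \<longlongrightarrow> D) (at t within S)"
proof -
  have "norm ((f s - f t) /\<^sub>R (s - t) - D) = norm (f s - f t - (s - t) *\<^sub>R D) / norm (s - t)" if "s \<noteq> t" for s
  proof -
    have "f s - f t - (s - t) *\<^sub>R D = (s - t) *\<^sub>R ((f s - f t) /\<^sub>R (s - t) - D)"
      using that by (simp add: scaleR_right_diff_distrib)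
    then show ?thesis using that by simp
  qed
  then have ev: "\<forall>\<^sub>F s in at t within S. norm ((f s - f t) /\<^sub>R (s - t) - D) = norm (f s - f t - (s - t) *\<^sub>R D) / norm (s - t)"
    by (auto simp: eventually_at_filter)
  have "((\<lambda>s. (f s - f t) /\<^sub>R (s - t)) \<longlongrightarrow> D) (at t within S) \<longleftrightarrow>
     ((\<lambda>s. norm ((f s - f t) /\<^sub>R (s - t) - D)) \<longlongrightarrow> 0) (at t within S)"
    by (simp add: tendsto_norm_zero_iff Lim_null[of _ D])
  also have "\<dots> \<longleftrightarrow> ((\<lambda>s. norm (f s - f t - (s - t) *\<^sub>R D) / norm (s - t)) \<longlongrightarrow> 0) (at t within S)"
    by (rule filterlim_cong[OF refl refl ev])
  finally show ?thesis
    by (simp add: has_vector_derivative_def has_derivative_iff_norm bounded_linear_scaleR_left)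
qed

text \<open>If \<open>d\<close> is within \<open>\<delta>\<close> of a constant \<open>D\<close>, the integral of \<open>u\<close> over a cube changes under the translation by \<open>h c\<close> as if the
  derivative were \<open>D\<close>, up to the corresponding error. For \<open>F\<^sub>n t\<close>, the integral of \<open>u\<close> against the bump on the cube translated by \<open>t c\<close>,
  the derivative in \<open>t\<close> is the integral of \<open>d\<close> against the same bump. This gives the estimate with the
  indicator function replaced by bumps, and the limit of large \<open>n\<close> concludes.\<close>

theorem cube_integral_increment:
  fixes u d :: "'a::euclidean_space \<Rightarrow> 'b::euclidean_space"
  assumes w: "has_weak_deriv \<Omega> [c] u d" and c: "c \<in> Basis" and h: "0 < h" and \<epsilon>: "0 < \<epsilon>"
    and sub: "cbox x (x + h *\<^sub>R c + \<epsilon> *\<^sub>R One) \<subseteq> \<Omega>"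
    and N: "negligible N" "\<And>z. z \<in> cbox x (x + h *\<^sub>R c + \<epsilon> *\<^sub>R One) \<Longrightarrow> z \<notin> N \<Longrightarrow> norm (d z - D) \<le> \<delta>"
  shows "norm (integral (cbox (x + h *\<^sub>R c) (x + h *\<^sub>R c + \<epsilon> *\<^sub>R One)) u
     - integral (cbox x (x + \<epsilon> *\<^sub>R One)) u - (h * \<epsilon> ^ DIM('a)) *\<^sub>R D) \<le> h * \<epsilon> ^ DIM('a) * \<delta>"
proof -
  define K where "K = cbox x (x + h *\<^sub>R c + \<epsilon> *\<^sub>R One)"
  define y where "y t = x + t *\<^sub>R c" for t
  let ?B = "\<lambda>n t z. cube_bump n \<epsilon> (z - y t)" and ?B' = "\<lambda>n t z. cube_bump_deriv n \<epsilon> c (z - y t)"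
  have K: "compact K" "K \<subseteq> \<Omega>" using sub by (auto simp: K_def)
  have subK: "cbox (y t) (y t + \<epsilon> *\<^sub>R One) \<subseteq> K" if "t \<in> {0..h}" for t
    using that c unfolding K_def y_def
    by (auto simp: subset_box inner_simps inner_Basis mult_left_le)
  have ud: "u absolutely_integrable_on K" "d absolutely_integrable_on K"
    using w K by (auto simp: has_weak_deriv_def locally_integrable_on_def)
  define I where "I n = integral (cbox 0 (\<epsilon> *\<^sub>R One)) (cube_bump n \<epsilon> :: 'a \<Rightarrow> real)" for n
  define F where "F n t = integral K (\<lambda>z. ?B n t z *\<^sub>R u z)" for n t
  have test: "test_function \<Omega> (\<lambda>z. ?B n t z)" if "t \<in> {0..h}" for n t
    using subK[OF that] K by (intro test_function_cube_bump) auto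
  have cont: "continuous_on S (\<lambda>z. cube_bump n \<epsilon> (z - v))" for n v and S :: "'a set"
    by (rule test_function_continuous_on(1)[OF test_function_cube_bump[OF order_refl]])
  have zero: "?B n t z = 0" "?B' n t z = 0"
    if "t \<in> {0..h}" "z \<notin> K" for n t z
  proof -
    have "z - y t \<notin> cbox 0 (\<epsilon> *\<^sub>R One)"
      unfolding cbox_0_shift using that subK by blast
    then show "?B n t z = 0" "?B' n t z = 0"
      using cube_bump_eq_0 cube_bump_deriv_eq_0 box_subset_cbox by blast+
  qed
  have aint: "(\<lambda>z. cube_bump n \<epsilon> (z - v) *\<^sub>R g z) absolutely_integrable_on K"
    if "g absolutely_integrable_on K" for n v and g :: "'a \<Rightarrow> 'b"
    by (intro absolutely_integrable_continuous_scaleR K cont that)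
  have Ieq: "integral K (\<lambda>z. ?B n t z) = I n" if t: "t \<in> {0..h}" for n t
  proof -
    have "integral K (\<lambda>z. ?B n t z) = integral (cbox (y t) (y t + \<epsilon> *\<^sub>R One)) (\<lambda>z. ?B n t z)"
    proof -
      have "?B n t z = 0" if "z \<notin> cbox (y t) (y t + \<epsilon> *\<^sub>R One)" for z
        using that cube_bump_eq_0 box_subset_cbox unfolding cbox_0_shift[symmetric] by blast
      then have "integral K (\<lambda>z. ?B n t z) =
          integral K (\<lambda>z. if z \<in> cbox (y t) (y t + \<epsilon> *\<^sub>R One) then ?B n t z else 0)"
        by (intro integral_cong) auto
      then show ?thesis using subK[OF t] by (simp add: integral_restrict_Int Int_absorb2)
    qed
    also have "\<dots> = I n"
      using integral_shift_cbox[of 0 "- y t" "\<epsilon> *\<^sub>R One" "cube_bump n \<epsilon>"] by (simp add: I_def add.commute)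
    finally show ?thesis .
  qed
  \<comment> \<open>Differentiation under the integral sign, followed by the definition of the weak derivative.\<close>
  have F': "(F n has_vector_derivative integral K (\<lambda>z. ?B n t z *\<^sub>R d z)) (at t within {0..h})"
    if t: "t \<in> {0..h}" for n t
  proof -
    obtain L where L: "\<And>z. \<bar>cube_bump_deriv n \<epsilon> c z\<bar> \<le> L" "L \<ge> 0"
      using cube_bump_deriv_bounded[OF c] by blast
    have shift: "z - y s = (z - x) - s *\<^sub>R c" for z s by (simp add: y_def algebra_simps)
    have lip: "\<bar>?B n s z - ?B n t z\<bar> \<le> L * \<bar>s - t\<bar>" for z s
      unfolding shift real_norm_def[symmetric]
      by (rule field_differentiable_bound[of UNIV])
         (auto intro!: cube_bump_directional[OF c] L)
    define q where "q s z = ((?B n s z - ?B n t z) / (s - t)) *\<^sub>R u z" for s z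
    have qi: "q s absolutely_integrable_on K" for s
    proof -
      have "(\<lambda>z. (1 / (s - t)) *\<^sub>R (?B n s z *\<^sub>R u z - ?B n t z *\<^sub>R u z)) absolutely_integrable_on K"
        by (intro absolutely_integrable_scaleR_left set_integral_diff(1) aint ud)
      then show ?thesis by (simp add: q_def[abs_def] scaleR_left_diff_distrib[symmetric])
    qed
    have Fq: "(F n s - F n t) /\<^sub>R (s - t) = integral K (q s)" for s
    proof -
      have "F n s - F n t = integral K (\<lambda>z. ?B n s z *\<^sub>R u z - ?B n t z *\<^sub>R u z)"
        unfolding F_def
        by (intro integral_diff[symmetric] set_lebesgue_integral_eq_integral(1) aint ud)
      then have "(F n s - F n t) /\<^sub>R (s - t) =
          integral K (\<lambda>z. inverse (s - t) *\<^sub>R (?B n s z *\<^sub>R u z - ?B n t z *\<^sub>R u z))"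
        by simp
      then show ?thesis by (simp add: q_def[abs_def] scaleR_left_diff_distrib[symmetric] divide_inverse_commute)
    qed
    have "((\<lambda>s. integral K (q s)) \<longlongrightarrow> integral K (\<lambda>z. - ?B' n t z *\<^sub>R u z)) (at t within {0..h})"
      unfolding tendsto_at_iff_sequentially o_def
    proof (intro allI impI)
      fix s assume s: "\<forall>i. s i \<in> {0..h} - {t}" "s \<longlonglongrightarrow> t"
      show "(\<lambda>i. integral K (q (s i))) \<longlonglongrightarrow> integral K (\<lambda>z. - ?B' n t z *\<^sub>R u z)"
      proof (rule dominated_convergence(2))
        show "q (s i) integrable_on K" for i
          using qi set_lebesgue_integral_eq_integral(1) by blast
        show "(\<lambda>z. L * norm (u z)) integrable_on K"
          using ud(1) by (intro integrable_on_mult_right) (simp add: absolutely_integrable_on_def)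
        show "norm (q (s i) z) \<le> L * norm (u z)" for i z
        proof -
          have "\<bar>(?B n (s i) z - ?B n t z) / (s i - t)\<bar> \<le> L"
            using lip[of z "s i"] s by (auto simp: abs_divide divide_le_eq)
          then show ?thesis unfolding q_def norm_scaleR real_norm_def by (rule mult_right_mono) simp
        qed
        show "(\<lambda>i. q (s i) z) \<longlonglongrightarrow> - ?B' n t z *\<^sub>R u z" for z
        proof -
          have "((\<lambda>r. (?B n r z - ?B n t z) / (r - t)) \<longlongrightarrow> - ?B' n t z) (at t)"
            using cube_bump_directional[OF c, of n \<epsilon> "z - x" t] unfolding has_field_derivative_iff shift .
          then have "(\<lambda>i. (?B n (s i) z - ?B n t z) / (s i - t)) \<longlonglongrightarrow> - ?B' n t z"
            unfolding tendsto_at_iff_sequentially o_def using s by auto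
          then show ?thesis unfolding q_def by (intro tendsto_intros)
        qed
      qed
    qed
    moreover have "integral K (\<lambda>z. - ?B' n t z *\<^sub>R u z) = integral K (\<lambda>z. ?B n t z *\<^sub>R d z)"
    proof -
      have "integral K (\<lambda>z. ?B' n t z *\<^sub>R u z) = - integral K (\<lambda>z. ?B n t z *\<^sub>R d z)"
        by (rule has_weak_deriv_integral[OF w test[OF t, of n] c K, unfolded iter_deriv_cube_bump[OF c]])
          (use zero[OF t] in auto)
      then show ?thesis by simp
    qed
    ultimately show ?thesis
      by (simp add: has_vector_derivative_iff_tendsto Fq)
  qed
  have F'bound: "norm (integral K (\<lambda>z. ?B n t z *\<^sub>R d z) - I n *\<^sub>R D) \<le> I n * \<delta>"
    if t: "t \<in> {0..h}" for n t
  proof -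
    have ci: "(\<lambda>z. ?B n t z) integrable_on K"
      unfolding K_def by (intro integrable_continuous cont)
    have di: "(\<lambda>z. ?B n t z *\<^sub>R d z) integrable_on K"
      using aint[OF ud(2)] set_lebesgue_integral_eq_integral(1) by blast
    have Di: "((\<lambda>z. ?B n t z *\<^sub>R D) has_integral I n *\<^sub>R D) K"
      using has_integral_scaleR_left[OF integrable_integral[OF ci], of D] Ieq[OF t] by simp
    define g where "g z = (if z \<in> N then 0 else ?B n t z *\<^sub>R d z - ?B n t z *\<^sub>R D)" for z
    have gi: "(g has_integral (integral K (\<lambda>z. ?B n t z *\<^sub>R d z) - I n *\<^sub>R D)) K"
      by (rule has_integral_spike[OF N(1) _ has_integral_diff[OF integrable_integral[OF di] Di]]) (auto simp: g_def)
    have "norm (integral K g) \<le> integral K (\<lambda>z. ?B n t z * \<delta>)"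
    proof (rule integral_norm_bound_integral)
      show "g integrable_on K" using gi by blast
      show "(\<lambda>z. ?B n t z * \<delta>) integrable_on K" using ci by (rule integrable_on_mult_left)
      fix z assume z: "z \<in> K"
      show "norm (g z) \<le> ?B n t z * \<delta>"
      proof (cases "z \<in> N")
        case True
        have "0 \<le> \<delta>" if "z \<in> K" "z \<notin> N" for z using N(2)[of z] that norm_ge_zero order_trans unfolding K_def by blast
        moreover have "\<exists>z\<in>K. z \<notin> N"
        proof (rule ccontr)
          assume "\<not> (\<exists>z\<in>K. z \<notin> N)"
          then have "negligible K" using N(1) by (meson negligible_subset subsetI)
          moreover have "box x (x + h *\<^sub>R c + \<epsilon> *\<^sub>R One) \<noteq> {}"
            using h \<epsilon> c by (auto simp: box_ne_empty inner_simps inner_Basis add_nonneg_pos)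
          ultimately show False unfolding K_def by (metis negligible_interval(1))
        qed
        ultimately have "0 \<le> \<delta>" by blast
        then show ?thesis using True cube_bump_range(1)[of n \<epsilon> "z - y t"] by (simp add: g_def)
      next
        case False
        then have "norm (g z) = ?B n t z * norm (d z - D)"
          using cube_bump_range(1)[of n \<epsilon> "z - y t"] by (simp add: g_def scaleR_right_diff_distrib[symmetric])
        then show ?thesis using N(2)[of z] False z cube_bump_range(1)[of n \<epsilon> "z - y t"]
          by (simp add: K_def mult_left_mono)
      qed
    qed
    then show ?thesis using integral_unique[OF gi] Ieq[OF t] by simp
  qed
  have inc: "norm (F n h - F n 0 - (h * I n) *\<^sub>R D) \<le> h * I n * \<delta>" for n
  proof -
    have Fint: "(F n has_vector_derivative integral K (\<lambda>z. ?B n t z *\<^sub>R d z)) (at t)" if "0 < t" "t < h" for t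
      using F'[of t n] that at_within_Icc_at[of 0 t h] by simp
    have Fc: "continuous_on {0..h} (F n)"
      using F'[of _ n] has_vector_derivative_continuous unfolding continuous_on_eq_continuous_within by blast
    have "norm ((F n h - (h * I n) *\<^sub>R D) - (F n 0 - (0 * I n) *\<^sub>R D)) \<le> h * (I n * \<delta>) - 0 * (I n * \<delta>)"
    proof (rule differentiable_bound_general[OF h])
      show "continuous_on {0..h} (\<lambda>t. F n t - (t * I n) *\<^sub>R D)" "continuous_on {0..h} (\<lambda>t. t * (I n * \<delta>))"
        by (intro continuous_intros Fc)+
      fix t assume t: "0 < t" "t < h"
      show "((\<lambda>t. F n t - (t * I n) *\<^sub>R D) has_vector_derivative
          (integral K (\<lambda>z. ?B n t z *\<^sub>R d z) - I n *\<^sub>R D)) (at t)"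
        by (auto intro!: derivative_eq_intros Fint t)
      show "((\<lambda>t. t * (I n * \<delta>)) has_vector_derivative I n * \<delta>) (at t)"
        by (auto intro!: derivative_eq_intros simp: has_real_derivative_iff_has_vector_derivative[symmetric])
      show "norm (integral K (\<lambda>z. ?B n t z *\<^sub>R d z) - I n *\<^sub>R D) \<le> I n * \<delta>"
        using F'bound t by simp
    qed
    then show ?thesis by (simp add: algebra_simps)
  qed
  have Flim: "(\<lambda>n. F n t) \<longlonglongrightarrow> integral (cbox (y t) (y t + \<epsilon> *\<^sub>R One)) u" if "t \<in> {0..h}" for t
    unfolding F_def by (rule cube_bump_integral_tendsto[OF K(1) subK[OF that] ud(1)])
  have Ilim: "(\<lambda>n. I n) \<longlonglongrightarrow> \<epsilon> ^ DIM('a)"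
  proof -
    have "(\<lambda>n. I n) \<longlonglongrightarrow> integral (cbox 0 (\<epsilon> *\<^sub>R One)) (\<lambda>_::'a. 1)"
      using cube_bump_integral_tendsto[of "cbox 0 (\<epsilon> *\<^sub>R One :: 'a)" 0 \<epsilon> "\<lambda>_. 1::real"]
      by (simp add: I_def)
    moreover have "measure lborel (cbox 0 (\<epsilon> *\<^sub>R One :: 'a)) = \<epsilon> ^ DIM('a)"
      using \<epsilon> by (subst content_cbox) auto
    ultimately show ?thesis by (simp add: I_def)
  qed
  have "norm (integral (cbox (y h) (y h + \<epsilon> *\<^sub>R One)) u - integral (cbox (y 0) (y 0 + \<epsilon> *\<^sub>R One)) u
       - (h * \<epsilon> ^ DIM('a)) *\<^sub>R D) \<le> h * \<epsilon> ^ DIM('a) * \<delta>"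
  proof (rule LIMSEQ_le)
    show "(\<lambda>n. norm (F n h - F n 0 - (h * I n) *\<^sub>R D)) \<longlonglongrightarrow> norm (integral (cbox (y h) (y h + \<epsilon> *\<^sub>R One)) u
       - integral (cbox (y 0) (y 0 + \<epsilon> *\<^sub>R One)) u - (h * \<epsilon> ^ DIM('a)) *\<^sub>R D)"
      using h by (intro tendsto_intros Flim Ilim) auto
    show "(\<lambda>n. h * I n * \<delta>) \<longlonglongrightarrow> h * \<epsilon> ^ DIM('a) * \<delta>" by (intro tendsto_intros Ilim)
  qed (use inc in blast)
  then show ?thesis by (simp add: y_def)
qed

section \<open>Continuous representatives\<close>

text \<open>The mean value of \<open>u\<close> on the cube with lower corner \<open>x\<close> and side \<open>h > 0\<close>.\<close>

definition cube_average :: "real \<Rightarrow> ('a::euclidean_space \<Rightarrow> 'b::euclidean_space) \<Rightarrow> 'a \<Rightarrow> 'b" where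
  "cube_average h u x = integral (cbox x (x + h *\<^sub>R One)) u /\<^sub>R h ^ DIM('a)"

lemma cube_neighbourhood:
  assumes "open \<Omega>" "x \<in> \<Omega>"
  obtains r where "r > 0" "cbox (x - r *\<^sub>R One) (x + r *\<^sub>R One) \<subseteq> (\<Omega> :: 'a::euclidean_space set)"
    "x \<in> box (x - r *\<^sub>R One) (x + r *\<^sub>R One)"
proof -
  obtain \<rho> where \<rho>: "\<rho> > 0" "ball x \<rho> \<subseteq> \<Omega>" using assms open_contains_ball by blast
  define r where "r = \<rho> / (real DIM('a) + 1)"
  have r: "r > 0" using \<rho> by (simp add: r_def)
  have "cbox (x - r *\<^sub>R One) (x + r *\<^sub>R One) \<subseteq> ball x \<rho>"
  proof
    fix z assume "z \<in> cbox (x - r *\<^sub>R One) (x + r *\<^sub>R One)"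
    then have "\<bar>(z - x) \<bullet> b\<bar> \<le> r" if "b \<in> Basis" for b
      using that by (force simp: mem_box inner_simps abs_le_iff)
    then have "norm (z - x) \<le> (\<Sum>b\<in>(Basis::'a set). r)"
      by (intro order_trans[OF norm_le_l1] sum_mono)
    also have "\<dots> = real DIM('a) * r" by simp
    also have "\<dots> < \<rho>" using \<rho> by (simp add: r_def field_simps)
    finally show "z \<in> ball x \<rho>" by (simp add: dist_norm norm_minus_commute)
  qed
  then show ?thesis using \<rho> r by (intro that[of r]) (auto simp: mem_box inner_simps)
qed

lemma eventually_cube_subset:
  assumes "open \<Omega>" "x \<in> \<Omega>"
  shows "\<forall>\<^sub>F h in at_right 0. cbox x (x + h *\<^sub>R One) \<subseteq> (\<Omega> :: 'a::euclidean_space set)"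
proof -
  obtain r where r: "r > 0" "cbox (x - r *\<^sub>R One) (x + r *\<^sub>R One) \<subseteq> \<Omega>"
    using cube_neighbourhood[OF assms] by blast
  have "cbox x (x + h *\<^sub>R One) \<subseteq> \<Omega>" if "0 < h" "h < r" for h
  proof (rule subset_trans[OF _ r(2)])
    show "cbox x (x + h *\<^sub>R One) \<subseteq> cbox (x - r *\<^sub>R One) (x + r *\<^sub>R One)"
      using that r(1) by (auto simp: subset_box inner_simps)
  qed
  then show ?thesis unfolding eventually_at_right_field using r(1) by blast
qed

lemma negligible_locally:
  assumes "open \<Omega>" and "\<And>x. x \<in> \<Omega> \<Longrightarrow> \<exists>U. open U \<and> x \<in> U \<and> negligible {z \<in> U. \<not> P z}"
  shows "negligible {z \<in> \<Omega>. \<not> P z}"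
  unfolding locally_negligible_alt[of "{z \<in> \<Omega>. \<not> P z}"]
proof
  fix x assume x: "x \<in> {z \<in> \<Omega>. \<not> P z}"
  then obtain U where U: "open U" "x \<in> U" "negligible {z \<in> U. \<not> P z}" using assms(2) by blast
  show "\<exists>V. openin (top_of_set {z \<in> \<Omega>. \<not> P z}) V \<and> x \<in> V \<and> negligible V"
  proof (intro exI conjI)
    show "openin (top_of_set {z \<in> \<Omega>. \<not> P z}) ({z \<in> \<Omega>. \<not> P z} \<inter> U)" using U by (auto simp: openin_open)
    show "x \<in> {z \<in> \<Omega>. \<not> P z} \<inter> U" using x U by auto
    show "negligible ({z \<in> \<Omega>. \<not> P z} \<inter> U)" by (rule negligible_subset[OF U(3)]) auto
  qed
qed

lemma cube_average_tendsto_AE: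
  fixes u :: "'a::euclidean_space \<Rightarrow> 'b::euclidean_space"
  assumes \<Omega>: "open \<Omega>" and u: "locally_integrable_on u \<Omega>"
  shows "negligible {x \<in> \<Omega>. \<not> ((\<lambda>h. cube_average h u x) \<longlongrightarrow> u x) (at_right 0)}"
proof (rule negligible_locally[OF \<Omega>])
  fix x assume "x \<in> \<Omega>"
  then obtain r where r: "r > 0" "cbox (x - r *\<^sub>R One) (x + r *\<^sub>R One) \<subseteq> \<Omega>"
    "x \<in> box (x - r *\<^sub>R One) (x + r *\<^sub>R One)"
    using cube_neighbourhood[OF \<Omega>] by blast
  define K where "K = cbox (x - r *\<^sub>R One) (x + r *\<^sub>R One)"
  define U where "U = box (x - r *\<^sub>R One) (x + r *\<^sub>R One)"
  define f where "f z = (if z \<in> K then u z else 0)" for z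
  have "u absolutely_integrable_on K"
    using u r(2) compact_cbox[of "x - r *\<^sub>R One" "x + r *\<^sub>R One"] by (simp add: locally_integrable_on_def K_def)
  then have "u integrable_on K" by (rule set_lebesgue_integral_eq_integral(1))
  then have "f integrable_on UNIV" unfolding f_def integrable_restrict_UNIV .
  then have "f integrable_on cbox a b" for a b by (rule integrable_on_subcbox) auto
  from integrable_ccontinuous_explicit[OF this] obtain N where N: "negligible N"
    "\<And>x e. \<lbrakk>x \<notin> N; 0 < e\<rbrakk> \<Longrightarrow> \<exists>d>0. \<forall>h. 0 < h \<and> h < d \<longrightarrow>
        norm (integral (cbox x (x + h *\<^sub>R One)) f /\<^sub>R h ^ DIM('a) - f x) < e" by metis
  have "((\<lambda>h. cube_average h u z) \<longlongrightarrow> u z) (at_right 0)" if z: "z \<in> U" "z \<notin> N" for z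
  proof -
    have "\<forall>\<^sub>F h in at_right 0. norm (cube_average h f z - f z) < e" if "0 < e" for e
      using N(2)[OF z(2) that] unfolding eventually_at_right_field cube_average_def by auto
    then have lim: "((\<lambda>h. cube_average h f z) \<longlongrightarrow> f z) (at_right 0)"
      by (simp add: tendsto_iff dist_norm)
    have fz: "f z = u z" using z(1) box_subset_cbox by (auto simp: f_def K_def U_def)
    have ev: "\<forall>\<^sub>F h in at_right 0. cube_average h f z = cube_average h u z"
      using eventually_cube_subset[of U z]
    proof (rule eventually_mono)
      fix h assume "cbox z (z + h *\<^sub>R One) \<subseteq> U"
      then have "integral (cbox z (z + h *\<^sub>R One)) f = integral (cbox z (z + h *\<^sub>R One)) u"
        using box_subset_cbox by (intro integral_cong) (auto simp: f_def K_def U_def)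
      then show "cube_average h f z = cube_average h u z" by (simp add: cube_average_def)
    qed (use z in \<open>auto simp: U_def\<close>)
    show ?thesis using Lim_transform_eventually[OF lim ev] fz by simp
  qed
  then have "negligible {z \<in> U. \<not> ((\<lambda>h. cube_average h u z) \<longlongrightarrow> u z) (at_right 0)}"
    by (intro negligible_subset[OF N(1)]) auto
  moreover have "open U" "x \<in> U" using r(3) by (simp_all add: U_def open_box)
  ultimately show "\<exists>U. open U \<and> x \<in> U \<and> negligible {z \<in> U. \<not> ((\<lambda>h. cube_average h u z) \<longlongrightarrow> u z) (at_right 0)}"
    by blast
qed

text \<open>The fundamental lemma of the calculus of variations.\<close>

lemma AE_eq_if_test_integrals_eq:
  fixes v w :: "'a::euclidean_space \<Rightarrow> 'b::euclidean_space"
  assumes \<Omega>: "open \<Omega>" and v: "locally_integrable_on v \<Omega>" and w: "locally_integrable_on w \<Omega>"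
    and eq: "\<And>\<phi>. test_function \<Omega> \<phi> \<Longrightarrow> (LINT x:\<Omega>|lebesgue. \<phi> x *\<^sub>R v x) = (LINT x:\<Omega>|lebesgue. \<phi> x *\<^sub>R w x)"
  shows "AE x in lebesgue_on \<Omega>. v x = w x"
proof -
  have cubes: "integral (cbox x (x + \<epsilon> *\<^sub>R One)) v = integral (cbox x (x + \<epsilon> *\<^sub>R One)) w"
    if sub: "cbox x (x + \<epsilon> *\<^sub>R One) \<subseteq> \<Omega>" for x \<epsilon>
  proof -
    define K where "K = cbox x (x + \<epsilon> *\<^sub>R One)"
    have K: "compact K" "K \<subseteq> \<Omega>" "cbox x (x + \<epsilon> *\<^sub>R One) \<subseteq> K" using sub by (auto simp: K_def)
    have vw: "v absolutely_integrable_on K" "w absolutely_integrable_on K"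
      using v w K by (auto simp: locally_integrable_on_def)
    have test: "test_function \<Omega> (\<lambda>z. cube_bump n \<epsilon> (z - x))" for n by (rule test_function_cube_bump[OF sub])
    have to_K: "(LINT z:\<Omega>|lebesgue. cube_bump n \<epsilon> (z - x) *\<^sub>R g z) = integral K (\<lambda>z. cube_bump n \<epsilon> (z - x) *\<^sub>R g z)"
      if "g absolutely_integrable_on K" for n and g :: "'a \<Rightarrow> 'b"
    proof (rule set_lebesgue_integral_supported[OF _ K(2)])
      show "(\<lambda>z. cube_bump n \<epsilon> (z - x) *\<^sub>R g z) absolutely_integrable_on K"
        by (intro absolutely_integrable_continuous_scaleR K test_function_continuous_on(1)[OF test] that)
      fix z assume "z \<notin> K"
      then have "z - x \<notin> box 0 (\<epsilon> *\<^sub>R One)" unfolding K_def using cbox_0_shift box_subset_cbox by blast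
      then show "cube_bump n \<epsilon> (z - x) *\<^sub>R g z = 0" by (simp add: cube_bump_eq_0)
    qed
    have "integral K (\<lambda>z. cube_bump n \<epsilon> (z - x) *\<^sub>R v z) = integral K (\<lambda>z. cube_bump n \<epsilon> (z - x) *\<^sub>R w z)" for n
      using eq[OF test, of n] to_K[OF vw(1), of n] to_K[OF vw(2), of n] by simp
    then show ?thesis
      using cube_bump_integral_tendsto[OF K(1,3) vw(1)] cube_bump_integral_tendsto[OF K(1,3) vw(2)]
      by (simp add: LIMSEQ_unique)
  qed
  show ?thesis
  proof (rule AE_lebesgue_onI)
    let ?N = "\<lambda>u. {x \<in> \<Omega>. \<not> ((\<lambda>h. cube_average h u x) \<longlongrightarrow> (u x :: 'b)) (at_right 0)}"
    show "negligible (?N v \<union> ?N w)" by (intro negligible_Un cube_average_tendsto_AE \<Omega> v w)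
    fix x assume x: "x \<in> \<Omega>" "x \<notin> ?N v \<union> ?N w"
    have "\<forall>\<^sub>F h in at_right 0. cube_average h v x = cube_average h w x"
      using eventually_cube_subset[OF \<Omega> x(1)] by eventually_elim (simp add: cube_average_def cubes)
    then have "((\<lambda>h. cube_average h w x) \<longlongrightarrow> v x) (at_right 0)"
      using x by (auto intro: Lim_transform_eventually)
    then show "v x = w x" using x by (auto intro: tendsto_unique[OF trivial_limit_at_right_real])
  qed (use \<Omega> in auto)
qed

lemma has_weak_deriv_unique:
  assumes "open \<Omega>" "has_weak_deriv \<Omega> bs u v" "has_weak_deriv \<Omega> bs u w"
  shows "AE x in lebesgue_on \<Omega>. v x = w x"
proof (rule AE_eq_if_test_integrals_eq[OF assms(1)])
  fix \<phi> assume "test_function \<Omega> \<phi>"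
  then have "((- 1) ^ length bs :: real) *\<^sub>R (LINT x:\<Omega>|lebesgue. \<phi> x *\<^sub>R v x) = (- 1) ^ length bs *\<^sub>R (LINT x:\<Omega>|lebesgue. \<phi> x *\<^sub>R w x)"
    using assms(2,3) unfolding has_weak_deriv_def by metis
  then show "(LINT x:\<Omega>|lebesgue. \<phi> x *\<^sub>R v x) = (LINT x:\<Omega>|lebesgue. \<phi> x *\<^sub>R w x)" by simp
qed (use assms in \<open>auto simp: has_weak_deriv_def\<close>)

lemma content_cube: "0 < h \<Longrightarrow> measure lborel (cbox x (x + h *\<^sub>R One)) = h ^ DIM('a)"
  for x :: "'a::euclidean_space"
  by (subst content_cbox) (auto simp: inner_simps)

lemma cube_average_tendsto_continuous:
  fixes u f :: "'a::euclidean_space \<Rightarrow> 'b::euclidean_space"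
  assumes S: "open S" "x \<in> S" and f: "continuous_on S f" and N: "negligible N" "\<And>z. z \<in> S \<Longrightarrow> z \<notin> N \<Longrightarrow> u z = f z"
  shows "((\<lambda>h. cube_average h u x) \<longlongrightarrow> f x) (at_right 0)"
  unfolding tendsto_iff
proof (intro allI impI)
  fix e :: real assume e: "e > 0"
  have "open {z \<in> S. dist (f z) (f x) < e / 2}"
  proof -
    have "open (S \<inter> (\<lambda>z. f z) -` ball (f x) (e / 2))"
      using f S by (intro continuous_open_preimage) auto
    moreover have "S \<inter> (\<lambda>z. f z) -` ball (f x) (e / 2) = {z \<in> S. dist (f z) (f x) < e / 2}"
      by (auto simp: dist_commute)
    ultimately show ?thesis by simp
  qed
  then have "\<forall>\<^sub>F h in at_right 0. cbox x (x + h *\<^sub>R One) \<subseteq> {z \<in> S. dist (f z) (f x) < e / 2}"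
    using e S by (intro eventually_cube_subset) auto
  then show "\<forall>\<^sub>F h in at_right 0. dist (cube_average h u x) (f x) < e"
    using eventually_at_right_less[of "0::real"]
  proof eventually_elim
    case (elim h)
    let ?Q = "cbox x (x + h *\<^sub>R One)"
    have c: "measure lborel ?Q = h ^ DIM('a)" by (rule content_cube[OF elim(2)])
    have fi: "(f has_integral integral ?Q f) ?Q"
      using f elim(1) by (intro integrable_integral integrable_continuous) (auto elim: continuous_on_subset)
    have "integral ?Q u = integral ?Q f"
      by (rule integral_spike[OF N(1)]) (use N(2) elim(1) in auto)
    moreover have "norm (integral ?Q f - (h ^ DIM('a)) *\<^sub>R f x) \<le> e / 2 * measure lborel ?Q"
    proof (rule has_integral_bound)
      show "((\<lambda>z. f z - f x) has_integral (integral ?Q f - (h ^ DIM('a)) *\<^sub>R f x)) ?Q"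
        using has_integral_diff[OF fi has_integral_const[of "f x" x "x + h *\<^sub>R One"]] c by simp
      show "norm (f z - f x) \<le> e / 2" if "z \<in> ?Q" for z
        using elim(1) that unfolding dist_norm[symmetric] by (simp add: subset_iff less_imp_le)
    qed (use e in simp)
    moreover have avg: "cube_average h u x - f x = (integral ?Q u - (h ^ DIM('a)) *\<^sub>R f x) /\<^sub>R h ^ DIM('a)"
      using elim(2) by (simp add: cube_average_def scaleR_right_diff_distrib)
    ultimately have "norm (cube_average h u x - f x) \<le> inverse (h ^ DIM('a)) * (e / 2 * h ^ DIM('a))"
      unfolding avg norm_scaleR using elim(2) c by (simp add: mult_left_mono del: times_divide_eq_left)
    then have "norm (cube_average h u x - f x) \<le> e / 2"
      using elim(2) by (simp add: mult_ac)
    then show ?case using e by (simp add: dist_norm)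
  qed
qed

lemma cube_average_increment_axis:
  fixes u d :: "'a::euclidean_space \<Rightarrow> 'b::euclidean_space"
  assumes w: "has_weak_deriv \<Omega> [c] u d" and c: "c \<in> Basis" and \<epsilon>: "0 < \<epsilon>"
    and xy: "x \<in> cbox p q" "x + t *\<^sub>R c \<in> cbox p q" and sub: "cbox p (q + \<epsilon> *\<^sub>R One) \<subseteq> \<Omega>"
    and N: "negligible N" "\<And>z. z \<in> cbox p (q + \<epsilon> *\<^sub>R One) \<Longrightarrow> z \<notin> N \<Longrightarrow> norm (d z - D) \<le> \<delta>"
  shows "norm (cube_average \<epsilon> u (x + t *\<^sub>R c) - cube_average \<epsilon> u x - t *\<^sub>R D) \<le> \<delta> * \<bar>t\<bar>"
proof -
  have pos: "norm (cube_average \<epsilon> u (x + t *\<^sub>R c) - cube_average \<epsilon> u x - t *\<^sub>R D) \<le> \<delta> * t"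
    if "t > 0" "x \<in> cbox p q" "x + t *\<^sub>R c \<in> cbox p q" for x t
  proof -
    have "cbox x (x + t *\<^sub>R c + \<epsilon> *\<^sub>R One) \<subseteq> cbox p (q + \<epsilon> *\<^sub>R One)"
      using that(2,3) by (auto simp: subset_box mem_box inner_simps)
    then have "norm (integral (cbox (x + t *\<^sub>R c) (x + t *\<^sub>R c + \<epsilon> *\<^sub>R One)) u
       - integral (cbox x (x + \<epsilon> *\<^sub>R One)) u - (t * \<epsilon> ^ DIM('a)) *\<^sub>R D) \<le> t * \<epsilon> ^ DIM('a) * \<delta>"
      using sub by (intro cube_integral_increment[OF w c that(1) \<epsilon> _ N(1)] N(2)) auto
    moreover have "cube_average \<epsilon> u (x + t *\<^sub>R c) - cube_average \<epsilon> u x - t *\<^sub>R D =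
      (integral (cbox (x + t *\<^sub>R c) (x + t *\<^sub>R c + \<epsilon> *\<^sub>R One)) u
       - integral (cbox x (x + \<epsilon> *\<^sub>R One)) u - (t * \<epsilon> ^ DIM('a)) *\<^sub>R D) /\<^sub>R \<epsilon> ^ DIM('a)"
      using \<epsilon> by (simp add: cube_average_def scaleR_right_diff_distrib)
    ultimately have "norm (cube_average \<epsilon> u (x + t *\<^sub>R c) - cube_average \<epsilon> u x - t *\<^sub>R D)
      \<le> inverse (\<epsilon> ^ DIM('a)) * (t * \<epsilon> ^ DIM('a) * \<delta>)"
      using \<epsilon> by (simp only: norm_scaleR) (simp add: mult_left_mono)
    then show ?thesis using \<epsilon> by (simp add: mult_ac)
  qed
  consider "t > 0" | "t = 0" | "t < 0" by linarith
  then show ?thesis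
  proof cases
    case 1 then show ?thesis using pos[OF 1 xy] by simp
  next
    case 3
    have "norm (cube_average \<epsilon> u (x + t *\<^sub>R c + (- t) *\<^sub>R c) - cube_average \<epsilon> u (x + t *\<^sub>R c) - (- t) *\<^sub>R D) \<le> \<delta> * (- t)"
      using 3 xy by (intro pos) auto
    then have "norm (- (cube_average \<epsilon> u (x + t *\<^sub>R c) - cube_average \<epsilon> u x - t *\<^sub>R D)) \<le> \<delta> * (- t)"
      by (simp add: algebra_simps)
    then show ?thesis using 3 by (simp only: norm_minus_cancel abs_of_neg)
  qed simp
qed

text \<open>The path from \<open>x\<close> to \<open>y\<close> changes one coordinate at a time, and so remains in every box that contains both points.\<close>

lemma cube_average_increment:
  fixes u :: "'a::euclidean_space \<Rightarrow> 'b::euclidean_space"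
  assumes w: "\<And>c. c \<in> Basis \<Longrightarrow> has_weak_deriv \<Omega> [c] u (d c)" and \<epsilon>: "0 < \<epsilon>"
    and xy: "x \<in> cbox p q" "y \<in> cbox p q" and sub: "cbox p (q + \<epsilon> *\<^sub>R One) \<subseteq> \<Omega>"
    and N: "negligible N"
      "\<And>c z. c \<in> Basis \<Longrightarrow> z \<in> cbox p (q + \<epsilon> *\<^sub>R One) \<Longrightarrow> z \<notin> N \<Longrightarrow> norm (d c z - D c) \<le> \<delta>"
  shows "norm (cube_average \<epsilon> u y - cube_average \<epsilon> u x - (\<Sum>c\<in>Basis. ((y - x) \<bullet> c) *\<^sub>R D c))
     \<le> \<delta> * (\<Sum>c\<in>Basis. \<bar>(y - x) \<bullet> c\<bar>)"
proof -
  define z where "z F = x + (\<Sum>c\<in>F. ((y - x) \<bullet> c) *\<^sub>R c)" for F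
  have zin: "z F \<in> cbox p q" if "F \<subseteq> Basis" for F
    unfolding mem_box
  proof
    fix b :: 'a assume b: "b \<in> Basis"
    have fin: "finite F" using that finite_Basis by (rule finite_subset)
    have "(\<Sum>c\<in>F. ((y - x) \<bullet> c) *\<^sub>R c) \<bullet> b = (\<Sum>c\<in>F. if c = b then (y - x) \<bullet> b else 0)"
      unfolding inner_sum_left using that b by (intro sum.cong) (auto simp: inner_Basis)
    also have "\<dots> = (if b \<in> F then (y - x) \<bullet> b else 0)" using fin by simp
    finally have "z F \<bullet> b = (if b \<in> F then y \<bullet> b else x \<bullet> b)" by (simp add: z_def inner_simps)
    then show "p \<bullet> b \<le> z F \<bullet> b \<and> z F \<bullet> b \<le> q \<bullet> b" using xy b by (auto simp: mem_box)
  qed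
  have "norm (cube_average \<epsilon> u (z F) - cube_average \<epsilon> u x - (\<Sum>c\<in>F. ((y - x) \<bullet> c) *\<^sub>R D c))
     \<le> \<delta> * (\<Sum>c\<in>F. \<bar>(y - x) \<bullet> c\<bar>)" if "F \<subseteq> Basis" for F
    using finite_subset[OF that finite_Basis] that
  proof (induction F rule: finite_induct)
    case empty then show ?case by (simp add: z_def)
  next
    case (insert c F)
    have z': "z (insert c F) = z F + ((y - x) \<bullet> c) *\<^sub>R c" using insert by (simp add: z_def algebra_simps)
    have 1: "norm (cube_average \<epsilon> u (z F + ((y - x) \<bullet> c) *\<^sub>R c) - cube_average \<epsilon> u (z F) - ((y - x) \<bullet> c) *\<^sub>R D c) \<le> \<delta> * \<bar>(y - x) \<bullet> c\<bar>"
      using insert.prems zin[of F] zin[of "insert c F"] z'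
      by (intro cube_average_increment_axis[OF w _ \<epsilon> _ _ sub N(1)] N(2)) auto
    have 2: "norm (cube_average \<epsilon> u (z F) - cube_average \<epsilon> u x - (\<Sum>c\<in>F. ((y - x) \<bullet> c) *\<^sub>R D c))
     \<le> \<delta> * (\<Sum>c\<in>F. \<bar>(y - x) \<bullet> c\<bar>)" using insert by auto
    have 3: "cube_average \<epsilon> u (z (insert c F)) - cube_average \<epsilon> u x - (\<Sum>c\<in>insert c F. ((y - x) \<bullet> c) *\<^sub>R D c)
       = (cube_average \<epsilon> u (z F + ((y - x) \<bullet> c) *\<^sub>R c) - cube_average \<epsilon> u (z F) - ((y - x) \<bullet> c) *\<^sub>R D c)
        + (cube_average \<epsilon> u (z F) - cube_average \<epsilon> u x - (\<Sum>c\<in>F. ((y - x) \<bullet> c) *\<^sub>R D c))"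
      using insert z' by simp
    have "norm (cube_average \<epsilon> u (z (insert c F)) - cube_average \<epsilon> u x - (\<Sum>c\<in>insert c F. ((y - x) \<bullet> c) *\<^sub>R D c))
       \<le> \<delta> * \<bar>(y - x) \<bullet> c\<bar> + \<delta> * (\<Sum>c\<in>F. \<bar>(y - x) \<bullet> c\<bar>)"
      unfolding 3 by (rule norm_triangle_mono[OF 1 2])
    then show ?case using insert(1,2) by (simp add: distrib_left)
  qed
  from this[of Basis] show ?thesis by (simp add: z_def euclidean_representation)
qed

lemma sum_abs_inner_Basis_le: "(\<Sum>c\<in>Basis. \<bar>x \<bullet> c\<bar>) \<le> real DIM('a) * norm (x :: 'a::euclidean_space)"
  using sum_mono[of Basis "\<lambda>c. \<bar>x \<bullet> c\<bar>" "\<lambda>_. norm x"] Basis_le_norm[of _ x] by simp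

text \<open>A bounded weak gradient makes the function Lipschitz off a null set, locally; hence it has
  a continuous representative.\<close>

theorem continuous_representative_exists:
  fixes u :: "'a::euclidean_space \<Rightarrow> 'b::euclidean_space"
  assumes \<Omega>: "open \<Omega>" and u: "locally_integrable_on u \<Omega>"
    and w: "\<And>c. c \<in> Basis \<Longrightarrow> has_weak_deriv \<Omega> [c] u (d c)"
    and M: "\<And>c. c \<in> Basis \<Longrightarrow> AE z in lebesgue_on \<Omega>. norm (d c z) \<le> M"
  obtains W where "continuous_on \<Omega> W" "AE z in lebesgue_on \<Omega>. W z = u z"
proof -
  have "AE z in lebesgue_on \<Omega>. \<forall>c\<in>Basis. norm (d c z) \<le> M"
    by (intro AE_finite_allI) (auto intro: M)
  then obtain N where "negligible N" "\<And>z. z \<in> \<Omega> \<Longrightarrow> z \<notin> N \<Longrightarrow> \<forall>c\<in>Basis. norm (d c z) \<le> M"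
    by (rule AE_lebesgue_onE) (use \<Omega> in auto)
  then have N: "negligible N" "\<And>c z. c \<in> Basis \<Longrightarrow> z \<in> \<Omega> \<Longrightarrow> z \<notin> N \<Longrightarrow> norm (d c z) \<le> M"
    by blast+
  define N' where "N' = {x \<in> \<Omega>. \<not> ((\<lambda>h. cube_average h u x) \<longlongrightarrow> u x) (at_right 0)}"
  have N': "negligible N'" unfolding N'_def by (rule cube_average_tendsto_AE[OF \<Omega> u])
  define W where "W x = Lim (at_right 0) (\<lambda>h. cube_average h u x)" for x
  have Wu: "W x = u x" if "x \<in> \<Omega>" "x \<notin> N'" for x
    using that unfolding W_def N'_def by (auto intro: tendsto_Lim)
  have "isCont W x0" if x0: "x0 \<in> \<Omega>" for x0
  proof -
    obtain r where r: "r > 0" "cbox (x0 - r *\<^sub>R One) (x0 + r *\<^sub>R One) \<subseteq> \<Omega>"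
      using cube_neighbourhood[OF \<Omega> x0] by blast
    define p where "p = x0 - (r / 2) *\<^sub>R One"
    define q where "q = x0 + (r / 2) *\<^sub>R One"
    have cub: "cbox p (q + \<epsilon> *\<^sub>R One) \<subseteq> \<Omega>" if "\<epsilon> \<le> r / 2" for \<epsilon>
    proof (rule subset_trans[OF _ r(2)])
      show "cbox p (q + \<epsilon> *\<^sub>R One) \<subseteq> cbox (x0 - r *\<^sub>R One) (x0 + r *\<^sub>R One)"
        using that r(1) by (auto simp: p_def q_def subset_box inner_simps)
    qed
    have x0b: "x0 \<in> box p q" using r(1) by (auto simp: p_def q_def mem_box inner_simps)
    have pq: "cbox p q \<subseteq> \<Omega>" using cub[of 0] r(1) by simp
    define S where "S = box p q - N'"
    define L where "L = max M 0 * real DIM('a)"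
    have L: "L \<ge> 0" by (simp add: L_def)
    have lip: "norm (u y - u x) \<le> L * norm (y - x)" if "x \<in> S" "y \<in> S" for x y
    proof -
      have xy: "x \<in> cbox p q" "y \<in> cbox p q" "x \<in> \<Omega>" "y \<in> \<Omega>" "x \<notin> N'" "y \<notin> N'"
        using that pq box_subset_cbox[of p q] by (auto simp: S_def)
      have lim: "((\<lambda>h. norm (cube_average h u y - cube_average h u x)) \<longlongrightarrow> norm (u y - u x)) (at_right 0)"
        using xy by (intro tendsto_intros) (auto simp: N'_def)
      show ?thesis
      proof (rule tendsto_upperbound[OF lim])
        have "norm (cube_average h u y - cube_average h u x) \<le> L * norm (y - x)" if h: "0 < h" "h < r / 2" for h
        proof -
          have "norm (cube_average h u y - cube_average h u x - (\<Sum>c\<in>Basis. ((y - x) \<bullet> c) *\<^sub>R 0))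
            \<le> max M 0 * (\<Sum>c\<in>Basis. \<bar>(y - x) \<bullet> c\<bar>)"
            using cub[of h] h N(2)
            by (intro cube_average_increment[OF w h(1) xy(1,2) _ N(1)]) (auto simp: max.coboundedI1 subset_iff)
          also have "\<dots> \<le> max M 0 * (real DIM('a) * norm (y - x))"
            by (intro mult_left_mono sum_abs_inner_Basis_le) simp
          finally show ?thesis by (simp add: L_def mult.assoc)
        qed
        then show "\<forall>\<^sub>F h in at_right 0. norm (cube_average h u y - cube_average h u x) \<le> L * norm (y - x)"
          unfolding eventually_at_right_field using r(1) by (intro exI[of _ "r / 2"]) auto
      qed simp
    qed
    have "uniformly_continuous_on S u"
      by (rule lipschitz_on_uniformly_continuous[of L]) (use lip L in \<open>auto intro!: lipschitz_onI simp: dist_norm\<close>)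
    then obtain g where g: "uniformly_continuous_on (closure S) g" "\<And>x. x \<in> S \<Longrightarrow> u x = g x"
      using uniformly_continuous_on_extension_on_closure by metis
    have dense: "box p q \<subseteq> closure S"
    proof
      fix x assume x: "x \<in> box p q"
      show "x \<in> closure S"
      proof (rule ccontr)
        assume nx: "x \<notin> closure S"
        have "box p q - closure S \<subseteq> N'" using closure_subset[of S] by (auto simp: S_def)
        then have "negligible (box p q - closure S)" by (rule negligible_subset[OF N'])
        moreover have "open (box p q - closure S)" by (intro open_Diff open_box closed_closure)
        moreover have "box p q - closure S \<noteq> {}" using nx x by blast
        ultimately show False using open_not_negligible by blast
      qed
    qed
    then have gc: "continuous_on (box p q) g"
      by (rule continuous_on_subset[OF uniformly_continuous_imp_continuous[OF g(1)]])
    have Wg: "W x = g x" if "x \<in> box p q" for x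
      unfolding W_def
    proof (rule tendsto_Lim)
      show "((\<lambda>h. cube_average h u x) \<longlongrightarrow> g x) (at_right 0)"
        by (rule cube_average_tendsto_continuous[OF open_box that gc N']) (simp add: g(2) S_def)
    qed simp
    have "continuous_on (box p q) W" using gc Wg by (simp cong: continuous_on_cong)
    then show ?thesis using x0b continuous_on_eq_continuous_at[OF open_box] by blast
  qed
  then have "continuous_on \<Omega> W" by (simp add: continuous_at_imp_continuous_on)
  moreover have "AE z in lebesgue_on \<Omega>. W z = u z"
    by (rule AE_lebesgue_onI[OF _ N' Wu]) (use \<Omega> in auto)
  ultimately show ?thesis by (rule that)
qed

text \<open>The estimate for averages passes to the limit at every point, as \<open>W\<close> is continuous. The case
  \<open>D = 0\<close> gives Lipschitz bounds; the case where \<open>D\<close> consists of the partial derivatives at \<open>x\<close> gives Taylor estimates.\<close>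

theorem continuous_representative_increment:
  fixes u W :: "'a::euclidean_space \<Rightarrow> 'b::euclidean_space"
  assumes W: "continuous_on \<Omega> W" "AE z in lebesgue_on \<Omega>. W z = u z" and \<Omega>: "open \<Omega>"
    and w: "\<And>c. c \<in> Basis \<Longrightarrow> has_weak_deriv \<Omega> [c] u (d c)"
    and r: "ball x r \<subseteq> \<Omega>" "y \<in> ball x r"
    and \<delta>: "\<And>c. c \<in> Basis \<Longrightarrow> AE z in lebesgue_on \<Omega>. z \<in> ball x r \<longrightarrow> norm (d c z - D c) \<le> \<delta>"
  shows "norm (W y - W x - (\<Sum>c\<in>Basis. ((y - x) \<bullet> c) *\<^sub>R D c)) \<le> \<delta> * (\<Sum>c\<in>Basis. \<bar>(y - x) \<bullet> c\<bar>)"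
proof -
  have "AE z in lebesgue_on \<Omega>. (\<forall>c\<in>Basis. z \<in> ball x r \<longrightarrow> norm (d c z - D c) \<le> \<delta>) \<and> W z = u z"
    by (intro AE_conjI AE_finite_allI W(2) \<delta> finite_Basis)
  then obtain N where "negligible N" "\<And>z. z \<in> \<Omega> \<Longrightarrow> z \<notin> N \<Longrightarrow>
      (\<forall>c\<in>Basis. z \<in> ball x r \<longrightarrow> norm (d c z - D c) \<le> \<delta>) \<and> W z = u z"
    by (rule AE_lebesgue_onE) (use \<Omega> in auto)
  then have N: "negligible N" "\<And>c z. c \<in> Basis \<Longrightarrow> z \<in> \<Omega> \<Longrightarrow> z \<notin> N \<Longrightarrow> z \<in> ball x r \<Longrightarrow> norm (d c z - D c) \<le> \<delta>"
     "\<And>z. z \<in> \<Omega> \<Longrightarrow> z \<notin> N \<Longrightarrow> u z = W z"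
    by (auto simp del: mem_ball)
  \<comment> \<open>The box spanned by \<open>x\<close> and \<open>y\<close> is contained in the closed ball about \<open>x\<close> through \<open>y\<close>; slightly enlarged, it is
    still contained in the open ball.\<close>
  define p where "p = (\<Sum>b\<in>Basis. min (x \<bullet> b) (y \<bullet> b) *\<^sub>R b)"
  define q where "q = (\<Sum>b\<in>Basis. max (x \<bullet> b) (y \<bullet> b) *\<^sub>R b)"
  have xy: "x \<in> cbox p q" "y \<in> cbox p q" by (auto simp: p_def q_def mem_box)
  have sub: "cbox p q \<subseteq> cball x (dist x y)"
  proof
    fix z assume z: "z \<in> cbox p q"
    have "\<bar>(z - x) \<bullet> b\<bar> \<le> \<bar>(y - x) \<bullet> b\<bar>" if "b \<in> Basis" for b
      using z that by (force simp: p_def q_def mem_box inner_simps min_def max_def split: if_splits)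
    then have "norm (z - x) \<le> norm (y - x)" by (rule norm_le_componentwise)
    then show "z \<in> cball x (dist x y)" by (simp add: dist_norm norm_minus_commute)
  qed
  define \<eta> where "\<eta> = (r - dist x y) / (real DIM('a) + 1)"
  have \<eta>: "\<eta> > 0" using r by (simp add: \<eta>_def)
  have sub': "cbox p (q + \<epsilon> *\<^sub>R One) \<subseteq> ball x r" if "0 < \<epsilon>" "\<epsilon> < \<eta>" for \<epsilon>
  proof
    fix z assume z: "z \<in> cbox p (q + \<epsilon> *\<^sub>R One)"
    define z' where "z' = (\<Sum>b\<in>Basis. min (z \<bullet> b) (q \<bullet> b) *\<^sub>R b)"
    have "p \<bullet> b \<le> q \<bullet> b" if "b \<in> Basis" for b using xy(1) that by (auto simp: mem_box)
    then have "z' \<in> cbox p q" using z by (auto simp: z'_def mem_box)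
    then have 1: "dist x z' \<le> dist x y" using sub by auto
    have "norm (z - z') \<le> (\<Sum>b\<in>(Basis::'a set). \<epsilon>)"
    proof (intro order_trans[OF norm_le_l1] sum_mono)
      fix b :: 'a assume "b \<in> Basis"
      then show "\<bar>(z - z') \<bullet> b\<bar> \<le> \<epsilon>" using z that by (auto simp: z'_def mem_box inner_simps min_def)
    qed
    then have "dist z' z \<le> real DIM('a) * \<epsilon>" by (simp add: dist_norm norm_minus_commute)
    also have "\<dots> < real DIM('a) * \<eta>" using that by simp
    also have "\<dots> \<le> r - dist x y" using r by (simp add: \<eta>_def field_simps)
    finally show "z \<in> ball x r" using 1 dist_triangle[of x z z'] by simp
  qed
  have "0 < r" using r(2) zero_le_dist[of x y] unfolding mem_ball by linarith
  then have xin: "x \<in> \<Omega>" "y \<in> \<Omega>" using r by auto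
  have "((\<lambda>\<epsilon>. norm (cube_average \<epsilon> u y - cube_average \<epsilon> u x - (\<Sum>c\<in>Basis. ((y - x) \<bullet> c) *\<^sub>R D c))) \<longlongrightarrow>
      norm (W y - W x - (\<Sum>c\<in>Basis. ((y - x) \<bullet> c) *\<^sub>R D c))) (at_right 0)"
    by (intro tendsto_intros cube_average_tendsto_continuous[OF \<Omega> _ W(1) N(1) N(3)] xin)
  then show ?thesis
  proof (rule tendsto_upperbound)
    have "norm (cube_average \<epsilon> u y - cube_average \<epsilon> u x - (\<Sum>c\<in>Basis. ((y - x) \<bullet> c) *\<^sub>R D c))
       \<le> \<delta> * (\<Sum>c\<in>Basis. \<bar>(y - x) \<bullet> c\<bar>)" if "0 < \<epsilon>" "\<epsilon> < \<eta>" for \<epsilon>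
      using sub'[OF that] r(1) by (intro cube_average_increment[OF w that(1) xy _ N(1)] N(2)) auto
    then show "\<forall>\<^sub>F \<epsilon> in at_right 0. norm (cube_average \<epsilon> u y - cube_average \<epsilon> u x - (\<Sum>c\<in>Basis. ((y - x) \<bullet> c) *\<^sub>R D c))
       \<le> \<delta> * (\<Sum>c\<in>Basis. \<bar>(y - x) \<bullet> c\<bar>)"
      unfolding eventually_at_right_field using \<eta> by auto
  qed simp
qed

section \<open>Higher weak derivatives\<close>

lemma iter_deriv_append: "iter_deriv (bs @ cs) f = iter_deriv bs (iter_deriv cs f)"
  by (induction bs) auto

lemma test_function_iter_deriv1:
  assumes \<phi>: "test_function \<Omega> \<phi>" and c: "c \<in> Basis"
  shows "test_function \<Omega> (iter_deriv [c] \<phi>)"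
    "closure {x. iter_deriv [c] \<phi> x \<noteq> 0} \<subseteq> closure {x. \<phi> x \<noteq> 0}"
proof -
  let ?S = "closure {x. \<phi> x \<noteq> 0}"
  have zero: "iter_deriv [c] \<phi> x = 0" if "x \<notin> ?S" for x
  proof -
    have "((\<lambda>_. 0) has_derivative (\<lambda>_. 0)) (at x)" by simp
    then have "(\<phi> has_derivative (\<lambda>_. 0)) (at x)"
      by (rule has_derivative_transform_within_open[where s = "- ?S"])
        (use that closure_subset[of "{x. \<phi> x \<noteq> 0}"] in auto)
    then have "frechet_derivative \<phi> (at x) = (\<lambda>_. 0)" by (metis frechet_derivative_at)
    then show ?thesis by simp
  qed
  then show sub: "closure {x. iter_deriv [c] \<phi> x \<noteq> 0} \<subseteq> ?S"
    by (intro closure_minimal) auto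
  have C: "C_k k (iter_deriv [c] \<phi>)" for k
  proof -
    have CS: "C_k (Suc k) \<phi>" using \<phi> by (simp add: test_function_def)
    have "bs @ [c] \<in> multi_indices (Suc k)" if "bs \<in> multi_indices k" for bs
      using that c by (simp add: multi_indices_def)
    then show ?thesis using CS unfolding C_k_def iter_deriv_append[symmetric] by force
  qed
  have S: "compact ?S" "?S \<subseteq> \<Omega>" using \<phi> by (simp_all add: test_function_def)
  have "compact (?S \<inter> closure {x. iter_deriv [c] \<phi> x \<noteq> 0})" by (intro compact_Int_closed S closed_closure)
  then have "compact (closure {x. iter_deriv [c] \<phi> x \<noteq> 0})" unfolding Int_absorb1[OF sub] .
  then show "test_function \<Omega> (iter_deriv [c] \<phi>)"
    using C subset_trans[OF sub S(2)] unfolding test_function_def by simp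
qed

lemma test_function_iter_deriv:
  assumes \<phi>: "test_function \<Omega> \<phi>" and bs: "bs \<in> lists Basis"
  shows "test_function \<Omega> (iter_deriv bs \<phi>) \<and>
    closure {x. iter_deriv bs \<phi> x \<noteq> 0} \<subseteq> closure {x. \<phi> x \<noteq> 0}"
  using bs
proof (induction bs)
  case (Cons c bs)
  then have IH: "test_function \<Omega> (iter_deriv bs \<phi>)" "closure {x. iter_deriv bs \<phi> x \<noteq> 0} \<subseteq> closure {x. \<phi> x \<noteq> 0}"
    and c: "c \<in> Basis" by auto
  have eq: "iter_deriv (c # bs) \<phi> = iter_deriv [c] (iter_deriv bs \<phi>)" by simp
  show ?case unfolding eq
    using test_function_iter_deriv1(1)[OF IH(1) c] subset_trans[OF test_function_iter_deriv1(2)[OF IH(1) c] IH(2)]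
    by (rule conjI)
qed (use \<phi> in auto)

text \<open>The new index is appended: the innermost derivative \<open>\<partial>\<^sub>c\<close> of the test function gives again a test
  function, for which the weak derivative of order \<open>bs\<close> applies.\<close>

lemma has_weak_deriv_step:
  assumes v: "has_weak_deriv \<Omega> bs u v" and w: "has_weak_deriv \<Omega> (bs @ [c]) u w" and c: "c \<in> Basis"
  shows "has_weak_deriv \<Omega> [c] v w"
  unfolding has_weak_deriv_def
proof (intro conjI allI impI)
  fix \<phi> assume \<phi>: "test_function \<Omega> \<phi>"
  let ?s = "(- 1) ^ length bs :: real"
  have "(LINT x:\<Omega>|lebesgue. iter_deriv bs (iter_deriv [c] \<phi>) x *\<^sub>R u x)
     = ?s *\<^sub>R (LINT x:\<Omega>|lebesgue. iter_deriv [c] \<phi> x *\<^sub>R v x)"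
    using v test_function_iter_deriv1(1)[OF \<phi> c] unfolding has_weak_deriv_def by blast
  moreover have "(LINT x:\<Omega>|lebesgue. iter_deriv (bs @ [c]) \<phi> x *\<^sub>R u x)
     = (- ?s) *\<^sub>R (LINT x:\<Omega>|lebesgue. \<phi> x *\<^sub>R w x)"
    using w \<phi> unfolding has_weak_deriv_def by simp
  ultimately have "?s *\<^sub>R (LINT x:\<Omega>|lebesgue. iter_deriv [c] \<phi> x *\<^sub>R v x) = ?s *\<^sub>R (- (LINT x:\<Omega>|lebesgue. \<phi> x *\<^sub>R w x))"
    unfolding iter_deriv_append by simp
  then have "(LINT x:\<Omega>|lebesgue. iter_deriv [c] \<phi> x *\<^sub>R v x) = - (LINT x:\<Omega>|lebesgue. \<phi> x *\<^sub>R w x)"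
    by (simp only: scaleR_cancel_left) simp
  then show "(LINT x:\<Omega>|lebesgue. iter_deriv [c] \<phi> x *\<^sub>R v x) = (- 1) ^ length [c] *\<^sub>R (LINT x:\<Omega>|lebesgue. \<phi> x *\<^sub>R w x)"
    by simp
qed (use v w in \<open>auto simp: has_weak_deriv_def\<close>)

lemma has_weak_deriv_diff:
  assumes 1: "has_weak_deriv \<Omega> bs u1 v1" and 2: "has_weak_deriv \<Omega> bs u2 v2" and bs: "bs \<in> lists Basis"
  shows "has_weak_deriv \<Omega> bs (\<lambda>x. u1 x - u2 x) (\<lambda>x. v1 x - v2 x)"
  unfolding has_weak_deriv_def
proof (intro conjI allI impI)
  have li: "locally_integrable_on u1 \<Omega>" "locally_integrable_on u2 \<Omega>"
    "locally_integrable_on v1 \<Omega>" "locally_integrable_on v2 \<Omega>"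
    using 1 2 by (auto simp: has_weak_deriv_def)
  show "locally_integrable_on (\<lambda>x. u1 x - u2 x) \<Omega>" "locally_integrable_on (\<lambda>x. v1 x - v2 x) \<Omega>"
    using li unfolding locally_integrable_on_def by (blast intro: set_integral_diff(1))+
  fix \<phi> assume \<phi>: "test_function \<Omega> \<phi>"
  have diff: "(LINT x:\<Omega>|lebesgue. \<phi> x *\<^sub>R (f x - g x)) = (LINT x:\<Omega>|lebesgue. \<phi> x *\<^sub>R f x) - (LINT x:\<Omega>|lebesgue. \<phi> x *\<^sub>R g x)"
    if \<phi>: "test_function \<Omega> \<phi>" and f: "locally_integrable_on f \<Omega>" and g: "locally_integrable_on g \<Omega>" for \<phi> and f g :: "'a \<Rightarrow> 'b"
  proof -
    obtain K where K: "compact K" "K \<subseteq> \<Omega>" and z: "\<And>x. x \<notin> K \<Longrightarrow> \<phi> x = 0"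
      using \<phi> closure_subset[of "{x. \<phi> x \<noteq> 0}"]
      unfolding test_function_def by (metis (mono_tags, lifting) mem_Collect_eq subset_iff)
    have ai: "(\<lambda>x. \<phi> x *\<^sub>R f x) absolutely_integrable_on K" "(\<lambda>x. \<phi> x *\<^sub>R g x) absolutely_integrable_on K"
      using K f g by (intro absolutely_integrable_continuous_scaleR test_function_continuous_on(1)[OF \<phi>];
          simp add: locally_integrable_on_def)+
    have "(\<lambda>x. \<phi> x *\<^sub>R (f x - g x)) absolutely_integrable_on K"
      using set_integral_diff(1)[OF ai] by (simp add: scaleR_right_diff_distrib)
    then have "(LINT x:\<Omega>|lebesgue. \<phi> x *\<^sub>R (f x - g x)) = integral K (\<lambda>x. \<phi> x *\<^sub>R (f x - g x))"
      using K z by (intro set_lebesgue_integral_supported) auto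
    also have "\<dots> = integral K (\<lambda>x. \<phi> x *\<^sub>R f x) - integral K (\<lambda>x. \<phi> x *\<^sub>R g x)"
      unfolding scaleR_right_diff_distrib
      by (intro integral_diff set_lebesgue_integral_eq_integral(1) ai)
    also have "integral K (\<lambda>x. \<phi> x *\<^sub>R f x) = (LINT x:\<Omega>|lebesgue. \<phi> x *\<^sub>R f x)"
      using K z ai by (intro set_lebesgue_integral_supported[symmetric]) auto
    also have "integral K (\<lambda>x. \<phi> x *\<^sub>R g x) = (LINT x:\<Omega>|lebesgue. \<phi> x *\<^sub>R g x)"
      using K z ai by (intro set_lebesgue_integral_supported[symmetric]) auto
    finally show ?thesis .
  qed
  have "(LINT x:\<Omega>|lebesgue. iter_deriv bs \<phi> x *\<^sub>R u1 x) = (- 1) ^ length bs *\<^sub>R (LINT x:\<Omega>|lebesgue. \<phi> x *\<^sub>R v1 x)"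
    "(LINT x:\<Omega>|lebesgue. iter_deriv bs \<phi> x *\<^sub>R u2 x) = (- 1) ^ length bs *\<^sub>R (LINT x:\<Omega>|lebesgue. \<phi> x *\<^sub>R v2 x)"
    using 1 2 \<phi> unfolding has_weak_deriv_def by blast+
  then show "(LINT x:\<Omega>|lebesgue. iter_deriv bs \<phi> x *\<^sub>R (u1 x - u2 x)) = (- 1) ^ length bs *\<^sub>R (LINT x:\<Omega>|lebesgue. \<phi> x *\<^sub>R (v1 x - v2 x))"
    using diff[OF conjunct1[OF test_function_iter_deriv[OF \<phi> bs]] li(1,2)] diff[OF \<phi> li(3,4)]
    by (simp add: scaleR_right_diff_distrib)
qed

section \<open>Sobolev functions\<close>

lemma borel_measurable_lebesgue_on_AE_eq:
  fixes f g :: "'a::euclidean_space \<Rightarrow> 'b::euclidean_space"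
  assumes "f \<in> borel_measurable (lebesgue_on S)" "S \<in> sets lebesgue" "AE x in lebesgue_on S. f x = g x"
  shows "g \<in> borel_measurable (lebesgue_on S)"
proof -
  have "(\<lambda>x. if x \<in> S then f x else 0) \<in> borel_measurable lebesgue"
    by (rule borel_measurable_if_I[OF assms(1,2)])
  moreover have "AE x in lebesgue. (if x \<in> S then f x else 0) = (if x \<in> S then g x else 0)"
    using assms(2,3) by (auto simp: AE_restrict_space_iff elim: eventually_mono)
  ultimately show ?thesis
    by (rule borel_measurable_if_D[OF borel_measurable_AE])
qed

lemma finite_multi_indices: "finite (multi_indices k :: 'a::euclidean_space list set)"
proof -
  have "multi_indices k = {xs :: 'a list. set xs \<subseteq> Basis \<and> length xs \<le> k}"
    by (auto simp: multi_indices_def)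
  then show ?thesis by (simp only: finite_lists_length_le[OF finite_Basis])
qed

lemma sobolev_weak_deriv:
  assumes u: "u \<in> sobolev_inf k \<Omega>" and \<Omega>: "open \<Omega>" and bs: "bs \<in> multi_indices k"
  shows "has_weak_deriv \<Omega> bs u (weak_deriv \<Omega> bs u)"
    "weak_deriv \<Omega> bs u \<in> borel_measurable (lebesgue_on \<Omega>)"
    "Linf_norm \<Omega> (weak_deriv \<Omega> bs u) < \<infinity>"
proof -
  obtain v where v: "v \<in> Linf \<Omega>" "has_weak_deriv \<Omega> bs u v" using u bs by (auto simp: sobolev_inf_def)
  show w: "has_weak_deriv \<Omega> bs u (weak_deriv \<Omega> bs u)"
    unfolding weak_deriv_def by (rule someI[of "has_weak_deriv \<Omega> bs u", OF v(2)])
  have ae: "AE x in lebesgue_on \<Omega>. v x = weak_deriv \<Omega> bs u x"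
    by (rule has_weak_deriv_unique[OF \<Omega> v(2) w])
  have vm: "v \<in> borel_measurable (lebesgue_on \<Omega>)" using v by (simp add: Linf_def)
  then show m: "weak_deriv \<Omega> bs u \<in> borel_measurable (lebesgue_on \<Omega>)"
    by (rule borel_measurable_lebesgue_on_AE_eq[OF _ _ ae]) (use \<Omega> in auto)
  have "Linf_norm \<Omega> (weak_deriv \<Omega> bs u) = Linf_norm \<Omega> v"
    unfolding Linf_norm_def using ae m vm by (intro esssup_AE_cong) auto
  then show "Linf_norm \<Omega> (weak_deriv \<Omega> bs u) < \<infinity>" using v by (simp add: Linf_def)
qed

lemma sobolev_inf_norm_finite:
  assumes "u \<in> sobolev_inf k \<Omega>" "open \<Omega>"
  shows "sobolev_inf_norm k \<Omega> u < \<infinity>"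
proof -
  have ne: "multi_indices k \<noteq> ({} :: 'a list set)" by (auto simp: multi_indices_def intro!: exI[of _ "[]"])
  have "sobolev_inf_norm k \<Omega> u = Max ((\<lambda>bs. Linf_norm \<Omega> (weak_deriv \<Omega> bs u)) ` multi_indices k)"
    unfolding sobolev_inf_norm_def using finite_multi_indices ne by (intro Max_Sup[symmetric]) auto
  also have "\<dots> \<in> (\<lambda>bs. Linf_norm \<Omega> (weak_deriv \<Omega> bs u)) ` multi_indices k"
    using finite_multi_indices ne by (intro Max_in) auto
  finally show ?thesis using sobolev_weak_deriv(3)[OF assms] by auto
qed

lemma AE_weak_deriv_le_sobolev_inf_norm:
  assumes "bs \<in> multi_indices k"
  shows "AE x in lebesgue_on \<Omega>. ennreal (norm (weak_deriv \<Omega> bs u x)) \<le> sobolev_inf_norm k \<Omega> u"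
proof -
  have "Linf_norm \<Omega> (weak_deriv \<Omega> bs u) \<le> sobolev_inf_norm k \<Omega> u"
    unfolding sobolev_inf_norm_def by (rule SUP_upper[OF assms])
  then show ?thesis
    using esssup_AE[of "\<lambda>x. ennreal (norm (weak_deriv \<Omega> bs u x))" "lebesgue_on \<Omega>"]
    unfolding Linf_norm_def by (auto elim: eventually_mono)
qed

lemma AE_weak_deriv_bounded:
  assumes u: "u \<in> sobolev_inf k \<Omega>" and \<Omega>: "open \<Omega>" and bs: "bs \<in> multi_indices k"
    and m: "m = enn2real (sobolev_inf_norm k \<Omega> u)"
  shows "AE x in lebesgue_on \<Omega>. norm (weak_deriv \<Omega> bs u x) \<le> m"
  using AE_weak_deriv_le_sobolev_inf_norm[OF bs, of \<Omega> u]
proof eventually_elim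
  case (elim x)
  then show ?case using sobolev_inf_norm_finite[OF u \<Omega>] m
    using enn2real_mono[OF elim] by simp
qed

lemma sobolev_inf_norm_triangle:
  assumes u: "u \<in> sobolev_inf k \<Omega>" and v: "v \<in> sobolev_inf k \<Omega>" and \<Omega>: "open \<Omega>"
  shows "sobolev_inf_norm k \<Omega> u \<le> sobolev_inf_norm k \<Omega> v + sobolev_inf_norm k \<Omega> (\<lambda>x. u x - v x)"
    "sobolev_inf_norm k \<Omega> v \<le> sobolev_inf_norm k \<Omega> u + sobolev_inf_norm k \<Omega> (\<lambda>x. u x - v x)"
proof -
  let ?D = "\<lambda>bs. weak_deriv \<Omega> bs (\<lambda>x. u x - v x)"
  have d: "AE x in lebesgue_on \<Omega>. ?D bs x = weak_deriv \<Omega> bs u x - weak_deriv \<Omega> bs v x" if bs: "bs \<in> multi_indices k" for bs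
  proof -
    have "has_weak_deriv \<Omega> bs (\<lambda>x. u x - v x) (\<lambda>x. weak_deriv \<Omega> bs u x - weak_deriv \<Omega> bs v x)"
      using bs by (intro has_weak_deriv_diff sobolev_weak_deriv(1)[OF u \<Omega>] sobolev_weak_deriv(1)[OF v \<Omega>])
        (auto simp: multi_indices_def)
    moreover from this have "has_weak_deriv \<Omega> bs (\<lambda>x. u x - v x) (?D bs)"
      unfolding weak_deriv_def[of \<Omega> bs "\<lambda>x. u x - v x"] by (rule someI[of "has_weak_deriv \<Omega> bs (\<lambda>x. u x - v x)"])
    ultimately show ?thesis using has_weak_deriv_unique[OF \<Omega>] by blast
  qed
  have *: "sobolev_inf_norm k \<Omega> f \<le> sobolev_inf_norm k \<Omega> g + sobolev_inf_norm k \<Omega> (\<lambda>x. u x - v x)"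
    if f: "f \<in> sobolev_inf k \<Omega>" and le: "\<And>bs. bs \<in> multi_indices k \<Longrightarrow> AE x in lebesgue_on \<Omega>.
        norm (weak_deriv \<Omega> bs f x) \<le> norm (weak_deriv \<Omega> bs g x) + norm (?D bs x)" for f g
    unfolding sobolev_inf_norm_def[of k \<Omega> f] Linf_norm_def
  proof (intro SUP_least esssup_I)
    fix bs :: "'a list" assume bs: "bs \<in> multi_indices k"
    show "(\<lambda>x. ennreal (norm (weak_deriv \<Omega> bs f x))) \<in> borel_measurable (lebesgue_on \<Omega>)"
      using sobolev_weak_deriv(2)[OF f \<Omega> bs] by simp
    show "AE x in lebesgue_on \<Omega>. ennreal (norm (weak_deriv \<Omega> bs f x)) \<le>
        sobolev_inf_norm k \<Omega> g + sobolev_inf_norm k \<Omega> (\<lambda>x. u x - v x)"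
      using le[OF bs] AE_weak_deriv_le_sobolev_inf_norm[OF bs, of \<Omega> g]
        AE_weak_deriv_le_sobolev_inf_norm[OF bs, of \<Omega> "\<lambda>x. u x - v x"]
    proof eventually_elim
      case (elim x)
      from elim(1) have "ennreal (norm (weak_deriv \<Omega> bs f x)) \<le> ennreal (norm (weak_deriv \<Omega> bs g x)) + ennreal (norm (?D bs x))"
        by (simp add: ennreal_plus[symmetric] ennreal_leI del: ennreal_plus)
      also have "\<dots> \<le> sobolev_inf_norm k \<Omega> g + sobolev_inf_norm k \<Omega> (\<lambda>x. u x - v x)"
        by (intro add_mono elim)
      finally show ?case .
    qed
  qed
  show "sobolev_inf_norm k \<Omega> u \<le> sobolev_inf_norm k \<Omega> v + sobolev_inf_norm k \<Omega> (\<lambda>x. u x - v x)"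
  proof (rule *[OF u])
    show "AE x in lebesgue_on \<Omega>. norm (weak_deriv \<Omega> bs u x) \<le> norm (weak_deriv \<Omega> bs v x) + norm (?D bs x)"
      if "bs \<in> multi_indices k" for bs
      using d[OF that] by eventually_elim (simp only: norm_triangle_sub)
  qed
  show "sobolev_inf_norm k \<Omega> v \<le> sobolev_inf_norm k \<Omega> u + sobolev_inf_norm k \<Omega> (\<lambda>x. u x - v x)"
  proof (rule *[OF v])
    show "AE x in lebesgue_on \<Omega>. norm (weak_deriv \<Omega> bs v x) \<le> norm (weak_deriv \<Omega> bs u x) + norm (?D bs x)"
      if "bs \<in> multi_indices k" for bs
      using d[OF that] by eventually_elim (simp only: norm_minus_commute[of "weak_deriv \<Omega> bs u _"] norm_triangle_sub)
  qed
qed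

text \<open>The norm of \<open>\<psi> t\<close> is measurable in \<open>t\<close> up to a null set, being almost everywhere the limit of the norms of the approximating simple
  functions; square integrability on a bounded interval then implies integrability.\<close>

lemma L2_sobolev_norm_integrable:
  fixes \<psi> :: "real \<Rightarrow> 'a::euclidean_space \<Rightarrow> real"
  assumes \<psi>: "\<psi> \<in> L2_sobolev T k \<Omega>" and \<Omega>: "open \<Omega>" and T: "0 < T"
  obtains M where "M integrable_on {0..T}" "\<And>t. 0 \<le> M t"
    "AE t in lebesgue_on {0<..<T}. \<psi> t \<in> sobolev_inf k \<Omega> \<and> M t = enn2real (sobolev_inf_norm k \<Omega> (\<psi> t))"
proof -
  let ?L = "lebesgue_on {0<..<T}"
  let ?n = "\<lambda>u. sobolev_inf_norm k \<Omega> u"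
  have sm: "strongly_measurable_sobolev T k \<Omega> \<psi>" and fin: "(\<integral>\<^sup>+ t. (?n (\<psi> t))\<^sup>2 \<partial>?L) < \<infinity>"
    using \<psi> by (auto simp: L2_sobolev_def)
  then obtain \<sigma> :: "nat \<Rightarrow> real \<Rightarrow> 'a \<Rightarrow> real" where ae: "AE t in ?L. \<psi> t \<in> sobolev_inf k \<Omega>"
    and \<sigma>: "\<And>n. simple_function ?L (\<sigma> n)" "\<And>n. \<sigma> n ` {0<..<T} \<subseteq> sobolev_inf k \<Omega>"
    and lim: "AE t in ?L. (\<lambda>n. ?n (\<lambda>x. \<sigma> n t x - \<psi> t x)) \<longlonglongrightarrow> 0"
    unfolding strongly_measurable_sobolev_def by blast
  define M0 where "M0 t = liminf (\<lambda>n. ?n (\<sigma> n t))" for t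
  have meas: "M0 \<in> borel_measurable ?L"
  proof -
    have "(\<lambda>t. ?n (\<sigma> n t)) \<in> borel_measurable ?L" for n
      using borel_measurable_simple_function[OF simple_function_compose[OF \<sigma>(1)]] by (simp add: o_def)
    then show ?thesis unfolding M0_def by measurable
  qed
  have eq: "AE t in ?L. M0 t = ?n (\<psi> t)"
    using ae lim AE_space
  proof eventually_elim
    case (elim t)
    have s: "\<sigma> n t \<in> sobolev_inf k \<Omega>" for n using \<sigma>(2)[of n] elim(3) by auto
    let ?a = "?n (\<psi> t)" and ?e = "\<lambda>n. ?n (\<lambda>x. \<sigma> n t x - \<psi> t x)"
    have a: "?a < \<infinity>" by (rule sobolev_inf_norm_finite[OF elim(1) \<Omega>])
    have "(\<lambda>n. ?n (\<sigma> n t)) \<longlonglongrightarrow> ?a"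
    proof (rule tendsto_sandwich)
      show "\<forall>\<^sub>F n in sequentially. ?a - ?e n \<le> ?n (\<sigma> n t)"
        using sobolev_inf_norm_triangle(2)[OF s elim(1) \<Omega>] a
        by (intro always_eventually) (auto simp: ennreal_minus_le_iff add.commute)
      show "\<forall>\<^sub>F n in sequentially. ?n (\<sigma> n t) \<le> ?a + ?e n"
        using sobolev_inf_norm_triangle(1)[OF s elim(1) \<Omega>] by (intro always_eventually) auto
      have "(\<lambda>n. ?a - ?e n) \<longlonglongrightarrow> ?a - 0"
        using elim(2) a by (intro tendsto_diff_ennreal) auto
      then show "(\<lambda>n. ?a - ?e n) \<longlonglongrightarrow> ?a" by simp
      have "(\<lambda>n. ?a + ?e n) \<longlonglongrightarrow> ?a + 0" using elim(2) by (intro tendsto_intros)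
      then show "(\<lambda>n. ?a + ?e n) \<longlonglongrightarrow> ?a" by simp
    qed
    then show ?case unfolding M0_def by (intro lim_imp_Liminf) auto
  qed
  define M where "M t = enn2real (M0 t)" for t
  have "integrable ?L M"
  proof (rule integrableI_bounded)
    show "M \<in> borel_measurable ?L" unfolding M_def using meas by measurable
    have "(\<integral>\<^sup>+ t. ennreal (norm (M t)) \<partial>?L) \<le> (\<integral>\<^sup>+ t. 1 + (?n (\<psi> t))\<^sup>2 \<partial>?L)"
    proof (rule nn_integral_mono_AE)
      show "AE t in ?L. ennreal (norm (M t)) \<le> 1 + (?n (\<psi> t))\<^sup>2"
        using eq ae
      proof eventually_elim
        case (elim t)
        have "?n (\<psi> t) < \<infinity>" by (rule sobolev_inf_norm_finite[OF elim(2) \<Omega>])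
        then obtain r where r: "?n (\<psi> t) = ennreal r" "r \<ge> 0" by (cases "?n (\<psi> t)") auto
        have "r \<le> 1 + r\<^sup>2" using zero_le_power2[of "r - 1"] r(2) by (simp add: power2_diff)
        then have "ennreal r \<le> ennreal (1 + r\<^sup>2)" by (rule ennreal_leI)
        also have "\<dots> = ennreal 1 + ennreal (r\<^sup>2)" by (rule ennreal_plus) auto
        also have "\<dots> = 1 + (ennreal r)\<^sup>2" using r(2) by (simp add: ennreal_power)
        finally have "ennreal r \<le> 1 + (ennreal r)\<^sup>2" .
        then show ?case using r elim(1) by (simp add: M_def)
      qed
    qed
    also have "\<dots> = (\<integral>\<^sup>+ t. 1 + (M0 t)\<^sup>2 \<partial>?L)"
      by (rule nn_integral_cong_AE) (use eq in \<open>eventually_elim, simp\<close>)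
    also have "\<dots> = (\<integral>\<^sup>+ t. 1 \<partial>?L) + (\<integral>\<^sup>+ t. (M0 t)\<^sup>2 \<partial>?L)"
      using meas by (intro nn_integral_add) auto
    also have "(\<integral>\<^sup>+ t. (M0 t)\<^sup>2 \<partial>?L) = (\<integral>\<^sup>+ t. (?n (\<psi> t))\<^sup>2 \<partial>?L)"
      by (rule nn_integral_cong_AE) (use eq in \<open>eventually_elim, simp\<close>)
    also have "(\<integral>\<^sup>+ t. 1 \<partial>?L) = ennreal T"
      using T by (simp add: emeasure_restrict_space)
    also have "ennreal T + (\<integral>\<^sup>+ t. (?n (\<psi> t))\<^sup>2 \<partial>?L) < \<infinity>" using fin by simp
    finally show "(\<integral>\<^sup>+ t. ennreal (norm (M t)) \<partial>?L) < \<infinity>" .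
  qed
  then have "M integrable_on {0<..<T}" by (rule integrable_on_lebesgue_on) auto
  then have "M integrable_on {0..T}" by (simp add: integrable_on_Icc_iff_Ioo)
  then show ?thesis
  proof (rule that)
    show "0 \<le> M t" for t by (simp add: M_def)
    show "AE t in ?L. \<psi> t \<in> sobolev_inf k \<Omega> \<and> M t = enn2real (?n (\<psi> t))"
      using eq ae by eventually_elim (simp add: M_def)
  qed
qed

section \<open>Pointwise estimates for weak derivatives\<close>

lemma continuous_AE_bound:
  fixes W :: "'a::euclidean_space \<Rightarrow> 'b::real_normed_vector"
  assumes \<Omega>: "open \<Omega>" and W: "continuous_on \<Omega> W" and ae: "AE x in lebesgue_on \<Omega>. norm (W x) \<le> M" and x: "x \<in> \<Omega>"
  shows "norm (W x) \<le> M"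
proof (rule ccontr)
  assume n: "\<not> norm (W x) \<le> M"
  obtain N where N: "negligible N" "\<And>z. z \<in> \<Omega> \<Longrightarrow> z \<notin> N \<Longrightarrow> norm (W z) \<le> M"
    using ae by (rule AE_lebesgue_onE) (use \<Omega> in auto)
  let ?S = "\<Omega> \<inter> (\<lambda>z. norm (W z)) -` {M<..}"
  have "open ?S" by (intro continuous_open_preimage continuous_intros W \<Omega> open_greaterThan)
  moreover have "?S \<subseteq> N"
  proof
    fix z assume "z \<in> ?S"
    then show "z \<in> N" using N(2)[of z] by (cases "z \<in> N") auto
  qed
  then have "negligible ?S" by (rule negligible_subset[OF N(1)])
  moreover have "?S \<noteq> {}" using n x by auto
  ultimately show False using open_not_negligible by blast
qed

lemma sobolev_cont_rep:
  fixes u :: "'a::euclidean_space \<Rightarrow> 'b::euclidean_space"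
  assumes u: "u \<in> sobolev_inf k \<Omega>" and \<Omega>: "open \<Omega>" and bs: "bs \<in> lists Basis" "length bs < k"
  shows "continuous_on \<Omega> (cont_rep \<Omega> (weak_deriv \<Omega> bs u))"
    "AE x in lebesgue_on \<Omega>. cont_rep \<Omega> (weak_deriv \<Omega> bs u) x = weak_deriv \<Omega> bs u x"
proof -
  have idx: "bs \<in> multi_indices k" "c \<in> Basis \<Longrightarrow> bs @ [c] \<in> multi_indices k" for c
    using bs by (auto simp: multi_indices_def)
  note w = sobolev_weak_deriv(1)[OF u \<Omega>]
  obtain W where "continuous_on \<Omega> W" "AE z in lebesgue_on \<Omega>. W z = weak_deriv \<Omega> bs u z"
  proof (rule continuous_representative_exists[OF \<Omega>])
    show "locally_integrable_on (weak_deriv \<Omega> bs u) \<Omega>" using w[OF idx(1)] by (simp add: has_weak_deriv_def)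
    fix c :: 'a assume c: "c \<in> Basis"
    show "has_weak_deriv \<Omega> [c] (weak_deriv \<Omega> bs u) (weak_deriv \<Omega> (bs @ [c]) u)"
      by (rule has_weak_deriv_step[OF w[OF idx(1)] w[OF idx(2)[OF c]] c])
    show "AE z in lebesgue_on \<Omega>. norm (weak_deriv \<Omega> (bs @ [c]) u z) \<le> enn2real (sobolev_inf_norm k \<Omega> u)"
      by (rule AE_weak_deriv_bounded[OF u \<Omega> idx(2)[OF c] refl])
  qed
  then have "continuous_on \<Omega> (cont_rep \<Omega> (weak_deriv \<Omega> bs u)) \<and>
    (AE x in lebesgue_on \<Omega>. cont_rep \<Omega> (weak_deriv \<Omega> bs u) x = weak_deriv \<Omega> bs u x)"
    unfolding cont_rep_def by (intro someI_ex[of "\<lambda>w. continuous_on \<Omega> w \<and> (AE x in lebesgue_on \<Omega>. w x = weak_deriv \<Omega> bs u x)"]) blast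
  then show "continuous_on \<Omega> (cont_rep \<Omega> (weak_deriv \<Omega> bs u))"
    "AE x in lebesgue_on \<Omega>. cont_rep \<Omega> (weak_deriv \<Omega> bs u) x = weak_deriv \<Omega> bs u x" by auto
qed

context
  fixes u :: "'a::euclidean_space \<Rightarrow> 'b::euclidean_space" and k :: nat and \<Omega> :: "'a set" and m :: real
    and W :: "'a list \<Rightarrow> 'a \<Rightarrow> 'b"
  assumes u: "u \<in> sobolev_inf k \<Omega>" and \<Omega>: "open \<Omega>"
    and m: "m = enn2real (sobolev_inf_norm k \<Omega> u)"
    and W: "W = (\<lambda>bs. cont_rep \<Omega> (weak_deriv \<Omega> bs u))"
begin

lemma sobolev_cont_rep_bound:
  assumes bs: "bs \<in> lists Basis" "length bs < k" and x: "x \<in> \<Omega>"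
  shows "norm (W bs x) \<le> m"
proof (rule continuous_AE_bound[OF \<Omega> _ _ x])
  show "continuous_on \<Omega> (W bs)" unfolding W by (rule sobolev_cont_rep(1)[OF u \<Omega> bs])
  have "bs \<in> multi_indices k" using bs by (auto simp: multi_indices_def)
  from AE_weak_deriv_bounded[OF u \<Omega> this m] sobolev_cont_rep(2)[OF u \<Omega> bs]
  show "AE x in lebesgue_on \<Omega>. norm (W bs x) \<le> m" unfolding W by eventually_elim simp
qed

lemma sobolev_cont_rep_increment:
  assumes bs: "bs \<in> lists Basis" "length bs < k" and r: "ball x r \<subseteq> \<Omega>" "y \<in> ball x r"
    and \<delta>: "\<And>c. c \<in> Basis \<Longrightarrow> AE z in lebesgue_on \<Omega>. z \<in> ball x r \<longrightarrow> norm (weak_deriv \<Omega> (bs @ [c]) u z - D c) \<le> \<delta>"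
    and \<delta>0: "0 \<le> \<delta>"
  shows "norm (W bs y - W bs x - (\<Sum>c\<in>Basis. ((y - x) \<bullet> c) *\<^sub>R D c)) \<le> \<delta> * (real DIM('a) * norm (y - x))"
proof -
  have idx: "bs \<in> multi_indices k" "c \<in> Basis \<Longrightarrow> bs @ [c] \<in> multi_indices k" for c
    using bs by (auto simp: multi_indices_def)
  have "norm (W bs y - W bs x - (\<Sum>c\<in>Basis. ((y - x) \<bullet> c) *\<^sub>R D c)) \<le> \<delta> * (\<Sum>c\<in>Basis. \<bar>(y - x) \<bullet> c\<bar>)"
    unfolding W
  proof (rule continuous_representative_increment[OF sobolev_cont_rep[OF u \<Omega> bs] \<Omega> _ r \<delta>])
    fix c :: 'a assume c: "c \<in> Basis"
    show "has_weak_deriv \<Omega> [c] (weak_deriv \<Omega> bs u) (weak_deriv \<Omega> (bs @ [c]) u)"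
      by (rule has_weak_deriv_step[OF sobolev_weak_deriv(1)[OF u \<Omega> idx(1)] sobolev_weak_deriv(1)[OF u \<Omega> idx(2)[OF c]] c])
  qed
  also have "\<dots> \<le> \<delta> * (real DIM('a) * norm (y - x))"
    by (intro mult_left_mono sum_abs_inner_Basis_le \<delta>0)
  finally show ?thesis .
qed

lemma sobolev_cont_rep_lipschitz:
  assumes bs: "bs \<in> lists Basis" "length bs < k" and r: "ball x r \<subseteq> \<Omega>" "y \<in> ball x r"
  shows "norm (W bs y - W bs x) \<le> real DIM('a) * m * norm (y - x)"
proof -
  have m0: "0 \<le> m" by (simp add: m)
  have "norm (W bs y - W bs x - (\<Sum>c\<in>Basis. ((y - x) \<bullet> c) *\<^sub>R 0)) \<le> m * (real DIM('a) * norm (y - x))"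
  proof (rule sobolev_cont_rep_increment[OF bs r _ m0])
    fix c :: 'a assume "c \<in> Basis"
    then have "bs @ [c] \<in> multi_indices k" using bs by (auto simp: multi_indices_def)
    from AE_weak_deriv_bounded[OF u \<Omega> this m]
    show "AE z in lebesgue_on \<Omega>. z \<in> ball x r \<longrightarrow> norm (weak_deriv \<Omega> (bs @ [c]) u z - 0) \<le> m"
      by eventually_elim simp
  qed
  then show ?thesis by (simp add: mult_ac)
qed

lemma sobolev_cont_rep_taylor:
  assumes bs: "bs \<in> lists Basis" "Suc (length bs) < k" and r: "ball x r \<subseteq> \<Omega>" "y \<in> ball x r"
  shows "norm (W bs y - W bs x - (\<Sum>c\<in>Basis. ((y - x) \<bullet> c) *\<^sub>R W (bs @ [c]) x)) \<le> (real DIM('a))\<^sup>2 * m * (norm (y - x))\<^sup>2"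
    (is "?l \<le> _")
proof -
  have m0: "0 \<le> m" by (simp add: m)
  \<comment> \<open>The weak derivatives of order one more vary by at most \<open>DIM('a) * m * \<rho>\<close> on the ball of radius \<open>\<rho>\<close> about \<open>x\<close>; then
    \<open>\<rho>\<close> tends to the distance of \<open>x\<close> and \<open>y\<close>.\<close>
  have bound: "?l \<le> (real DIM('a) * m * \<rho>) * (real DIM('a) * norm (y - x))" if \<rho>: "dist x y < \<rho>" "\<rho> < r" for \<rho>
  proof (rule sobolev_cont_rep_increment)
    show "bs \<in> lists Basis" "length bs < k" using bs by auto
    show "ball x \<rho> \<subseteq> \<Omega>" "y \<in> ball x \<rho>" using r \<rho> by (auto intro: order_trans[OF subset_ball])
    have "0 \<le> \<rho>" using \<rho>(1) zero_le_dist[of x y] by linarith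
    then show "0 \<le> real DIM('a) * m * \<rho>" using m0 by simp
    fix c :: 'a assume c: "c \<in> Basis"
    have bc: "bs @ [c] \<in> lists Basis" "length (bs @ [c]) < k" using bs c by auto
    show "AE z in lebesgue_on \<Omega>. z \<in> ball x \<rho> \<longrightarrow> norm (weak_deriv \<Omega> (bs @ [c]) u z - W (bs @ [c]) x) \<le> real DIM('a) * m * \<rho>"
      using sobolev_cont_rep(2)[OF u \<Omega> bc]
    proof eventually_elim
      case (elim z)
      show ?case
      proof
        assume z: "z \<in> ball x \<rho>"
        have "norm (W (bs @ [c]) z - W (bs @ [c]) x) \<le> real DIM('a) * m * norm (z - x)"
          using z \<rho> by (intro sobolev_cont_rep_lipschitz[OF bc r(1)]) auto
        also have "\<dots> \<le> real DIM('a) * m * \<rho>"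
          using z m0 by (intro mult_left_mono) (auto simp: dist_norm norm_minus_commute)
        finally show "norm (weak_deriv \<Omega> (bs @ [c]) u z - W (bs @ [c]) x) \<le> real DIM('a) * m * \<rho>"
          using elim by (simp add: W)
      qed
    qed
  qed
  have "((\<lambda>\<rho>. (real DIM('a) * m * \<rho>) * (real DIM('a) * norm (y - x))) \<longlongrightarrow>
      (real DIM('a) * m * dist x y) * (real DIM('a) * norm (y - x))) (at_right (dist x y))"
    by (intro tendsto_intros)
  then have "?l \<le> (real DIM('a) * m * dist x y) * (real DIM('a) * norm (y - x))"
  proof (rule tendsto_lowerbound)
    show "\<forall>\<^sub>F \<rho> in at_right (dist x y). ?l \<le> (real DIM('a) * m * \<rho>) * (real DIM('a) * norm (y - x))"
      unfolding eventually_at_right_field using bound r(2) by (intro exI[of _ r]) auto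
  qed simp
  then show ?thesis by (simp add: power2_eq_square mult_ac dist_norm norm_minus_commute)
qed

end

section \<open>Flows of vector fields with Lipschitz derivative\<close>

text \<open>A time-dependent vector field \<open>V\<close> on \<open>\<Omega>\<close> whose derivative \<open>A t x\<close> in the space variable is bounded and locally
  Lipschitz, with constants \<open>M t\<close> that are integrable in time. The estimates concern a point \<open>y\<close> of a ball
  about \<open>x\<close> contained in \<open>\<Omega>\<close>. Measurability of \<open>V\<close> and \<open>A\<close> is not assumed: along a trajectory, \<open>V\<close> is almost everywhere
  the derivative of an absolutely continuous function and so is integrable.\<close>

locale lipschitz_derivative_field =
  fixes \<Omega> :: "'a::euclidean_space set" and T :: real and M :: "real \<Rightarrow> real"
    and V :: "real \<Rightarrow> 'a \<Rightarrow> 'a" and A :: "real \<Rightarrow> 'a \<Rightarrow> 'a \<Rightarrow> 'a"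
  assumes T: "0 < T" and M_int: "M integrable_on {0..T}" and M_nonneg: "\<And>t. 0 \<le> M t"
    and A_lin: "\<And>t x. linear (A t x)"
    and A_bound: "AE t in lebesgue_on {0<..<T}. \<forall>x\<in>\<Omega>. \<forall>b. norm (A t x b) \<le> M t * norm b"
    and V_lip: "AE t in lebesgue_on {0<..<T}. \<forall>x r y. ball x r \<subseteq> \<Omega> \<longrightarrow> y \<in> ball x r \<longrightarrow>
        norm (V t y - V t x) \<le> M t * norm (y - x)"
    and V_taylor: "AE t in lebesgue_on {0<..<T}. \<forall>x r y. ball x r \<subseteq> \<Omega> \<longrightarrow> y \<in> ball x r \<longrightarrow>
        norm (V t y - V t x - A t x (y - x)) \<le> M t * (norm (y - x))\<^sup>2"
    and A_lip: "AE t in lebesgue_on {0<..<T}. \<forall>x r y b. ball x r \<subseteq> \<Omega> \<longrightarrow> y \<in> ball x r \<longrightarrow>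
        norm (A t y b - A t x b) \<le> M t * norm (y - x) * norm b"
begin

text \<open>The factor by which Gronwall's inequality lets norms grow on \<open>{0..T}\<close>.\<close>

definition growth :: real where "growth = exp (integral {0..T} M)"

lemma growth_ge_1: "1 \<le> growth"
  unfolding growth_def using integral_nonneg[OF M_int] M_nonneg by simp

lemma M_int_sub: "0 \<le> s \<Longrightarrow> t \<le> T \<Longrightarrow> M integrable_on {s..t}"
  using M_int by (meson atLeastatMost_subset_iff integrable_on_subinterval)

lemma AE_sub: "AE t in lebesgue_on {0<..<T}. P t \<Longrightarrow> 0 \<le> a \<Longrightarrow> b \<le> T \<Longrightarrow> AE t in lebesgue_on {a<..<b}. P t"
  by (erule AE_lebesgue_on_subset) auto

text \<open>The inequality is applied to the norm of \<open>y t\<close> increased by \<open>c\<close>, which absorbs the inhomogeneous term.\<close>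

lemma gronwall_vector:
  fixes y f :: "real \<Rightarrow> 'a"
  assumes \<tau>: "\<tau> \<le> T" and t: "t \<in> {0..\<tau>}" and f: "f integrable_on {0..\<tau>}"
    and y: "\<And>t. t \<in> {0..\<tau>} \<Longrightarrow> y t = y 0 + integral {0..t} f"
    and bound: "AE t in lebesgue_on {0<..<\<tau>}. norm (f t) \<le> M t * (norm (y t) + c)" and c: "0 \<le> c"
  shows "norm (y t) \<le> (norm (y 0) + c) * growth"
proof -
  have \<tau>0: "0 \<le> \<tau>" using t by auto
  have cont: "continuous_on {0..\<tau>} y" by (rule continuous_on_if_indefinite_integral[OF f y])
  have Mi: "M integrable_on {0..\<tau>}" by (rule M_int_sub) (use \<tau> in auto)
  have "norm (y t) + c \<le> (norm (y 0) + c) * exp (integral {0..t} M)"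
  proof (rule gronwall_integrable[OF Mi M_nonneg _ _ _ t])
    show "continuous_on {0..\<tau>} (\<lambda>t. norm (y t) + c)" by (intro continuous_intros cont)
    show "0 \<le> norm (y t) + c" for t using c by simp
    fix t assume t: "t \<in> {0..\<tau>}"
    have "norm (integral {0..t} f) \<le> integral {0..t} (\<lambda>s. M s * (norm (y s) + c))"
    proof (rule absolutely_integrable_AE_bound(2))
      show "f integrable_on {0..t}" by (rule integrable_on_subinterval[OF f]) (use t in auto)
      show "(\<lambda>s. M s * (norm (y s) + c)) integrable_on {0..t}"
        using t \<tau> continuous_on_subset[OF cont, of "{0..t}"]
        by (intro integrable_times_continuous M_int_sub M_nonneg continuous_intros) auto
      show "AE s in lebesgue_on {0<..<t}. norm (f s) \<le> M s * (norm (y s) + c)"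
        by (rule AE_lebesgue_on_subset[OF bound]) (use t in auto)
    qed
    then show "norm (y t) + c \<le> norm (y 0) + c + integral {0..t} (\<lambda>s. M s * (norm (y s) + c))"
      using norm_triangle_ineq[of "y 0" "integral {0..t} f"] y[OF t] by simp
  qed
  also have "\<dots> \<le> (norm (y 0) + c) * growth"
    unfolding growth_def using t \<tau> c M_nonneg
    by (intro mult_left_mono) (auto intro!: integral_subset_le M_int_sub)
  finally show ?thesis using c by simp
qed

text \<open>A Caratheodory solution that stays in \<open>\<Omega>\<close> during the whole time interval.\<close>

definition trajectory :: "(real \<Rightarrow> 'a) \<Rightarrow> bool" where
  "trajectory y \<longleftrightarrow> caratheodory_solution V T y \<and> (\<forall>t\<in>{0..T}. y t \<in> \<Omega>)"

lemma trajectory_integral: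
  assumes y: "trajectory y"
  shows "(\<lambda>r. V r (y r)) integrable_on {0..T}"
    "t \<in> {0..T} \<Longrightarrow> y t = y 0 + integral {0..t} (\<lambda>r. V r (y r))"
proof -
  have *: "((\<lambda>r. V r (y r)) has_integral (y t - y 0)) {0..t}" if "t \<in> {0..T}" for t
  proof (rule abs_cont_on_has_integral)
    show "abs_cont_on {0..t} y"
      using y that by (auto simp: trajectory_def caratheodory_solution_def elim: abs_cont_on_subset)
    have "AE r in lebesgue_on {0<..<T}. (y has_vector_derivative V r (y r)) (at r)"
      using y unfolding trajectory_def caratheodory_solution_def by blast
    then show "AE r in lebesgue_on {0<..<t}. (y has_vector_derivative V r (y r)) (at r)"
      by (rule AE_sub) (use that in auto)
  qed (use that in auto)
  from *[of T] T show "(\<lambda>r. V r (y r)) integrable_on {0..T}" by auto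
  show "t \<in> {0..T} \<Longrightarrow> y t = y 0 + integral {0..t} (\<lambda>r. V r (y r))"
    using integral_unique[OF *[of t]] by simp
qed

lemma trajectory_continuous:
  assumes y: "trajectory y"
  shows "continuous_on {0..T} y"
  by (rule continuous_on_if_indefinite_integral[OF trajectory_integral[OF y]])

lemma trajectory_tube:
  assumes y: "trajectory y" and \<Omega>: "open \<Omega>"
  obtains \<rho> where "\<rho> > 0" "\<And>t. t \<in> {0..T} \<Longrightarrow> ball (y t) \<rho> \<subseteq> \<Omega>"
proof -
  have "compact (y ` {0..T})" by (intro compact_continuous_image trajectory_continuous y compact_Icc)
  moreover have "y ` {0..T} \<subseteq> \<Omega>" using y by (auto simp: trajectory_def)
  ultimately obtain \<rho> where "\<rho> > 0" "(\<Union>x\<in>y ` {0..T}. ball x \<rho>) \<subseteq> \<Omega>"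
    using compact_subset_open_imp_ball_epsilon_subset[OF _ \<Omega>] by metis
  then show ?thesis by (intro that[of \<rho>]) blast+
qed

text \<open>Two trajectories separate at most by the factor \<open>growth\<close>, as long as the second one remains in
  the tube around the first one in which \<open>V\<close> is Lipschitz; and it never leaves this tube if it starts
  close enough.\<close>

lemma trajectory_separation_local:
  assumes y: "trajectory y" and z: "trajectory z" and \<rho>: "\<And>t. t \<in> {0..T} \<Longrightarrow> ball (y t) \<rho> \<subseteq> \<Omega>"
    and \<tau>: "\<tau> \<in> {0..T}" and close: "\<And>t. 0 \<le> t \<Longrightarrow> t < \<tau> \<Longrightarrow> z t \<in> ball (y t) \<rho>" and t: "t \<in> {0..\<tau>}"
  shows "norm (z t - y t) \<le> norm (z 0 - y 0) * growth"
proof -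
  have int: "(\<lambda>r. V r (w r)) integrable_on {0..t}" if "trajectory w" "t \<in> {0..T}" for w t
    using trajectory_integral(1)[OF that(1)] that(2)
    by (meson atLeastAtMost_iff atLeastatMost_subset_iff integrable_on_subinterval order_refl)
  have "norm (z t - y t) \<le> (norm (z 0 - y 0) + 0) * growth"
  proof (rule gronwall_vector[where y = "\<lambda>t. z t - y t" and f = "\<lambda>r. V r (z r) - V r (y r)" and \<tau> = \<tau>])
    show "\<tau> \<le> T" "t \<in> {0..\<tau>}" using \<tau> t by auto
    show "(\<lambda>r. V r (z r) - V r (y r)) integrable_on {0..\<tau>}" by (intro integrable_diff int y z \<tau>)
    show "z t - y t = z 0 - y 0 + integral {0..t} (\<lambda>r. V r (z r) - V r (y r))" if "t \<in> {0..\<tau>}" for t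
    proof -
      have t: "t \<in> {0..T}" using that \<tau> by auto
      show ?thesis
        using trajectory_integral(2)[OF y t] trajectory_integral(2)[OF z t]
          integral_diff[OF int[OF z t] int[OF y t]] by simp
    qed
    have "AE t in lebesgue_on {0<..<\<tau>}. \<forall>x r y. ball x r \<subseteq> \<Omega> \<longrightarrow> y \<in> ball x r \<longrightarrow>
        norm (V t y - V t x) \<le> M t * norm (y - x)"
      by (rule AE_sub[OF V_lip]) (use \<tau> in auto)
    then show "AE t in lebesgue_on {0<..<\<tau>}. norm (V t (z t) - V t (y t)) \<le> M t * (norm (z t - y t) + 0)"
      using AE_space
    proof eventually_elim
      case (elim t)
      then have t: "0 \<le> t" "t < \<tau>" "t \<in> {0..T}" using \<tau> by auto
      show ?case using elim(1)[rule_format, OF \<rho>[OF t(3)] close[OF t(1,2)]] by simp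
    qed
  qed simp
  then show ?thesis by simp
qed

lemma trajectory_separation:
  assumes y: "trajectory y" and z: "trajectory z" and \<rho>: "\<And>t. t \<in> {0..T} \<Longrightarrow> ball (y t) \<rho> \<subseteq> \<Omega>"
    and start: "norm (z 0 - y 0) * growth < \<rho>" and t: "t \<in> {0..T}"
  shows "norm (z t - y t) \<le> norm (z 0 - y 0) * growth" "z t \<in> ball (y t) \<rho>"
proof -
  have inball: "z t \<in> ball (y t) \<rho>" if "t \<in> {0..T}" for t
  proof (rule ccontr)
    assume "z t \<notin> ball (y t) \<rho>"
    let ?B = "{t \<in> {0..T}. \<rho> \<le> norm (z t - y t)}"
    have "t \<in> ?B" using that \<open>z t \<notin> ball (y t) \<rho>\<close> by (auto simp: dist_norm norm_minus_commute)
    \<comment> \<open>The first time at which the distance reaches \<open>\<rho>\<close> is contradictory.\<close>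
    moreover have "closed ?B"
    proof -
      have "closed ({0..T} \<inter> (\<lambda>t. norm (z t - y t)) -` {\<rho>..})"
        by (intro continuous_closed_preimage continuous_intros trajectory_continuous y z closed_atLeast closed_atLeastAtMost)
      moreover have "{0..T} \<inter> (\<lambda>t. norm (z t - y t)) -` {\<rho>..} = ?B" by auto
      ultimately show ?thesis by simp
    qed
    then have "compact ({0..T} \<inter> ?B)" by (intro compact_Int_closed compact_Icc)
    then have "compact ?B" by (simp add: Int_absorb1 subset_iff)
    ultimately obtain \<tau> where \<tau>: "\<tau> \<in> ?B" "\<And>t. t \<in> ?B \<Longrightarrow> \<tau> \<le> t"
      using compact_attains_inf[of ?B] by blast
    have "z r \<in> ball (y r) \<rho>" if "0 \<le> r" "r < \<tau>" for r
    proof (rule ccontr)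
      assume "z r \<notin> ball (y r) \<rho>"
      then have "r \<in> ?B" using that \<tau>(1) by (auto simp: dist_norm norm_minus_commute)
      then show False using \<tau>(2) that by fastforce
    qed
    then have "norm (z \<tau> - y \<tau>) \<le> norm (z 0 - y 0) * growth"
      using \<tau>(1) by (intro trajectory_separation_local[OF y z \<rho>, of \<tau> \<tau>]) auto
    then show False using \<tau>(1) start by auto
  qed
  show "z t \<in> ball (y t) \<rho>" by (rule inball[OF t])
  show "norm (z t - y t) \<le> norm (z 0 - y 0) * growth"
    using T t by (intro trajectory_separation_local[OF y z \<rho>, of T t] inball) auto
qed

lemma integrable_on_initial:
  "f integrable_on {0..T} \<Longrightarrow> t \<in> {0..T} \<Longrightarrow> f integrable_on {0..t}" for f :: "real \<Rightarrow> 'a"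
  by (rule integrable_on_subinterval) auto

lemma difference_quotient_integral:
  assumes y: "trajectory y" and z: "trajectory z"
  shows "(\<lambda>r. (V r (z r) - V r (y r)) /\<^sub>R h) integrable_on {0..T}"
    "t \<in> {0..T} \<Longrightarrow> (z t - y t) /\<^sub>R h = (z 0 - y 0) /\<^sub>R h + integral {0..t} (\<lambda>r. (V r (z r) - V r (y r)) /\<^sub>R h)"
proof -
  show "(\<lambda>r. (V r (z r) - V r (y r)) /\<^sub>R h) integrable_on {0..T}"
    by (intro integrable_cmul integrable_diff trajectory_integral(1) z y)
  assume t: "t \<in> {0..T}"
  have "integral {0..t} (\<lambda>r. (V r (z r) - V r (y r)) /\<^sub>R h)
      = (integral {0..t} (\<lambda>r. V r (z r)) - integral {0..t} (\<lambda>r. V r (y r))) /\<^sub>R h"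
    using integral_diff[OF integrable_on_initial[OF trajectory_integral(1)[OF z] t]
        integrable_on_initial[OF trajectory_integral(1)[OF y] t]] by simp
  then show "(z t - y t) /\<^sub>R h = (z 0 - y 0) /\<^sub>R h + integral {0..t} (\<lambda>r. (V r (z r) - V r (y r)) /\<^sub>R h)"
    using trajectory_integral(2)[OF z t] trajectory_integral(2)[OF y t]
    by (simp add: algebra_simps)
qed

text \<open>Up to an error of order \<open>h\<close>, the difference quotients of two trajectories satisfy the linearized equation.\<close>

lemma difference_quotient_remainder:
  assumes y: "trajectory y" and z: "trajectory z" and \<rho>: "\<And>t. t \<in> {0..T} \<Longrightarrow> ball (y t) \<rho> \<subseteq> \<Omega>"
    and start: "norm (z 0 - y 0) * growth < \<rho>" and h: "h \<noteq> 0" "norm (z 0 - y 0) \<le> L * \<bar>h\<bar>"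
    and r: "r \<in> {0..T}"
    and tay: "\<forall>x \<rho> y. ball x \<rho> \<subseteq> \<Omega> \<longrightarrow> y \<in> ball x \<rho> \<longrightarrow>
        norm (V r y - V r x - A r x (y - x)) \<le> M r * (norm (y - x))\<^sup>2"
  shows "norm ((V r (z r) - V r (y r)) /\<^sub>R h - A r (y r) ((z r - y r) /\<^sub>R h)) \<le> M r * ((L * growth)\<^sup>2 * \<bar>h\<bar>)"
proof -
  note sep = trajectory_separation[OF y z \<rho> start r]
  have eq: "(V r (z r) - V r (y r)) /\<^sub>R h - A r (y r) ((z r - y r) /\<^sub>R h)
      = (V r (z r) - V r (y r) - A r (y r) (z r - y r)) /\<^sub>R h"
    using linear_cmul[OF A_lin, of r "y r" "inverse h" "z r - y r"]
    by (simp only: scaleR_right_diff_distrib[of _ "V r (z r) - V r (y r)"])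
  have "norm (z r - y r) \<le> norm (z 0 - y 0) * growth" by (rule sep(1))
  also have "\<dots> \<le> (L * \<bar>h\<bar>) * growth" using h(2) growth_ge_1 by (intro mult_right_mono) auto
  finally have "(norm (z r - y r))\<^sup>2 \<le> (L * \<bar>h\<bar> * growth)\<^sup>2" by (intro power_mono) auto
  then have "norm (V r (z r) - V r (y r) - A r (y r) (z r - y r)) \<le> M r * (L * \<bar>h\<bar> * growth)\<^sup>2"
    using tay[rule_format, OF \<rho>[OF r] sep(2)] M_nonneg[of r] by (meson mult_left_mono order_trans)
  also have "\<dots> = \<bar>h\<bar> * (M r * ((L * growth)\<^sup>2 * \<bar>h\<bar>))"
    by (simp add: power2_eq_square mult_ac)
  finally have "norm (V r (z r) - V r (y r) - A r (y r) (z r - y r)) / \<bar>h\<bar> \<le> M r * ((L * growth)\<^sup>2 * \<bar>h\<bar>)"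
    using h(1) by (simp add: divide_le_eq mult_ac)
  then show ?thesis unfolding eq by (simp add: divide_inverse_commute)
qed

lemma difference_quotients_close:
  assumes y: "trajectory y" and z1: "trajectory z1" and z2: "trajectory z2"
    and \<rho>: "\<And>t. t \<in> {0..T} \<Longrightarrow> ball (y t) \<rho> \<subseteq> \<Omega>"
    and start: "norm (z1 0 - y 0) * growth < \<rho>" "norm (z2 0 - y 0) * growth < \<rho>"
    and h: "h1 \<noteq> 0" "h2 \<noteq> 0" "norm (z1 0 - y 0) \<le> L * \<bar>h1\<bar>" "norm (z2 0 - y 0) \<le> L * \<bar>h2\<bar>"
    and t: "t \<in> {0..T}"
  shows "norm ((z1 t - y t) /\<^sub>R h1 - (z2 t - y t) /\<^sub>R h2)
     \<le> (norm ((z1 0 - y 0) /\<^sub>R h1 - (z2 0 - y 0) /\<^sub>R h2) + (L * growth)\<^sup>2 * (\<bar>h1\<bar> + \<bar>h2\<bar>)) * growth"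
proof -
  let ?f = "\<lambda>z h r. (V r (z r) - V r (y r)) /\<^sub>R h"
  show ?thesis
  proof (rule gronwall_vector[where \<tau> = T and f = "\<lambda>r. ?f z1 h1 r - ?f z2 h2 r"
        and y = "\<lambda>t. (z1 t - y t) /\<^sub>R h1 - (z2 t - y t) /\<^sub>R h2"])
    show "(\<lambda>r. ?f z1 h1 r - ?f z2 h2 r) integrable_on {0..T}" by (intro integrable_diff difference_quotient_integral(1) y z1 z2)
    show "(z1 t - y t) /\<^sub>R h1 - (z2 t - y t) /\<^sub>R h2 = (z1 0 - y 0) /\<^sub>R h1 - (z2 0 - y 0) /\<^sub>R h2
        + integral {0..t} (\<lambda>r. ?f z1 h1 r - ?f z2 h2 r)" if t: "t \<in> {0..T}" for t
    proof -
      have "integral {0..t} (\<lambda>r. ?f z1 h1 r - ?f z2 h2 r) = integral {0..t} (?f z1 h1) - integral {0..t} (?f z2 h2)"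
        by (intro integral_diff integrable_on_initial[OF _ t] difference_quotient_integral(1) y z1 z2)
      then show ?thesis
        unfolding difference_quotient_integral(2)[OF y z1 t] difference_quotient_integral(2)[OF y z2 t] by simp
    qed
    show "AE r in lebesgue_on {0<..<T}. norm (?f z1 h1 r - ?f z2 h2 r) \<le>
       M r * (norm ((z1 r - y r) /\<^sub>R h1 - (z2 r - y r) /\<^sub>R h2) + (L * growth)\<^sup>2 * (\<bar>h1\<bar> + \<bar>h2\<bar>))"
      using V_taylor A_bound AE_space
    proof eventually_elim
      case (elim r)
      then have r: "r \<in> {0..T}" by auto
      have yr: "y r \<in> \<Omega>" using y r unfolding trajectory_def by blast
      let ?a = "A r (y r)" and ?d1 = "(z1 r - y r) /\<^sub>R h1" and ?d2 = "(z2 r - y r) /\<^sub>R h2"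
      have eq: "?f z1 h1 r - ?f z2 h2 r = (?f z1 h1 r - ?a ?d1) - (?f z2 h2 r - ?a ?d2) + ?a (?d1 - ?d2)"
        using linear_diff[OF A_lin, of r "y r" ?d1 ?d2] by simp
      have "norm (?f z1 h1 r - ?f z2 h2 r) \<le> (norm (?f z1 h1 r - ?a ?d1) + norm (?f z2 h2 r - ?a ?d2)) + norm (?a (?d1 - ?d2))"
        unfolding eq by (rule norm_triangle_mono[OF norm_triangle_ineq4 order_refl])
      also have "\<dots> \<le> (M r * ((L * growth)\<^sup>2 * \<bar>h1\<bar>) + M r * ((L * growth)\<^sup>2 * \<bar>h2\<bar>)) + M r * norm (?d1 - ?d2)"
      proof (intro add_mono)
        show "norm (?f z1 h1 r - ?a ?d1) \<le> M r * ((L * growth)\<^sup>2 * \<bar>h1\<bar>)"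
          by (rule difference_quotient_remainder[OF y z1 \<rho> start(1) h(1,3) r elim(1)])
        show "norm (?f z2 h2 r - ?a ?d2) \<le> M r * ((L * growth)\<^sup>2 * \<bar>h2\<bar>)"
          by (rule difference_quotient_remainder[OF y z2 \<rho> start(2) h(2,4) r elim(1)])
        show "norm (?a (?d1 - ?d2)) \<le> M r * norm (?d1 - ?d2)"
          by (rule elim(2)[rule_format, OF yr])
      qed
      also have "\<dots> = M r * (norm (?d1 - ?d2) + (L * growth)\<^sup>2 * (\<bar>h1\<bar> + \<bar>h2\<bar>))"
        by (simp only: distrib_left add_ac)
      finally show ?case .
    qed
  qed (use t T in auto)
qed

text \<open>Solutions of the linearized equation along a trajectory, in integrated form.\<close>

definition linearized :: "(real \<Rightarrow> 'a) \<Rightarrow> (real \<Rightarrow> 'a) \<Rightarrow> bool" where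
  "linearized y b \<longleftrightarrow> (\<lambda>r. A r (y r) (b r)) integrable_on {0..T} \<and>
     (\<forall>t\<in>{0..T}. b t = b 0 + integral {0..t} (\<lambda>r. A r (y r) (b r)))"

lemma linearized_growth:
  assumes y: "trajectory y" and b: "linearized y b" and t: "t \<in> {0..T}"
  shows "norm (b t) \<le> norm (b 0) * growth"
proof -
  have "norm (b t) \<le> (norm (b 0) + 0) * growth"
  proof (rule gronwall_vector[where f = "\<lambda>r. A r (y r) (b r)" and \<tau> = T])
    show "AE r in lebesgue_on {0<..<T}. norm (A r (y r) (b r)) \<le> M r * (norm (b r) + 0)"
      using A_bound AE_space
    proof eventually_elim
      case (elim r)
      then have "y r \<in> \<Omega>" using y unfolding trajectory_def by auto
      from elim(1)[rule_format, OF this] show ?case by simp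
    qed
    show "(\<lambda>r. A r (y r) (b r)) integrable_on {0..T}" using b unfolding linearized_def by blast
    show "b t = b 0 + integral {0..t} (\<lambda>r. A r (y r) (b r))" if "t \<in> {0..T}" for t
      using b that unfolding linearized_def by blast
  qed (use t in simp_all)
  then show ?thesis by simp
qed

lemma linearized_caratheodory:
  assumes y: "trajectory y" and b: "linearized y b"
  shows "caratheodory_solution (\<lambda>t b. A t (y t) b) T b"
  unfolding caratheodory_solution_def
proof
  let ?f = "\<lambda>r. A r (y r) (b r)"
  let ?C = "norm (b 0) * growth"
  have f: "?f integrable_on {0..T}" and beq: "\<And>t. t \<in> {0..T} \<Longrightarrow> b t = b 0 + integral {0..t} ?f"
    using b unfolding linearized_def by blast+
  have C: "0 \<le> ?C" using growth_ge_1 by simp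
  have bound: "AE r in lebesgue_on {0<..<T}. norm (?f r) \<le> ?C * M r"
    using A_bound AE_space
  proof eventually_elim
    case (elim r)
    then have r: "r \<in> {0..T}" by auto
    have "norm (?f r) \<le> M r * norm (b r)" using elim(1) y r unfolding trajectory_def by blast
    also have "\<dots> \<le> M r * ?C" by (intro mult_left_mono linearized_growth[OF y b r] M_nonneg)
    finally show ?case by (simp add: mult.commute)
  qed
  show "abs_cont_on {0..T} b"
  proof (rule abs_cont_on_dominated)
    show "(\<lambda>r. ?C * M r) integrable_on {0..T}" using M_int by (rule integrable_on_mult_right)
    show "0 \<le> ?C * M r" for r using C M_nonneg by simp
    fix s t assume st: "0 \<le> s" "s \<le> t" "t \<le> T"
    have "b t - b s = integral {0..t} ?f - integral {0..s} ?f" using beq[of s] beq[of t] st by simp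
    also have "\<dots> = integral {s..t} ?f" by (rule integral_diff_initial[OF f st])
    finally have "dist (b t) (b s) = norm (integral {s..t} ?f)" by (simp only: dist_norm)
    then have "dist (b s) (b t) = norm (integral {s..t} ?f)" by (simp only: dist_commute)
    also have "\<dots> \<le> integral {s..t} (\<lambda>r. ?C * M r)"
    proof (rule absolutely_integrable_AE_bound(2))
      show "?f integrable_on {s..t}" using f st by (meson atLeastatMost_subset_iff integrable_on_subinterval)
      show "(\<lambda>r. ?C * M r) integrable_on {s..t}" using st by (intro integrable_on_mult_right M_int_sub) auto
      show "AE r in lebesgue_on {s<..<t}. norm (?f r) \<le> ?C * M r" by (rule AE_sub[OF bound]) (use st in auto)
    qed
    finally show "dist (b s) (b t) \<le> integral {s..t} (\<lambda>r. ?C * M r)" .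
  qed
  show "AE t in lebesgue_on {0<..<T}. (b has_vector_derivative A t (y t) (b t)) (at t)"
    using indefinite_integral_has_vector_derivative_AE[OF f] AE_space
  proof eventually_elim
    case (elim t)
    then have t: "t \<in> {0<..<T}" by auto
    have "((\<lambda>u. b 0 + integral {0..u} ?f) has_vector_derivative 0 + ?f t) (at t)"
      by (intro has_vector_derivative_add has_vector_derivative_const elim(1))
    then have "((\<lambda>u. b 0 + integral {0..u} ?f) has_vector_derivative ?f t) (at t)" by simp
    then show ?case
    proof (rule has_vector_derivative_transform_within_open[of _ _ _ "{0<..<T}"])
      show "b 0 + integral {0..u} ?f = b u" if "u \<in> {0<..<T}" for u
        using beq[of u] that by simp
    qed (use t in auto)
  qed
qed

lemma linearized_stable:
  assumes y: "trajectory y" and z: "trajectory z" and \<rho>: "\<And>t. t \<in> {0..T} \<Longrightarrow> ball (y t) \<rho> \<subseteq> \<Omega>"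
    and start: "norm (z 0 - y 0) * growth < \<rho>" and b: "linearized y b" and c: "linearized z c" and t: "t \<in> {0..T}"
  shows "norm (c t - b t) \<le> (norm (c 0 - b 0) + norm (z 0 - y 0) * growth * (norm (c 0) * growth)) * growth"
proof (rule gronwall_vector[where \<tau> = T and y = "\<lambda>t. c t - b t" and f = "\<lambda>r. A r (z r) (c r) - A r (y r) (b r)"])
  have bi: "(\<lambda>r. A r (y r) (b r)) integrable_on {0..T}" and ci: "(\<lambda>r. A r (z r) (c r)) integrable_on {0..T}"
    using b c unfolding linearized_def by blast+
  show "(\<lambda>r. A r (z r) (c r) - A r (y r) (b r)) integrable_on {0..T}" by (intro integrable_diff bi ci)
  show "c t - b t = c 0 - b 0 + integral {0..t} (\<lambda>r. A r (z r) (c r) - A r (y r) (b r))" if t: "t \<in> {0..T}" for t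
  proof -
    have "b t = b 0 + integral {0..t} (\<lambda>r. A r (y r) (b r))" "c t = c 0 + integral {0..t} (\<lambda>r. A r (z r) (c r))"
      using b c t unfolding linearized_def by blast+
    moreover have "integral {0..t} (\<lambda>r. A r (z r) (c r) - A r (y r) (b r))
        = integral {0..t} (\<lambda>r. A r (z r) (c r)) - integral {0..t} (\<lambda>r. A r (y r) (b r))"
      by (intro integral_diff integrable_on_initial[OF _ t] bi ci)
    ultimately show ?thesis by (simp only:) simp
  qed
  show "AE r in lebesgue_on {0<..<T}. norm (A r (z r) (c r) - A r (y r) (b r)) \<le>
      M r * (norm (c r - b r) + norm (z 0 - y 0) * growth * (norm (c 0) * growth))"
    using A_bound A_lip AE_space
  proof eventually_elim
    case (elim r)
    then have r: "r \<in> {0..T}" by auto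
    note sep = trajectory_separation[OF y z \<rho> start r]
    have yr: "y r \<in> \<Omega>" using y r unfolding trajectory_def by blast
    have eq: "A r (z r) (c r) - A r (y r) (b r) = A r (y r) (c r - b r) + (A r (z r) (c r) - A r (y r) (c r))"
      using linear_diff[OF A_lin, of r "y r" "c r" "b r"] by simp
    have 1: "norm (A r (y r) (c r - b r)) \<le> M r * norm (c r - b r)"
      by (rule elim(1)[rule_format, OF yr])
    have "norm (A r (z r) (c r) - A r (y r) (c r)) \<le> M r * norm (z r - y r) * norm (c r)"
      by (rule elim(2)[rule_format, OF \<rho>[OF r] sep(2)])
    also have "\<dots> = M r * (norm (z r - y r) * norm (c r))" by simp
    also have "\<dots> \<le> M r * ((norm (z 0 - y 0) * growth) * (norm (c 0) * growth))"
      using growth_ge_1 by (intro mult_left_mono mult_mono sep(1) linearized_growth[OF z c r] M_nonneg) auto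
    finally have 2: "norm (A r (z r) (c r) - A r (y r) (c r)) \<le> M r * ((norm (z 0 - y 0) * growth) * (norm (c 0) * growth))" .
    show ?case unfolding eq distrib_left by (rule norm_triangle_mono[OF 1 2])
  qed
qed (use t growth_ge_1 in simp_all)

text \<open>A family of trajectories whose initial values are differentiable in the parameter is differentiable in the
  parameter at all times, and its derivative solves the linearized equation.\<close>

theorem flow_differentiable_in_parameter:
  fixes X :: "real \<Rightarrow> real \<Rightarrow> 'a"
  assumes \<Omega>: "open \<Omega>" and X: "\<And>\<sigma>. \<sigma> \<in> {a..b} \<Longrightarrow> trajectory (\<lambda>t. X t \<sigma>)" and ab: "a < b" and s: "s \<in> {a..b}"
    and der: "(X 0 has_vector_derivative g) (at s within {a..b})"
  obtains w where "linearized (\<lambda>t. X t s) w" "w 0 = g"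
    "\<And>t. t \<in> {0..T} \<Longrightarrow> (X t has_vector_derivative w t) (at s within {a..b})"
proof -
  define y where "y t = X t s" for t
  have y: "trajectory y" using X[OF s] by (simp add: y_def[abs_def])
  obtain \<rho> where \<rho>: "\<rho> > 0" "\<And>t. t \<in> {0..T} \<Longrightarrow> ball (y t) \<rho> \<subseteq> \<Omega>"
    using trajectory_tube[OF y \<Omega>] by blast
  define L where "L = norm g + 1"
  have L: "L > 0" by (simp add: L_def add_nonneg_pos)
  have gr: "growth > 0" using growth_ge_1 by linarith
  obtain d0 where d0: "d0 > 0" "\<And>\<sigma>. \<sigma> \<in> {a..b} \<Longrightarrow> norm (\<sigma> - s) < d0 \<Longrightarrow>
      norm (X 0 \<sigma> - X 0 s - (\<sigma> - s) *\<^sub>R g) \<le> 1 * norm (\<sigma> - s)"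
    using der zero_less_one unfolding has_vector_derivative_def has_derivative_within_alt by blast
  \<comment> \<open>Within distance \<open>d\<close> of \<open>s\<close> the increments at time \<open>0\<close> are at most \<open>L\<close> times those of the parameter, and the
    trajectories stay in the tube.\<close>
  define d where "d = min d0 (\<rho> / (L * growth))"
  have d: "d > 0" using d0 \<rho> L gr by (simp add: d_def)
  define good where "good \<sigma> \<longleftrightarrow> \<sigma> \<in> {a..b} \<and> \<sigma> \<noteq> s \<and> \<bar>\<sigma> - s\<bar> < d" for \<sigma>
  have lip0: "norm (X 0 \<sigma> - y 0) \<le> L * \<bar>\<sigma> - s\<bar>" if "good \<sigma>" for \<sigma>
  proof -
    have "norm (X 0 \<sigma> - X 0 s - (\<sigma> - s) *\<^sub>R g) \<le> \<bar>\<sigma> - s\<bar>" using d0(2)[of \<sigma>] that by (auto simp: good_def d_def)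
    moreover have "norm (X 0 \<sigma> - X 0 s) \<le> norm ((\<sigma> - s) *\<^sub>R g) + norm (X 0 \<sigma> - X 0 s - (\<sigma> - s) *\<^sub>R g)"
      by (rule norm_triangle_sub)
    moreover have "norm ((\<sigma> - s) *\<^sub>R g) + \<bar>\<sigma> - s\<bar> = L * \<bar>\<sigma> - s\<bar>"
      by (simp only: norm_scaleR real_norm_def L_def) (simp add: algebra_simps)
    ultimately show ?thesis unfolding y_def by linarith
  qed
  have start: "norm (X 0 \<sigma> - y 0) * growth < \<rho>" if "good \<sigma>" for \<sigma>
  proof -
    have "norm (X 0 \<sigma> - y 0) * growth \<le> (L * \<bar>\<sigma> - s\<bar>) * growth" using lip0[OF that] gr by (intro mult_right_mono) auto
    also have "\<dots> = \<bar>\<sigma> - s\<bar> * (L * growth)" by simp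
    also have "\<dots> < \<rho>" using that L gr by (simp add: good_def d_def pos_less_divide_eq)
    finally show ?thesis .
  qed
  have tr: "trajectory (\<lambda>t. X t \<sigma>)" if "good \<sigma>" for \<sigma> using X that by (simp add: good_def)
  define D where "D \<sigma> t = (X t \<sigma> - y t) /\<^sub>R (\<sigma> - s)" for \<sigma> t
  define C where "C = (L * growth)\<^sup>2"
  have close: "norm (D \<sigma>1 t - D \<sigma>2 t) \<le> (norm (D \<sigma>1 0 - D \<sigma>2 0) + C * (\<bar>\<sigma>1 - s\<bar> + \<bar>\<sigma>2 - s\<bar>)) * growth"
    if "good \<sigma>1" "good \<sigma>2" "t \<in> {0..T}" for \<sigma>1 \<sigma>2 t
    unfolding D_def C_def using that
    by (intro difference_quotients_close[OF y tr[OF that(1)] tr[OF that(2)] \<rho>(2)] start lip0) (auto simp: good_def)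
  define e where "e \<sigma> = norm (D \<sigma> 0 - g) + C * \<bar>\<sigma> - s\<bar>" for \<sigma>
  have close': "norm (D \<sigma>1 t - D \<sigma>2 t) \<le> (e \<sigma>1 + e \<sigma>2) * growth" if "good \<sigma>1" "good \<sigma>2" "t \<in> {0..T}" for \<sigma>1 \<sigma>2 t
  proof -
    have "norm (D \<sigma>1 0 - D \<sigma>2 0) + C * (\<bar>\<sigma>1 - s\<bar> + \<bar>\<sigma>2 - s\<bar>) \<le> e \<sigma>1 + e \<sigma>2"
      using norm_triangle_ineq4[of "D \<sigma>1 0 - g" "D \<sigma>2 0 - g"] by (simp add: e_def algebra_simps)
    then show ?thesis using close[OF that] gr by (meson mult_right_mono less_imp_le order_trans)
  qed
  have D0: "((\<lambda>\<sigma>. D \<sigma> 0) \<longlongrightarrow> g) (at s within {a..b})"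
    using der unfolding has_vector_derivative_iff_tendsto D_def y_def .
  have elim0: "(e \<longlongrightarrow> 0) (at s within {a..b})"
  proof -
    have "((\<lambda>\<sigma>. norm (D \<sigma> 0 - g) + C * \<bar>\<sigma> - s\<bar>) \<longlongrightarrow> norm (g - g) + C * \<bar>s - s\<bar>) (at s within {a..b})"
      by (intro tendsto_intros D0)
    then show ?thesis by (simp add: e_def[abs_def])
  qed
  \<comment> \<open>The limit is first taken along a sequence of parameters; the rate extends it to all parameters near \<open>s\<close>.\<close>
  obtain \<sigma>0 where \<sigma>0: "\<And>n. \<sigma>0 n \<in> {a..b} - {s}" "\<sigma>0 \<longlonglongrightarrow> s"
    using islimpt_sequential[of s "{a..b}"] islimpt_Icc[OF ab] s by auto
  obtain n0 where n0: "\<And>n. n \<ge> n0 \<Longrightarrow> \<bar>\<sigma>0 n - s\<bar> < d"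
    using \<sigma>0(2) d unfolding LIMSEQ_def dist_real_def by blast
  define \<sigma> where "\<sigma> n = \<sigma>0 (n + n0)" for n
  have \<sigma>: "good (\<sigma> n)" for n using \<sigma>0(1)[of "n + n0"] n0[of "n + n0"] by (simp add: \<sigma>_def good_def)
  have \<sigma>_lim: "\<sigma> \<longlonglongrightarrow> s" unfolding \<sigma>_def by (rule LIMSEQ_ignore_initial_segment[OF \<sigma>0(2)])
  have \<sigma>_in: "\<sigma> n \<in> {a..b} - {s}" for n using \<sigma>[of n] by (simp add: good_def)
  have along: "(\<lambda>n. f (\<sigma> n)) \<longlonglongrightarrow> l" if "(f \<longlongrightarrow> l) (at s within {a..b})" for f :: "real \<Rightarrow> 'z::topological_space" and l
    using that \<sigma>_in \<sigma>_lim unfolding tendsto_at_iff_sequentially o_def by blast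
  have e_lim: "(\<lambda>n. e (\<sigma> n)) \<longlonglongrightarrow> 0" by (rule along[OF elim0])
  have "Cauchy (\<lambda>n. D (\<sigma> n) t)" if t: "t \<in> {0..T}" for t
  proof (rule CauchyI)
    fix \<epsilon> :: real assume \<epsilon>: "0 < \<epsilon>"
    have "(\<lambda>n. e (\<sigma> n) * growth) \<longlonglongrightarrow> 0 * growth" by (intro tendsto_intros e_lim)
    then have "\<forall>\<^sub>F n in sequentially. e (\<sigma> n) * growth < \<epsilon> / 2" 
      by (rule order_tendstoD(2)) (use \<epsilon> in simp)
    then obtain n1 where n1: "\<And>n. n \<ge> n1 \<Longrightarrow> e (\<sigma> n) * growth < \<epsilon> / 2"
      unfolding eventually_sequentially by blast
    show "\<exists>M. \<forall>m\<ge>M. \<forall>n\<ge>M. norm (D (\<sigma> m) t - D (\<sigma> n) t) < \<epsilon>"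
    proof (intro exI allI impI)
      fix m n assume "m \<ge> n1" "n \<ge> n1"
      then show "norm (D (\<sigma> m) t - D (\<sigma> n) t) < \<epsilon>"
        using close'[OF \<sigma> \<sigma> t, of m n] n1[of m] n1[of n] by (simp add: distrib_right)
    qed
  qed
  then have "\<exists>l. (\<lambda>n. D (\<sigma> n) t) \<longlonglongrightarrow> l" if "t \<in> {0..T}" for t
    using that Cauchy_convergent_iff convergent_def by blast
  then obtain w where w: "\<And>t. t \<in> {0..T} \<Longrightarrow> (\<lambda>n. D (\<sigma> n) t) \<longlonglongrightarrow> w t" by metis
  have T0: "0 \<in> {0..T}" using T by simp
  have w0: "w 0 = g" using w[OF T0] along[OF D0] by (rule LIMSEQ_unique)
  have rate: "norm (D \<tau> t - w t) \<le> e \<tau> * growth" if "good \<tau>" "t \<in> {0..T}" for \<tau> t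
  proof (rule LIMSEQ_le)
    show "(\<lambda>n. norm (D \<tau> t - D (\<sigma> n) t)) \<longlonglongrightarrow> norm (D \<tau> t - w t)"
      by (intro tendsto_intros w that)
    have "(\<lambda>n. (e \<tau> + e (\<sigma> n)) * growth) \<longlonglongrightarrow> (e \<tau> + 0) * growth" by (intro tendsto_intros e_lim)
    then show "(\<lambda>n. (e \<tau> + e (\<sigma> n)) * growth) \<longlonglongrightarrow> e \<tau> * growth" by simp
    show "\<exists>N. \<forall>n\<ge>N. norm (D \<tau> t - D (\<sigma> n) t) \<le> (e \<tau> + e (\<sigma> n)) * growth"
      using close'[OF that(1) \<sigma> that(2)] by blast
  qed
  have derX: "(X t has_vector_derivative w t) (at s within {a..b})" if t: "t \<in> {0..T}" for t
  proof -
    have "((\<lambda>\<tau>. D \<tau> t - w t) \<longlongrightarrow> 0) (at s within {a..b})"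
    proof (rule Lim_null_comparison)
      show "\<forall>\<^sub>F \<tau> in at s within {a..b}. norm (D \<tau> t - w t) \<le> e \<tau> * growth"
        unfolding eventually_at using d rate[OF _ t] by (intro exI[of _ d]) (auto simp: good_def dist_real_def)
      show "((\<lambda>\<tau>. e \<tau> * growth) \<longlongrightarrow> 0) (at s within {a..b})"
        using tendsto_mult_right[OF elim0, of growth] by simp
    qed
    then show ?thesis
      unfolding has_vector_derivative_iff_tendsto using Lim_null[of "\<lambda>\<tau>. D \<tau> t" "w t"] by (simp add: D_def y_def)
  qed
  have lin: "(\<lambda>r. A r (y r) (w r)) integrable_on {0..t} \<and> w t = w 0 + integral {0..t} (\<lambda>r. A r (y r) (w r))"
    if t: "t \<in> {0..T}" for t
  proof -
    define f where "f n r = (V r (X r (\<sigma> n)) - V r (y r)) /\<^sub>R (\<sigma> n - s)" for n r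
    have fi: "f n integrable_on {0..t}" for n
      unfolding f_def by (rule integrable_on_initial[OF difference_quotient_integral(1)[OF y tr[OF \<sigma>]] t])
    have Df: "D (\<sigma> n) t = D (\<sigma> n) 0 + integral {0..t} (f n)" for n
      unfolding D_def f_def by (rule difference_quotient_integral(2)[OF y tr[OF \<sigma>] t])
    have bound: "AE r in lebesgue_on {0<..<T}. norm (f n r) \<le> L * growth * M r" for n
      using V_lip AE_space
    proof eventually_elim
      case (elim r)
      then have r: "r \<in> {0..T}" by auto
      note sep = trajectory_separation[OF y tr[OF \<sigma>] \<rho>(2) start[OF \<sigma>] r]
      have h: "\<bar>\<sigma> n - s\<bar> > 0" using \<sigma>[of n] by (simp add: good_def)
      have "norm (X r (\<sigma> n) - y r) \<le> (L * \<bar>\<sigma> n - s\<bar>) * growth"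
        using sep(1)[of n] lip0[OF \<sigma>, of n] gr by (meson mult_right_mono less_imp_le order_trans)
      then have "norm (V r (X r (\<sigma> n)) - V r (y r)) \<le> M r * ((L * \<bar>\<sigma> n - s\<bar>) * growth)"
        using elim(1)[rule_format, OF \<rho>(2)[OF r] sep(2)[of n]] M_nonneg[of r] by (meson mult_left_mono order_trans)
      then have "norm (V r (X r (\<sigma> n)) - V r (y r)) / \<bar>\<sigma> n - s\<bar> \<le> L * growth * M r"
        using h by (simp add: divide_le_eq mult_ac)
      then show ?case by (simp add: f_def divide_inverse_commute)
    qed
    have conv: "AE r in lebesgue_on {0<..<T}. (\<lambda>n. f n r) \<longlonglongrightarrow> A r (y r) (w r)"
      using V_taylor A_bound AE_space
    proof eventually_elim
      case (elim r)
      then have r: "r \<in> {0..T}" by auto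
      have yr: "y r \<in> \<Omega>" using y r unfolding trajectory_def by blast
      have "(\<lambda>n. f n r - A r (y r) (w r)) \<longlonglongrightarrow> 0"
      proof (rule Lim_null_comparison)
        show "\<forall>\<^sub>F n in sequentially. norm (f n r - A r (y r) (w r)) \<le> M r * (C * \<bar>\<sigma> n - s\<bar>) + M r * norm (D (\<sigma> n) r - w r)"
        proof (intro always_eventually allI)
          fix n
          have 1: "norm (f n r - A r (y r) (D (\<sigma> n) r)) \<le> M r * (C * \<bar>\<sigma> n - s\<bar>)"
            unfolding f_def D_def C_def
            by (rule difference_quotient_remainder[OF y tr[OF \<sigma>] \<rho>(2) start[OF \<sigma>] _ lip0[OF \<sigma>] r elim(1)])
              (use \<sigma>[of n] in \<open>auto simp: good_def\<close>)
          have 2: "norm (A r (y r) (D (\<sigma> n) r - w r)) \<le> M r * norm (D (\<sigma> n) r - w r)"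
            by (rule elim(2)[rule_format, OF yr])
          have eq: "f n r - A r (y r) (w r) = (f n r - A r (y r) (D (\<sigma> n) r)) + A r (y r) (D (\<sigma> n) r - w r)"
            using linear_diff[OF A_lin, of r "y r" "D (\<sigma> n) r" "w r"] by simp
          show "norm (f n r - A r (y r) (w r)) \<le> M r * (C * \<bar>\<sigma> n - s\<bar>) + M r * norm (D (\<sigma> n) r - w r)"
            unfolding eq by (rule norm_triangle_mono[OF 1 2])
        qed
        have "(\<lambda>n. M r * (C * \<bar>\<sigma> n - s\<bar>) + M r * norm (D (\<sigma> n) r - w r)) \<longlonglongrightarrow> M r * (C * \<bar>s - s\<bar>) + M r * norm (w r - w r)"
          by (intro tendsto_intros \<sigma>_lim w r)
        then show "(\<lambda>n. M r * (C * \<bar>\<sigma> n - s\<bar>) + M r * norm (D (\<sigma> n) r - w r)) \<longlonglongrightarrow> 0" by simp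
      qed
      then show ?case by (simp add: Lim_null[of _ "A r (y r) (w r)"])
    qed
    have sub: "0 \<le> (0::real)" "t \<le> T" using t by auto
    have Mi: "(\<lambda>r. L * growth * M r) integrable_on {0..t}" by (intro integrable_on_mult_right M_int_sub sub)
    note dc = dominated_convergence_AE[OF fi Mi AE_sub[OF bound sub] AE_sub[OF conv sub]]
    have "(\<lambda>n. D (\<sigma> n) 0 + integral {0..t} (f n)) \<longlonglongrightarrow> w 0 + integral {0..t} (\<lambda>r. A r (y r) (w r))"
      by (intro tendsto_add w[OF T0] dc(2))
    then have "(\<lambda>n. D (\<sigma> n) t) \<longlonglongrightarrow> w 0 + integral {0..t} (\<lambda>r. A r (y r) (w r))" by (simp only: Df)
    then show ?thesis using dc(1) LIMSEQ_unique[OF w[OF t]] by blast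
  qed
  show ?thesis
  proof (rule that[of w])
    show "linearized (\<lambda>t. X t s) w"
      unfolding linearized_def y_def[symmetric]
    proof (intro conjI ballI)
      have "T \<in> {0..T}" using T by simp
      from lin[OF this] show "(\<lambda>r. A r (y r) (w r)) integrable_on {0..T}" by (rule conjunct1)
      show "w t = w 0 + integral {0..t} (\<lambda>r. A r (y r) (w r))" if "t \<in> {0..T}" for t
        using lin[OF that] by (rule conjunct2)
    qed
  qed (fact w0, fact derX)
qed

end

section \<open>Curves in the Sobolev space of order two\<close>

lemma continuous_on_eq_if_AE_eq:
  fixes f g :: "'a::euclidean_space \<Rightarrow> 'b::real_normed_vector"
  assumes "open \<Omega>" "continuous_on \<Omega> f" "continuous_on \<Omega> g" "AE x in lebesgue_on \<Omega>. f x = g x" "x \<in> \<Omega>"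
  shows "f x = g x"
proof -
  have "norm (f x - g x) \<le> 0"
  proof (rule continuous_AE_bound[OF assms(1) _ _ assms(5)])
    show "continuous_on \<Omega> (\<lambda>x. f x - g x)" by (intro continuous_intros assms)
    show "AE x in lebesgue_on \<Omega>. norm (f x - g x) \<le> 0" using assms(4) by eventually_elim simp
  qed
  then show ?thesis by simp
qed

text \<open>The derivative of \<open>\<gamma>\<close> is Lipschitz in the open interval and so extends continuously to the end points; the
  fundamental theorem of calculus gives the one-sided derivatives there.\<close>

theorem sobolev_curve_C1:
  fixes \<gamma> :: "real \<Rightarrow> 'b::euclidean_space"
  assumes ab: "a < b" and \<gamma>: "\<gamma> \<in> sobolev_inf 2 {a<..<b}" "continuous_on {a..b} \<gamma>"
    and \<gamma>': "\<gamma>' = cont_rep {a..b} (weak_deriv {a<..<b} [1] \<gamma>)"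
  shows "continuous_on {a..b} \<gamma>'"
    "s \<in> {a..b} \<Longrightarrow> (\<gamma> has_vector_derivative \<gamma>' s) (at s within {a..b})"
proof -
  let ?\<Omega> = "{a<..<b}"
  define m where "m = enn2real (sobolev_inf_norm 2 ?\<Omega> \<gamma>)"
  define W where "W bs = cont_rep ?\<Omega> (weak_deriv ?\<Omega> bs \<gamma>)" for bs
  have op: "open ?\<Omega>" by simp
  have Wdef: "W = (\<lambda>bs. cont_rep ?\<Omega> (weak_deriv ?\<Omega> bs \<gamma>))" by (simp add: W_def[abs_def])
  have bs0: "[] \<in> lists (Basis :: real set)" "length ([] :: real list) < 2" "Suc (length ([] :: real list)) < 2" by auto
  have bs1: "[1] \<in> lists (Basis :: real set)" "length [1 :: real] < 2" by auto
  note W0 = sobolev_cont_rep[OF \<gamma>(1) op bs0(1,2), folded W_def]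
  note W1 = sobolev_cont_rep[OF \<gamma>(1) op bs1, folded W_def]
  note lip = sobolev_cont_rep_lipschitz[OF \<gamma>(1) op m_def Wdef bs1]
  \<comment> \<open>Two points of the interval lie in a ball about their midpoint that is contained in it.\<close>
  have lip': "norm (W [1] y - W [1] x) \<le> m * norm (y - x)" if xy: "x \<in> ?\<Omega>" "y \<in> ?\<Omega>" for x y
  proof -
    define c where "c = (x + y) / 2"
    define r where "r = min (c - a) (b - c)"
    have sub: "ball c r \<subseteq> ?\<Omega>" by (auto simp: r_def dist_real_def)
    have "x \<in> ball c r" "y \<in> ball c r" using xy by (auto simp: r_def c_def dist_real_def field_simps)
    then have le: "norm (W [1] x - W [1] c) \<le> m * norm (x - c)" "norm (W [1] y - W [1] c) \<le> m * norm (y - c)"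
      using lip[OF sub] by auto
    have "norm (x - c) = norm (y - x) / 2" "norm (y - c) = norm (y - x) / 2"
      by (auto simp: c_def field_simps abs_real_def)
    then have "m * norm (x - c) + m * norm (y - c) = m * norm (y - x)"
      by (simp only: distrib_left[symmetric] field_sum_of_halves)
    moreover have "norm (W [1] y - W [1] x) \<le> norm (W [1] y - W [1] c) + norm (W [1] x - W [1] c)"
      using norm_triangle_ineq4[of "W [1] y - W [1] c" "W [1] x - W [1] c"] by simp
    ultimately show ?thesis using le by linarith
  qed
  have "uniformly_continuous_on ?\<Omega> (W [1])"
    by (rule lipschitz_on_uniformly_continuous[of m])
      (use lip' in \<open>auto intro!: lipschitz_onI simp: dist_norm m_def\<close>)
  then obtain g where g: "uniformly_continuous_on (closure ?\<Omega>) g" "\<And>x. x \<in> ?\<Omega> \<Longrightarrow> W [1] x = g x"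
    using uniformly_continuous_on_extension_on_closure by metis
  have "continuous_on {a..b} g"
    using uniformly_continuous_imp_continuous[OF g(1)] ab by simp
  moreover have "AE x in lebesgue_on {a..b}. g x = weak_deriv ?\<Omega> [1] \<gamma> x"
  proof -
    obtain N where N: "negligible N" "\<And>x. x \<in> ?\<Omega> \<Longrightarrow> x \<notin> N \<Longrightarrow> W [1] x = weak_deriv ?\<Omega> [1] \<gamma> x"
      using W1(2) by (rule AE_lebesgue_onE) auto
    show ?thesis
    proof (rule AE_lebesgue_onI)
      show "negligible (N \<union> {a, b})" using N(1) by simp
      show "g x = weak_deriv ?\<Omega> [1] \<gamma> x" if "x \<in> {a..b}" "x \<notin> N \<union> {a, b}" for x
        using N(2)[of x] g(2)[of x] that by auto
    qed simp
  qed
  ultimately have "continuous_on {a..b} \<gamma>' \<and> (AE x in lebesgue_on {a..b}. \<gamma>' x = weak_deriv ?\<Omega> [1] \<gamma> x)"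
    unfolding \<gamma>' cont_rep_def
    by (intro someI[of "\<lambda>w. continuous_on {a..b} w \<and> (AE x in lebesgue_on {a..b}. w x = weak_deriv ?\<Omega> [1] \<gamma> x)" g] conjI)
  then have c': "continuous_on {a..b} \<gamma>'" and ae': "AE x in lebesgue_on {a..b}. \<gamma>' x = weak_deriv ?\<Omega> [1] \<gamma> x" by auto
  show "continuous_on {a..b} \<gamma>'" by (rule c')
  have W1eq: "W [1] x = \<gamma>' x" if "x \<in> ?\<Omega>" for x
  proof (rule continuous_on_eq_if_AE_eq[OF op W1(1) _ _ that])
    show "continuous_on ?\<Omega> \<gamma>'" by (rule continuous_on_subset[OF c']) auto
    have "AE x in lebesgue_on ?\<Omega>. \<gamma>' x = weak_deriv ?\<Omega> [1] \<gamma> x"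
      by (rule AE_lebesgue_on_subset[OF ae']) auto
    then show "AE x in lebesgue_on ?\<Omega>. W [1] x = \<gamma>' x" using W1(2) by eventually_elim simp
  qed
  have W0eq: "W [] x = \<gamma> x" if "x \<in> ?\<Omega>" for x
  proof (rule continuous_on_eq_if_AE_eq[OF op W0(1) _ _ that])
    show c: "continuous_on ?\<Omega> \<gamma>" by (rule continuous_on_subset[OF \<gamma>(2)]) auto
    have "locally_integrable_on \<gamma> ?\<Omega>"
      unfolding locally_integrable_on_def
      by (auto intro!: set_integrable_subset[OF absolutely_integrable_continuous_real[OF \<gamma>(2)]] dest: lmeasurable_compact simp: fmeasurableD)
    then have "has_weak_deriv ?\<Omega> [] \<gamma> \<gamma>" by (simp add: has_weak_deriv_def)
    moreover have "has_weak_deriv ?\<Omega> [] \<gamma> (weak_deriv ?\<Omega> [] \<gamma>)"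
      by (rule sobolev_weak_deriv(1)[OF \<gamma>(1) op]) (simp add: multi_indices_def)
    ultimately have "AE x in lebesgue_on ?\<Omega>. \<gamma> x = weak_deriv ?\<Omega> [] \<gamma> x"
      using has_weak_deriv_unique[OF op] by blast
    then show "AE x in lebesgue_on ?\<Omega>. W [] x = \<gamma> x" using W0(2) by eventually_elim simp
  qed
  have der: "(\<gamma> has_vector_derivative \<gamma>' x) (at x)" if x: "x \<in> ?\<Omega>" for x
  proof -
    obtain r where r: "r > 0" "ball x r \<subseteq> ?\<Omega>" using x open_contains_ball[of ?\<Omega>] op by metis
    have bd: "norm (\<gamma> y - \<gamma> x - (y - x) *\<^sub>R \<gamma>' x) \<le> m * (norm (y - x))\<^sup>2" if y: "y \<in> ball x r" for y
      using sobolev_cont_rep_taylor[OF \<gamma>(1) op m_def Wdef bs0(1,3) r(2) y] W0eq[OF x] W1eq[OF x] W0eq[of y] r(2) y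
      by (auto simp: subset_iff)
    have "((\<lambda>y. (\<gamma> y - \<gamma> x) /\<^sub>R (y - x) - \<gamma>' x) \<longlongrightarrow> 0) (at x)"
    proof (rule Lim_null_comparison)
      show "\<forall>\<^sub>F y in at x. norm ((\<gamma> y - \<gamma> x) /\<^sub>R (y - x) - \<gamma>' x) \<le> m * norm (y - x)"
        unfolding eventually_at
      proof (intro exI[of _ r] conjI ballI impI r(1))
        fix y assume y: "y \<noteq> x \<and> dist y x < r"
        have "(\<gamma> y - \<gamma> x) /\<^sub>R (y - x) - \<gamma>' x = (\<gamma> y - \<gamma> x - (y - x) *\<^sub>R \<gamma>' x) /\<^sub>R (y - x)"
          using y by (simp add: scaleR_right_diff_distrib)
        then have "norm ((\<gamma> y - \<gamma> x) /\<^sub>R (y - x) - \<gamma>' x) = norm (\<gamma> y - \<gamma> x - (y - x) *\<^sub>R \<gamma>' x) / norm (y - x)"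
          by (simp add: divide_inverse_commute)
        also have "\<dots> \<le> m * (norm (y - x))\<^sup>2 / norm (y - x)"
          using y by (intro divide_right_mono bd) (auto simp: dist_commute)
        also have "\<dots> = m * norm (y - x)"
        proof -
          have "norm (y - x) \<noteq> 0" using y by simp
          then show ?thesis
            unfolding power2_eq_square mult.assoc[symmetric] by (rule nonzero_mult_div_cancel_right)
        qed
        finally show "norm ((\<gamma> y - \<gamma> x) /\<^sub>R (y - x) - \<gamma>' x) \<le> m * norm (y - x)" .
      qed
      have "((\<lambda>y. m * norm (y - x)) \<longlongrightarrow> m * norm (x - x)) (at x)" by (intro tendsto_intros)
      then show "((\<lambda>y. m * norm (y - x)) \<longlongrightarrow> 0) (at x)" by simp
    qed
    then show ?thesis
      unfolding has_vector_derivative_iff_tendsto using Lim_null[of "\<lambda>y. (\<gamma> y - \<gamma> x) /\<^sub>R (y - x)" "\<gamma>' x"] by simp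
  qed
  assume s: "s \<in> {a..b}"
  have "((\<lambda>u. \<gamma> a + integral {a..u} \<gamma>') has_vector_derivative 0 + \<gamma>' s) (at s within {a..b})"
    by (intro has_vector_derivative_add has_vector_derivative_const integral_has_vector_derivative[OF c' s])
  then have "((\<lambda>u. \<gamma> a + integral {a..u} \<gamma>') has_vector_derivative \<gamma>' s) (at s within {a..b})" by simp
  then show "(\<gamma> has_vector_derivative \<gamma>' s) (at s within {a..b})"
  proof (rule has_vector_derivative_transform[OF s, rotated])
    fix u assume u: "u \<in> {a..b}"
    have "(\<gamma>' has_integral (\<gamma> u - \<gamma> a)) {a..u}"
      by (rule fundamental_theorem_of_calculus_interior) (use u der continuous_on_subset[OF \<gamma>(2)] in auto)
    from integral_unique[OF this] show "\<gamma> u = \<gamma> a + integral {a..u} \<gamma>'" by simp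
  qed
qed

section \<open>The velocity field of a stream function\<close>

lemma norm_J_mult: "norm (J *v x) = norm x"
proof -
  have "(J *v x) $ 1 = - x $ 2" "(J *v x) $ 2 = x $ 1"
    by (simp_all add: J_def matrix_vector_mult_def sum_2)
  then show ?thesis by (simp add: norm_vec_def L2_set_def sum_2 add.commute)
qed

lemma sum_Basis_real2: "(\<Sum>c\<in>Basis. f (c :: real^2)) = (\<Sum>j\<in>UNIV. f (axis j 1))"
proof -
  have B: "(Basis :: (real^2) set) = (\<lambda>j. axis j 1) ` UNIV" by (auto simp: Basis_vec_def)
  have inj: "inj (\<lambda>j. axis j 1 :: real^2)" by (auto simp: inj_on_def axis_eq_axis)
  show ?thesis unfolding B sum.reindex[OF inj] o_def ..
qed

lemma norm_le_sum_2: "norm (x :: real^2) \<le> \<bar>x $ 1\<bar> + \<bar>x $ 2\<bar>"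
  using norm_le_l1_cart[of x] by (simp add: sum_2)

text \<open>The entry \<open>i j\<close> of \<open>hessian\<close> is the weak derivative in the direction \<open>j\<close> of the component \<open>i\<close> of \<open>grad\<close>, since the
  innermost index of a multi-index is differentiated first when it acts on test functions. The constant \<open>8\<close> is
  \<open>DIM\<^sup>2\<close> for the Taylor remainder of each component, summed over the two components.\<close>

lemma grad_hessian_estimates:
  fixes u :: "real^2 \<Rightarrow> real"
  assumes u: "u \<in> sobolev_inf 3 \<Omega>" and \<Omega>: "open \<Omega>"
    and m: "m = enn2real (sobolev_inf_norm 3 \<Omega> u)"
  shows "x \<in> \<Omega> \<Longrightarrow> norm ((J ** hessian \<Omega> u x) *v b) \<le> 8 * m * norm b"
    and "ball x r \<subseteq> \<Omega> \<Longrightarrow> y \<in> ball x r \<Longrightarrow>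
      norm (J *v grad \<Omega> u y - J *v grad \<Omega> u x) \<le> 8 * m * norm (y - x)"
    and "ball x r \<subseteq> \<Omega> \<Longrightarrow> y \<in> ball x r \<Longrightarrow>
      norm (J *v grad \<Omega> u y - J *v grad \<Omega> u x - (J ** hessian \<Omega> u x) *v (y - x)) \<le> 8 * m * (norm (y - x))\<^sup>2"
    and "ball x r \<subseteq> \<Omega> \<Longrightarrow> y \<in> ball x r \<Longrightarrow>
      norm ((J ** hessian \<Omega> u y) *v b - (J ** hessian \<Omega> u x) *v b) \<le> 8 * m * norm (y - x) * norm b"
proof -
  define W where "W = (\<lambda>bs. cont_rep \<Omega> (weak_deriv \<Omega> bs u))"
  have m0: "0 \<le> m" by (simp add: m)
  have g: "grad \<Omega> u x $ i = W [axis i 1] x" for x i by (simp add: grad_def W_def)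
  have h: "hessian \<Omega> u x $ i $ j = W [axis i 1, axis j 1] x" for x i j by (simp add: hessian_def W_def)
  have ax: "axis i 1 \<in> (Basis :: (real^2) set)" for i by simp
  have b1: "[axis i 1] \<in> lists (Basis :: (real^2) set)" "length [axis i 1 :: real^2] < 3" "Suc (length [axis i 1 :: real^2]) < 3" for i
    using ax by auto
  have b2: "[axis i 1, axis j 1] \<in> lists (Basis :: (real^2) set)" "length [axis i 1 :: real^2, axis j 1] < 3" for i j
    using ax by auto
  have comp: "\<bar>b $ i\<bar> \<le> norm b" for b :: "real^2" and i by (rule component_le_norm_cart)
  have hv: "(hessian \<Omega> u x *v b) $ i = W [axis i 1, axis 1 1] x * b $ 1 + W [axis i 1, axis 2 1] x * b $ 2" for x b i
    by (simp add: matrix_vector_mult_def sum_2 h)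
  show "norm ((J ** hessian \<Omega> u x) *v b) \<le> 8 * m * norm b" if x: "x \<in> \<Omega>"
  proof -
    have W2: "\<bar>W [axis i 1, axis j 1] x\<bar> \<le> m" for i j
      using sobolev_cont_rep_bound[OF u \<Omega> m W_def b2 x] by simp
    have "\<bar>(hessian \<Omega> u x *v b) $ i\<bar> \<le> m * norm b + m * norm b" for i
    proof -
      have "\<bar>W [axis i 1, axis j 1] x * b $ j\<bar> \<le> m * norm b" for j
        unfolding abs_mult by (intro mult_mono W2 comp m0) simp
      then show ?thesis unfolding hv using abs_triangle_ineq by (meson add_mono order_trans)
    qed
    from add_mono[OF this[of 1] this[of 2]] have "norm (hessian \<Omega> u x *v b) \<le> 4 * (m * norm b)"
      using norm_le_sum_2[of "hessian \<Omega> u x *v b"] by simp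
    also have "\<dots> \<le> 8 * m * norm b" using m0 by simp
    finally show ?thesis by (simp only: matrix_vector_mul_assoc[symmetric] norm_J_mult)
  qed
  assume r: "ball x r \<subseteq> \<Omega>" "y \<in> ball x r"
  show "norm (J *v grad \<Omega> u y - J *v grad \<Omega> u x) \<le> 8 * m * norm (y - x)"
  proof -
    have "\<bar>(grad \<Omega> u y - grad \<Omega> u x) $ i\<bar> \<le> 2 * m * norm (y - x)" for i
      using sobolev_cont_rep_lipschitz[OF u \<Omega> m W_def b1(1,2) r] by (simp add: g)
    from add_mono[OF this[of 1] this[of 2]]
    have "norm (grad \<Omega> u y - grad \<Omega> u x) \<le> 4 * (m * norm (y - x))"
      using norm_le_sum_2[of "grad \<Omega> u y - grad \<Omega> u x"] by simp
    also have "\<dots> \<le> 8 * m * norm (y - x)" using m0 by simp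
    finally show ?thesis by (simp only: matrix_vector_mult_diff_distrib[symmetric] norm_J_mult)
  qed
  show "norm (J *v grad \<Omega> u y - J *v grad \<Omega> u x - (J ** hessian \<Omega> u x) *v (y - x)) \<le> 8 * m * (norm (y - x))\<^sup>2"
  proof -
    let ?v = "grad \<Omega> u y - grad \<Omega> u x - hessian \<Omega> u x *v (y - x)"
    have "\<bar>?v $ i\<bar> \<le> 4 * m * (norm (y - x))\<^sup>2" for i
    proof -
      have "(\<Sum>c\<in>Basis. ((y - x) \<bullet> c) *\<^sub>R W ([axis i 1] @ [c]) x) = (hessian \<Omega> u x *v (y - x)) $ i"
        unfolding sum_Basis_real2 hv by (simp add: sum_2 inner_axis mult.commute)
      then show ?thesis
        using sobolev_cont_rep_taylor[OF u \<Omega> m W_def b1(1,3)[of i] r] by (simp add: g)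
    qed
    from add_mono[OF this[of 1] this[of 2]] have "norm ?v \<le> 8 * m * (norm (y - x))\<^sup>2"
      using norm_le_sum_2[of ?v] by simp
    then show ?thesis
      by (simp only: matrix_vector_mul_assoc[symmetric] matrix_vector_mult_diff_distrib[symmetric] norm_J_mult)
  qed
  show "norm ((J ** hessian \<Omega> u y) *v b - (J ** hessian \<Omega> u x) *v b) \<le> 8 * m * norm (y - x) * norm b"
  proof -
    let ?v = "hessian \<Omega> u y *v b - hessian \<Omega> u x *v b"
    have W2: "\<bar>W [axis i 1, axis j 1] y - W [axis i 1, axis j 1] x\<bar> \<le> 2 * m * norm (y - x)" for i j
      using sobolev_cont_rep_lipschitz[OF u \<Omega> m W_def b2 r] by simp
    have "\<bar>?v $ i\<bar> \<le> 2 * m * norm (y - x) * norm b + 2 * m * norm (y - x) * norm b" for i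
    proof -
      have 1: "\<bar>(W [axis i 1, axis j 1] y - W [axis i 1, axis j 1] x) * b $ j\<bar> \<le> 2 * m * norm (y - x) * norm b" for j
        unfolding abs_mult using m0 by (intro mult_mono W2 comp) auto
      have eq: "?v $ i = (W [axis i 1, axis 1 1] y - W [axis i 1, axis 1 1] x) * b $ 1
         + (W [axis i 1, axis 2 1] y - W [axis i 1, axis 2 1] x) * b $ 2"
        by (simp add: hv algebra_simps)
      show ?thesis unfolding eq by (rule order_trans[OF abs_triangle_ineq add_mono[OF 1 1]])
    qed
    from add_mono[OF this[of 1] this[of 2]] have "norm ?v \<le> 8 * m * norm (y - x) * norm b"
      using norm_le_sum_2[of ?v] by (simp add: mult_ac)
    then show ?thesis
      by (simp only: matrix_vector_mul_assoc[symmetric] matrix_vector_mult_diff_distrib[symmetric] norm_J_mult)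
  qed
qed

section \<open>The coupled system and the length of the interface\<close>

theorem proposition2p1:
  fixes \<Omega> :: "(real^2) set"
    and T :: real
    and \<psi> :: "real \<Rightarrow> real^2 \<Rightarrow> real"
    and \<gamma>\<^sub>0 \<gamma>\<^sub>0' :: "real \<Rightarrow> real^2"
    and \<Phi> :: "real \<Rightarrow> real^2 \<Rightarrow> real^2"
    and X a :: "real \<Rightarrow> real \<Rightarrow> real^2"
  assumes domain: "open \<Omega>" "connected \<Omega>" "\<Omega> \<noteq> {}" "bounded \<Omega>" "simply_connected \<Omega>" "C2_boundary \<Omega>"
    and T: "T > 0"
    and \<psi>: "\<psi> \<in> L2_sobolev T 3 \<Omega>"
    and \<psi>_bdry: "AE t in lebesgue_on {0<..<T}. vanishes_on_frontier \<Omega> (\<psi> t)"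
    and \<gamma>\<^sub>0: "\<gamma>\<^sub>0 \<in> sobolev_inf 2 {0<..<1}" "continuous_on {0..1} \<gamma>\<^sub>0" "\<gamma>\<^sub>0 ` {0..1} \<subseteq> \<Omega>"
    and \<gamma>\<^sub>0': "\<gamma>\<^sub>0' = cont_rep {0..1} (weak_deriv {0<..<1} [1] \<gamma>\<^sub>0)"
    and \<Phi>: "is_flow_map \<Omega> T \<psi> \<Phi>"
    and X: "X = (\<lambda>t s. \<Phi> t (\<gamma>\<^sub>0 s))"
    and a: "a = (\<lambda>t s. vector_derivative (X t) (at s within {0..1}))"
  shows "(\<forall>t\<in>{0..T}. \<forall>s\<in>{0..1}. (X t has_vector_derivative a t s) (at s within {0..1})) \<and>
     (\<forall>s\<in>{0..1}.
        caratheodory_solution (\<lambda>t y. J *v grad \<Omega> (\<psi> t) y) T (\<lambda>t. X t s) \<and>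
        caratheodory_solution (\<lambda>t b. (J ** hessian \<Omega> (\<psi> t) (X t s)) *v b) T (\<lambda>t. a t s) \<and>
        X 0 s = \<gamma>\<^sub>0 s \<and> a 0 s = \<gamma>\<^sub>0' s) \<and>
     (\<forall>t\<in>{0..T}.
        (\<lambda>s. norm (a t s)) absolutely_integrable_on {0..1} \<and>
        arc_length 0 1 (X t) = ennreal (LINT s:{0..1}|lebesgue. norm (a t s)))"
proof -
  obtain M0 where M0: "M0 integrable_on {0..T}" "\<And>t. 0 \<le> M0 t"
    "AE t in lebesgue_on {0<..<T}. \<psi> t \<in> sobolev_inf 3 \<Omega> \<and> M0 t = enn2real (sobolev_inf_norm 3 \<Omega> (\<psi> t))"
    using L2_sobolev_norm_integrable[OF \<psi> domain(1) T] by blast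
  define M where "M t = 8 * M0 t" for t
  define V where "V t x = J *v grad \<Omega> (\<psi> t) x" for t x
  define A where "A t x b = (J ** hessian \<Omega> (\<psi> t) x) *v b" for t x b
  interpret lipschitz_derivative_field \<Omega> T M V A
  proof (rule lipschitz_derivative_field.intro)
    show "M integrable_on {0..T}" unfolding M_def by (rule integrable_on_mult_right[OF M0(1)])
    show "0 \<le> M t" for t using M0(2)[of t] by (simp add: M_def)
    show "linear (A t x)" for t x unfolding A_def by (rule matrix_vector_mul_linear)
    show "AE t in lebesgue_on {0<..<T}. \<forall>x\<in>\<Omega>. \<forall>b. norm (A t x b) \<le> M t * norm b"
      using M0(3) unfolding A_def M_def
      by eventually_elim (intro ballI allI grad_hessian_estimates(1)[OF _ domain(1)], auto)
    show "AE t in lebesgue_on {0<..<T}. \<forall>x r y. ball x r \<subseteq> \<Omega> \<longrightarrow> y \<in> ball x r \<longrightarrow>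
        norm (V t y - V t x) \<le> M t * norm (y - x)"
      using M0(3) unfolding V_def M_def
      by eventually_elim (intro allI impI grad_hessian_estimates(2)[OF _ domain(1)], auto)
    show "AE t in lebesgue_on {0<..<T}. \<forall>x r y. ball x r \<subseteq> \<Omega> \<longrightarrow> y \<in> ball x r \<longrightarrow>
        norm (V t y - V t x - A t x (y - x)) \<le> M t * (norm (y - x))\<^sup>2"
      using M0(3) unfolding V_def A_def M_def
      by eventually_elim (intro allI impI grad_hessian_estimates(3)[OF _ domain(1)], auto)
    show "AE t in lebesgue_on {0<..<T}. \<forall>x r y b. ball x r \<subseteq> \<Omega> \<longrightarrow> y \<in> ball x r \<longrightarrow>
        norm (A t y b - A t x b) \<le> M t * norm (y - x) * norm b"
      using M0(3) unfolding A_def M_def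
      by eventually_elim (intro allI impI grad_hessian_estimates(4)[OF _ domain(1)], auto)
  qed (rule T)
  note \<gamma>C1 = sobolev_curve_C1[OF zero_less_one \<gamma>\<^sub>0(1,2) \<gamma>\<^sub>0']
  have car: "caratheodory_solution (\<lambda>t y. J *v grad \<Omega> (\<psi> t) y) T (\<lambda>t. X t s)" "X 0 s = \<gamma>\<^sub>0 s"
    "\<And>t. t \<in> {0..T} \<Longrightarrow> X t s \<in> \<Omega>" if "s \<in> {0..1}" for s
  proof -
    have "\<gamma>\<^sub>0 s \<in> \<Omega>" using that \<gamma>\<^sub>0(3) by blast
    then show "caratheodory_solution (\<lambda>t y. J *v grad \<Omega> (\<psi> t) y) T (\<lambda>t. X t s)" "X 0 s = \<gamma>\<^sub>0 s"
      "\<And>t. t \<in> {0..T} \<Longrightarrow> X t s \<in> \<Omega>"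
      using \<Phi> unfolding X is_flow_map_def by blast+
  qed
  have tr: "trajectory (\<lambda>t. X t s)" if "s \<in> {0..1}" for s
    using car(1,3)[OF that] unfolding trajectory_def V_def by blast
  have der0: "(X 0 has_vector_derivative \<gamma>\<^sub>0' s) (at s within {0..1})" if s: "s \<in> {0..1}" for s
    by (rule has_vector_derivative_transform[OF s _ \<gamma>C1(2)[OF s]]) (rule car(2))
  have "\<exists>w. linearized (\<lambda>t. X t s) w \<and> w 0 = \<gamma>\<^sub>0' s \<and>
     (\<forall>t\<in>{0..T}. (X t has_vector_derivative w t) (at s within {0..1}))" if s: "s \<in> {0..1}" for s
    using flow_differentiable_in_parameter[OF domain(1) tr zero_less_one s der0[OF s]] by metis
  then obtain w where w: "\<And>s. s \<in> {0..1} \<Longrightarrow> linearized (\<lambda>t. X t s) (w s)" "\<And>s. s \<in> {0..1} \<Longrightarrow> w s 0 = \<gamma>\<^sub>0' s"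
     "\<And>s t. s \<in> {0..1} \<Longrightarrow> t \<in> {0..T} \<Longrightarrow> (X t has_vector_derivative w s t) (at s within {0..1})"
    by metis
  have aw: "a t s = w s t" if "s \<in> {0..1}" "t \<in> {0..T}" for s t
    unfolding a using vector_derivative_within_cbox[of 0 1 s "X t" "w s t"] w(3)[OF that] that(1) by simp
  have der: "(X t has_vector_derivative a t s) (at s within {0..1})" if "s \<in> {0..1}" "t \<in> {0..T}" for s t
    using w(3)[OF that] aw[OF that] by simp
  have lin: "linearized (\<lambda>t. X t s) (\<lambda>t. a t s)" if s: "s \<in> {0..1}" for s
  proof -
    have "linearized (\<lambda>t. X t s) (w s)" by (rule w(1)[OF s])
    moreover have eq: "a t s = w s t" if "t \<in> {0..T}" for t by (rule aw[OF s that])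
    ultimately show ?thesis
      unfolding linearized_def
    proof (elim conjE, intro conjI ballI)
      assume i: "(\<lambda>r. A r (X r s) (w s r)) integrable_on {0..T}"
        and f: "\<forall>t\<in>{0..T}. w s t = w s 0 + integral {0..t} (\<lambda>r. A r (X r s) (w s r))"
      show "(\<lambda>r. A r (X r s) (a r s)) integrable_on {0..T}"
        by (rule integrable_eq[OF i]) (simp add: eq)
      fix t assume t: "t \<in> {0..T}"
      have "integral {0..t} (\<lambda>r. A r (X r s) (a r s)) = integral {0..t} (\<lambda>r. A r (X r s) (w s r))"
        by (rule integral_cong) (use t eq in auto)
      then show "a t s = a 0 s + integral {0..t} (\<lambda>r. A r (X r s) (a r s))"
        using f[rule_format, OF t] eq[OF t] eq[of 0] T by simp
    qed
  qed
  have a0: "a 0 s = \<gamma>\<^sub>0' s" if "s \<in> {0..1}" for s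
    using aw[OF that, of 0] w(2)[OF that] T by simp
  have cont_a: "continuous_on {0..1} (a t)" if t: "t \<in> {0..T}" for t
    unfolding continuous_on_def
  proof
    fix s :: real assume s: "s \<in> {0..1}"
    obtain \<rho> where \<rho>: "\<rho> > 0" "\<And>t. t \<in> {0..T} \<Longrightarrow> ball (X t s) \<rho> \<subseteq> \<Omega>"
      using trajectory_tube[OF tr[OF s] domain(1)] by blast
    have \<gamma>lim: "(\<gamma>\<^sub>0 \<longlongrightarrow> \<gamma>\<^sub>0 s) (at s within {0..1})" "(\<gamma>\<^sub>0' \<longlongrightarrow> \<gamma>\<^sub>0' s) (at s within {0..1})"
      using \<gamma>\<^sub>0(2) \<gamma>C1(1) s by (auto simp: continuous_on_def)
    let ?e = "\<lambda>\<sigma>. (norm (\<gamma>\<^sub>0' \<sigma> - \<gamma>\<^sub>0' s) + norm (\<gamma>\<^sub>0 \<sigma> - \<gamma>\<^sub>0 s) * growth * (norm (\<gamma>\<^sub>0' \<sigma>) * growth)) * growth"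
    have "((\<lambda>\<sigma>. a t \<sigma> - a t s) \<longlongrightarrow> 0) (at s within {0..1})"
    proof (rule Lim_null_comparison)
      have "((\<lambda>\<sigma>. norm (\<gamma>\<^sub>0 \<sigma> - \<gamma>\<^sub>0 s) * growth) \<longlongrightarrow> norm (\<gamma>\<^sub>0 s - \<gamma>\<^sub>0 s) * growth) (at s within {0..1})"
        by (intro tendsto_intros \<gamma>lim)
      then have "\<forall>\<^sub>F \<sigma> in at s within {0..1}. norm (\<gamma>\<^sub>0 \<sigma> - \<gamma>\<^sub>0 s) * growth < \<rho>"
        by (rule order_tendstoD(2)) (use \<rho>(1) in simp)
      moreover have "\<forall>\<^sub>F \<sigma> in at s within {0..1}. \<sigma> \<in> {0..1}" by (simp add: eventually_at_filter)
      ultimately show "\<forall>\<^sub>F \<sigma> in at s within {0..1}. norm (a t \<sigma> - a t s) \<le> ?e \<sigma>"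
      proof eventually_elim
        case (elim \<sigma>)
        have "norm (a t \<sigma> - a t s) \<le> (norm (a 0 \<sigma> - a 0 s) + norm (X 0 \<sigma> - X 0 s) * growth * (norm (a 0 \<sigma>) * growth)) * growth"
        proof (rule linearized_stable[OF tr[OF s] tr[OF elim(2)] \<rho>(2) _ lin[OF s] lin[OF elim(2)] t])
          show "norm (X 0 \<sigma> - X 0 s) * growth < \<rho>" using elim(1) unfolding car(2)[OF s] car(2)[OF elim(2)] .
        qed
        then show ?case unfolding a0[OF s] a0[OF elim(2)] car(2)[OF s] car(2)[OF elim(2)] .
      qed
      have "(?e \<longlongrightarrow> (norm (\<gamma>\<^sub>0' s - \<gamma>\<^sub>0' s) + norm (\<gamma>\<^sub>0 s - \<gamma>\<^sub>0 s) * growth * (norm (\<gamma>\<^sub>0' s) * growth)) * growth) (at s within {0..1})"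
        by (intro tendsto_intros \<gamma>lim)
      then show "(?e \<longlongrightarrow> 0) (at s within {0..1})" by simp
    qed
    then show "(a t \<longlongrightarrow> a t s) (at s within {0..1})" using Lim_null[of "a t" "a t s"] by simp
  qed
  have length: "(\<lambda>s. norm (a t s)) absolutely_integrable_on {0..1} \<and>
      arc_length 0 1 (X t) = ennreal (LINT s:{0..1}|lebesgue. norm (a t s))" if t: "t \<in> {0..T}" for t
  proof
    show ai: "(\<lambda>s. norm (a t s)) absolutely_integrable_on {0..1}"
      by (intro absolutely_integrable_continuous_real continuous_intros cont_a t)
    have "arc_length 0 1 (X t) = ennreal (integral {0..1} (\<lambda>s. norm (a t s)))"
      by (rule arc_length_eq_integral) (use der[OF _ t] cont_a[OF t] in auto)
    then show "arc_length 0 1 (X t) = ennreal (LINT s:{0..1}|lebesgue. norm (a t s))"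
      using set_lebesgue_integral_eq_integral(2)[OF ai] by simp
  qed
  have "caratheodory_solution (\<lambda>t b. (J ** hessian \<Omega> (\<psi> t) (X t s)) *v b) T (\<lambda>t. a t s)" if s: "s \<in> {0..1}" for s
    using linearized_caratheodory[OF tr[OF s] lin[OF s]] unfolding A_def .
  then show ?thesis using der car(1,2) a0 length by blast
qed

end
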